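(* Let $a>0$. The Fourier transform $F\mapsto\widehat F$ is a bijection between the space $\mathcal C^\infty_{[-a,a]}(\mathrm{HC})$ and the space of entire holomorphic functions $A:\mathbb C\to\mathcal H$ satisfying the following growth condition: for every $N\in\mathbb N$ and every $u\in\mathfrak U(\mathfrak{hc})$ there is a constant $C_{N,u}$ such that $$\big|\zeta^{-[n]}\,T\big(A(\zeta)\,d\pi_{-\zeta}(u)\big)\big|\le C_{N,u}\,(1+|\zeta|)^{-N}e^{a|\mathrm{Im}(\zeta)|}\qquad\text{for all }\zeta\in\mathbb C\setminus\{0\}.$$
   Context: Algebra. Let $V$ be a purely odd real super vector space of dimension $n\ge 1$ with a positive definite symmetric bilinear form $\beta$, and fix an orthonormal basis $a_1,\dots,a_n$. The Heisenberg--Clifford Lie superalgebra is $\mathfrak{hc}=V\oplus\mathbb R z$ with $z$ even and central, $V$ odd, and $[u+\lambda z,v+\mu z]=2\beta(u,v)z$. Its universal enveloping algebra $\mathfrak U(\mathfrak{hc})$ is the unital real superalgebra generated by odd $a_1,\dots,a_n$ and an even central element $z$ with $a_ia_j=-a_ja_i$ ($i\ne j$) and $a_i^2=z$. Put $\gamma=a_1\cdots a_n$. The coproduct $\Delta:\mathfrak U(\mathfrak{hc})\to\mathfrak U(\mathfrak{hc})\otimes\mathfrak U(\mathfrak{hc})$ is the even unital algebra homomorphism with $\Delta(x)=x\otimes1+1\otimes x$ for $x\in\mathfrak{hc}$, where $(a\otimes b)(c\otimes d)=(-1)^{|b||c|}ac\otimes bd$ ($|\cdot|$ denotes parity). Write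 $\Delta(\gamma)=\sum_i\gamma_i^{(1)}\otimes\gamma_i^{(2)}$ with homogeneous terms. Functions. $\mathcal C^\infty(\mathrm{HC})$ is the space of linear maps $F:\mathfrak U(\mathfrak{hc})\to C^\infty(\mathbb R)$ (complex-valued functions) with $F(zu)=F(u)'$ for all $u$; write $F(u;x)=F(u)(x)$. $\mathcal C^\infty_{[-a,a]}(\mathrm{HC})$ is the subspace of those $F$ with $\mathrm{supp}\,F(u)\subset[-a,a]$ for all $u\in\mathfrak U(\mathfrak{hc})$. Representations. For $\zeta\in\mathbb C$ put $\sigma=\begin{pmatrix}1&0\\0&-1\end{pmatrix}$, $X_\zeta=\begin{pmatrix}0&\zeta\\1&0\end{pmatrix}$, $Y_\zeta=\begin{pmatrix}0&i\zeta\\-i&0\end{pmatrix}$. If $n=2k$: $\mathcal H_\zeta=\mathrm{Mat}_{2^k}(\mathbb C)=\mathrm{End}((\mathbb C^{1|1})^{\otimes k})$, and for $1\le j\le k$, $c_\zeta(a_{2j-1})=\sigma^{\otimes(j-1)}\otimes X_\zeta\otimes 1^{\otimes(k-j)}$, $c_\zeta(a_{2j})=\sigma^{\otimes(j-1)}\otimes Y_\zeta\otimes1^{\otimes(k-j)}$. If $n=2k+1$: let $D_\zeta=\mathbb C[\epsilon]$ with $\epsilon$ odd, $\epsilon^2=\zeta$, and $\mathcal H_\zeta=D_\zeta\otimes\mathrm{Mat}_{2^k}(\mathbb C)=\mathrm{End}_{D_\zeta}(D_\zeta\otimes\mathbb C^{2^k})$; let $C_1,\dots,C_{2k}\in \mathrm{Mat}_{2^k}(\mathbb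 C)$ be the matrices $c_1(a_1),\dots,c_1(a_{2k})$ of the even case with parameter $1$, $\Gamma=\sigma^{\otimes k}$, and $c_\zeta(a_1)=\epsilon\otimes\Gamma$, $c_\zeta(a_{j+1})=\epsilon\otimes(-i\,\Gamma C_j)$ for $1\le j\le 2k$. $\mathcal H$ denotes the underlying complex vector space of $\mathcal H_\zeta$, which does not depend on $\zeta$ (for odd $n$ it is $\mathrm{Mat}_{2^k}(\mathbb C)\oplus\epsilon\,\mathrm{Mat}_{2^k}(\mathbb C)$). In both cases $d\pi_\zeta:\mathfrak U(\mathfrak{hc})\to\mathcal H_\zeta$ is the unital algebra homomorphism with $d\pi_\zeta(a_j)=e^{i\pi/4}c_\zeta(a_j)$ and $d\pi_\zeta(z)=i\zeta$. Functional $T$. On $\mathcal H_\zeta$ define $T(A)=\mathrm{STr}(A)=\mathrm{Tr}(\sigma^{\otimes k}A)$ if $n=2k$, and $T(A)=\mathrm{Tr}(e^{i\pi/4}\epsilon A)$ if $n=2k+1$, where $\mathrm{Tr}$ is the trace over $\mathbb C$ of an endomorphism of $D_\zeta\otimes\mathbb C^{2^k}$. In $T(A(\zeta)d\pi_{-\zeta}(u))$ the product and $T$ are taken in $\mathcal H_{-\zeta}$. Let $[n]=n/2$ for $n$ even and $[n]=(n+1)/2$ for $n$ odd. Fourier transform. For compactly supported $F$ and $\zeta\in\mathbb C$, $\widehat F(\zeta)=\int_{\mathrm{HC}}F\cdot\pi_{-\zeta}$ with $\pi_{-\zeta}(u;x)=e^{-i\zeta x}d\pi_{-\zeta}(u)$;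 explicitly $$\widehat F(\zeta)=\sum_i\Big(\int_{\mathbb R}F(\gamma_i^{(1)};x)e^{-i\zeta x}\,dx\Big)\,d\pi_{-\zeta}(\gamma_i^{(2)})\in\mathcal H.$$ *)

theory Defs
  imports "HOL-Analysis.Analysis" "Jordan_Normal_Form.Matrix"
begin

section \<open>The Heisenberg--Clifford Lie superalgebra\<close>

text \<open>
  The pair \<open>(V, \<beta>)\<close> is a type \<open>'v :: euclidean_space\<close> with its inner product, and
  \<open>(v, \<lambda>) :: 'v \<times> real\<close> stands for \<open>v + \<lambda> z\<close>, with \<open>'v\<close> odd and \<open>z\<close> even.
\<close>

definition hc_bracket :: "'v::real_inner \<times> real \<Rightarrow> 'v \<times> real \<Rightarrow> 'v \<times> real" where
  "hc_bracket x y = (0, 2 * inner (fst x) (fst y))"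

definition hc_even :: "'v::real_inner \<times> real \<Rightarrow> bool" where
  "hc_even x \<longleftrightarrow> fst x = 0"

definition hc_odd :: "'v::real_inner \<times> real \<Rightarrow> bool" where
  "hc_odd x \<longleftrightarrow> snd x = 0"


section \<open>Its universal enveloping algebra\<close>

text \<open>
  The unital associative real algebra presented by the generators \<open>x \<in> hc\<close>, linearity in \<open>x\<close>, and
  \<open>x y - (-1)\<^bsup>|x||y|\<^esup> y x = [x, y]\<close> for homogeneous \<open>x, y\<close>: formal algebra terms modulo the least
  congruence containing the axioms of unital associative real algebras and these relations.
\<close>

datatype 'g alg_term =
  Gen 'g | Scal real | Plus "'g alg_term" "'g alg_term" | Times "'g alg_term" "'g alg_term"

inductive hc_cong :: "('v::real_inner \<times> real) alg_term \<Rightarrow> ('v \<times> real) alg_term \<Rightarrow> bool" where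
  hc_refl: "hc_cong s s"
| hc_sym: "hc_cong s t \<Longrightarrow> hc_cong t s"
| hc_trans: "hc_cong s t \<Longrightarrow> hc_cong t u \<Longrightarrow> hc_cong s u"
| hc_plus_cong: "hc_cong s s' \<Longrightarrow> hc_cong t t' \<Longrightarrow> hc_cong (Plus s t) (Plus s' t')"
| hc_times_cong: "hc_cong s s' \<Longrightarrow> hc_cong t t' \<Longrightarrow> hc_cong (Times s t) (Times s' t')"
| hc_plus_assoc: "hc_cong (Plus (Plus s t) u) (Plus s (Plus t u))"
| hc_plus_comm: "hc_cong (Plus s t) (Plus t s)"
| hc_plus_zero: "hc_cong (Plus (Scal 0) s) s"
| hc_plus_inv: "hc_cong (Plus (Times (Scal (-1)) s) s) (Scal 0)"
| hc_times_assoc: "hc_cong (Times (Times s t) u) (Times s (Times t u))"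
| hc_one_times: "hc_cong (Times (Scal 1) s) s"
| hc_distrib_right: "hc_cong (Times (Plus s t) u) (Plus (Times s u) (Times t u))"
| hc_distrib_left: "hc_cong (Times s (Plus t u)) (Plus (Times s t) (Times s u))"
| hc_scal_plus: "hc_cong (Scal (c + d)) (Plus (Scal c) (Scal d))"
| hc_scal_times: "hc_cong (Scal (c * d)) (Times (Scal c) (Scal d))"
| hc_scal_central: "hc_cong (Times s (Scal c)) (Times (Scal c) s)"
| hc_gen_plus: "hc_cong (Gen (x + y)) (Plus (Gen x) (Gen y))"
| hc_gen_scale: "hc_cong (Gen (c *\<^sub>R x)) (Times (Scal c) (Gen x))"
| hc_bracket_odd: "hc_odd x \<Longrightarrow> hc_odd y \<Longrightarrow>
    hc_cong (Plus (Times (Gen x) (Gen y)) (Times (Gen y) (Gen x))) (Gen (hc_bracket x y))"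
| hc_bracket_even: "hc_even x \<and> (hc_even y \<or> hc_odd y) \<or> hc_odd x \<and> hc_even y \<Longrightarrow>
    hc_cong (Plus (Times (Gen x) (Gen y)) (Times (Scal (-1)) (Times (Gen y) (Gen x))))
      (Gen (hc_bracket x y))"

primrec alg_eval :: "('g \<Rightarrow> 'b::real_algebra_1) \<Rightarrow> 'g alg_term \<Rightarrow> 'b" where
  "alg_eval f (Gen x) = f x"
| "alg_eval f (Scal c) = of_real c"
| "alg_eval f (Plus s t) = alg_eval f s + alg_eval f t"
| "alg_eval f (Times s t) = alg_eval f s * alg_eval f t"

definition hc_map :: "('v::real_inner \<times> real \<Rightarrow> 'b::real_algebra_1) \<Rightarrow> bool" where
  "hc_map f \<longleftrightarrow> linear f \<and>
    (\<forall>x y. hc_odd x \<longrightarrow> hc_odd y \<longrightarrow> f x * f y + f y * f x = f (hc_bracket x y)) \<and>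
    (\<forall>x y. hc_even x \<and> (hc_even y \<or> hc_odd y) \<or> hc_odd x \<and> hc_even y \<longrightarrow>
       f x * f y - f y * f x = f (hc_bracket x y))"

lemma hc_mapD:
  assumes "hc_map f"
  shows "linear f"
    "hc_odd x \<Longrightarrow> hc_odd y \<Longrightarrow> f x * f y + f y * f x = f (hc_bracket x y)"
    "hc_even x \<and> (hc_even y \<or> hc_odd y) \<or> hc_odd x \<and> hc_even y \<Longrightarrow>
      f x * f y - f y * f x = f (hc_bracket x y)"
  using assms unfolding hc_map_def by blast+

lemma alg_eval_cong:
  assumes "hc_map f" "hc_cong s t"
  shows "alg_eval f s = alg_eval f t"
  using assms(2)
proof (induction rule: hc_cong.induct)
  case (hc_gen_plus x y)
  then show ?case using hc_mapD(1)[OF assms(1)] by (simp add: linear_add)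
next
  case (hc_gen_scale c x)
  then show ?case using hc_mapD(1)[OF assms(1)] by (simp add: linear_scale scaleR_conv_of_real)
next
  case (hc_bracket_odd x y)
  then show ?case by (simp add: hc_mapD(2)[OF assms(1)])
next
  case (hc_bracket_even x y)
  then show ?case by (simp add: hc_mapD(3)[OF assms(1)])
next
  case (hc_scal_central s c)
  then show ?case by (simp add: Reals_def of_real_def)
qed (simp_all add: algebra_simps)

quotient_type (overloaded) 'v uhc = "('v::real_inner \<times> real) alg_term" / hc_cong
  by (rule equivpI) (auto intro: reflpI sympI transpI hc_cong.intros)

lift_definition hc_gen :: "'v::real_inner \<times> real \<Rightarrow> 'v uhc" is Gen .

instantiation uhc :: (real_inner) real_algebra_1
begin

lift_definition zero_uhc :: "'a uhc" is "Scal 0" .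
lift_definition one_uhc :: "'a uhc" is "Scal 1" .
lift_definition plus_uhc :: "'a uhc \<Rightarrow> 'a uhc \<Rightarrow> 'a uhc" is Plus by (rule hc_plus_cong)
lift_definition times_uhc :: "'a uhc \<Rightarrow> 'a uhc \<Rightarrow> 'a uhc" is Times by (rule hc_times_cong)
lift_definition scaleR_uhc :: "real \<Rightarrow> 'a uhc \<Rightarrow> 'a uhc" is "\<lambda>c. Times (Scal c)"
  by (intro hc_times_cong hc_refl)
lift_definition uminus_uhc :: "'a uhc \<Rightarrow> 'a uhc" is "Times (Scal (-1))"
  by (intro hc_times_cong hc_refl)
definition minus_uhc :: "'a uhc \<Rightarrow> 'a uhc \<Rightarrow> 'a uhc" where
  "minus_uhc x y = x + - y"

instance
proof
  fix a b c :: "'a uhc" and r s :: real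
  show "a + b + c = a + (b + c)" by transfer (rule hc_cong.intros)
  show "a + b = b + a" by transfer (rule hc_plus_comm)
  show "0 + a = a" by transfer (rule hc_cong.intros)
  show "- a + a = 0" by transfer (rule hc_cong.intros)
  show "a - b = a + - b" by (rule minus_uhc_def)
  show "r *\<^sub>R (a + b) = r *\<^sub>R a + r *\<^sub>R b" by transfer (rule hc_distrib_left)
  show "(r + s) *\<^sub>R a = r *\<^sub>R a + s *\<^sub>R a"
    by transfer (meson hc_distrib_right hc_scal_plus hc_times_cong hc_refl
        hc_trans)
  show "r *\<^sub>R s *\<^sub>R a = (r * s) *\<^sub>R a"
    by transfer (meson hc_times_assoc hc_scal_times hc_times_cong hc_refl
        hc_trans hc_sym)
  show "1 *\<^sub>R a = a" by transfer (rule hc_one_times)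
  show "a * b * c = a * (b * c)" by transfer (rule hc_times_assoc)
  show "(a + b) * c = a * c + b * c" by transfer (rule hc_distrib_right)
  show "a * (b + c) = a * b + a * c" by transfer (rule hc_distrib_left)
  show "r *\<^sub>R a * b = r *\<^sub>R (a * b)" by transfer (rule hc_times_assoc)
  show "a * r *\<^sub>R b = r *\<^sub>R (a * b)"
    by transfer (meson hc_times_assoc hc_scal_central hc_times_cong hc_refl
        hc_trans hc_sym)
  show "1 * a = a" by transfer (rule hc_one_times)
  show "a * 1 = a" by transfer (meson hc_scal_central hc_one_times hc_trans)
  have "\<not> hc_cong (Scal 0 :: ('a \<times> real) alg_term) (Scal 1)"
  proof
    assume "hc_cong (Scal 0 :: ('a \<times> real) alg_term) (Scal 1)"
    moreover have "hc_map (\<lambda>_ :: 'a \<times> real. 0 :: real)"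
      by (simp add: hc_map_def linear_zero)
    ultimately have "alg_eval (\<lambda>_ :: 'a \<times> real. 0 :: real) (Scal 0) =
        alg_eval (\<lambda>_ :: 'a \<times> real. 0 :: real) (Scal 1)" by (rule alg_eval_cong[rotated])
    then show False by simp
  qed
  then show "(0 :: 'a uhc) \<noteq> 1" by transfer
qed

end

lemma of_real_uhc: "of_real c = abs_uhc (Scal c)"
proof -
  have "of_real c = c *\<^sub>R (1 :: 'a uhc)" by (simp add: of_real_def)
  also have "\<dots> = abs_uhc (Scal c)"
    by transfer (meson hc_scal_central hc_one_times hc_trans)
  finally show ?thesis .
qed

lemma uhc_induct [case_names gen scal plus times]:
  assumes "\<And>x. P (hc_gen x)" "\<And>c. P (of_real c)"
    "\<And>u v. P u \<Longrightarrow> P v \<Longrightarrow> P (u + v)" "\<And>u v. P u \<Longrightarrow> P v \<Longrightarrow> P (u * v)"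
  shows "P u"
proof (induction u rule: uhc.abs_induct)
  case (1 t)
  then show ?case
  proof (induction t)
    case (Gen x) then show ?case using assms(1)[of x] by (simp add: hc_gen.abs_eq)
  next
    case (Scal c) then show ?case using assms(2)[of c] by (simp add: of_real_uhc)
  next
    case (Plus s t) then show ?case using assms(3) by (simp flip: plus_uhc.abs_eq)
  next
    case (Times s t) then show ?case using assms(4) by (simp flip: times_uhc.abs_eq)
  qed
qed

lemma linear_hc_gen: "linear hc_gen"
proof
  show "hc_gen (x + y) = hc_gen x + hc_gen y" for x y :: "'a \<times> real"
    by transfer (rule hc_gen_plus)
  show "hc_gen (c *\<^sub>R x) = c *\<^sub>R hc_gen x" for c and x :: "'a \<times> real"
    by transfer (rule hc_gen_scale)
qed

lemma hc_map_hc_gen: "hc_map hc_gen"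
proof -
  have "hc_gen x * hc_gen y + hc_gen y * hc_gen x = hc_gen (hc_bracket x y)"
    if "hc_odd x" "hc_odd y" for x y :: "'a \<times> real"
    using that by transfer (rule hc_bracket_odd)
  moreover have "hc_gen x * hc_gen y + - (hc_gen y * hc_gen x) = hc_gen (hc_bracket x y)"
    if "hc_even x \<and> (hc_even y \<or> hc_odd y) \<or> hc_odd x \<and> hc_even y" for x y :: "'a \<times> real"
    using that by transfer (rule hc_bracket_even)
  ultimately show ?thesis by (simp add: hc_map_def linear_hc_gen)
qed

definition uhc_lift :: "('v::real_inner \<times> real \<Rightarrow> 'b::real_algebra_1) \<Rightarrow> 'v uhc \<Rightarrow> 'b" where
  "uhc_lift f u = alg_eval f (rep_uhc u)"

lemma uhc_lift_abs: "hc_map f \<Longrightarrow> uhc_lift f (abs_uhc t) = alg_eval f t"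
  unfolding uhc_lift_def
  by (rule alg_eval_cong) (simp_all add: Quotient3_rep_abs[OF Quotient3_uhc] hc_refl)

lemma uhc_lift:
  assumes "hc_map f"
  shows "uhc_lift f (hc_gen x) = f x" "uhc_lift f 1 = 1"
    "uhc_lift f (u + v) = uhc_lift f u + uhc_lift f v"
    "uhc_lift f (u * v) = uhc_lift f u * uhc_lift f v"
    "uhc_lift f (c *\<^sub>R u) = c *\<^sub>R uhc_lift f u"
proof -
  note L = uhc_lift_abs[OF assms]
  show "uhc_lift f (hc_gen x) = f x" by (simp add: hc_gen.abs_eq L)
  show "uhc_lift f 1 = 1" by (simp add: one_uhc.abs_eq L)
  show "uhc_lift f (u + v) = uhc_lift f u + uhc_lift f v"
    by (induction u, induction v) (simp add: plus_uhc.abs_eq L)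
  show "uhc_lift f (u * v) = uhc_lift f u * uhc_lift f v"
    by (induction u, induction v) (simp add: times_uhc.abs_eq L)
  show "uhc_lift f (c *\<^sub>R u) = c *\<^sub>R uhc_lift f u"
    by (induction u rule: uhc.abs_induct)
       (simp add: scaleR_uhc.abs_eq L flip: scaleR_conv_of_real)
qed

definition uhc_vec :: "'v::real_inner \<Rightarrow> 'v uhc" where
  "uhc_vec v = hc_gen (v, 0)"

definition uhc_z :: "'v::real_inner uhc" where
  "uhc_z = hc_gen (0, 1)"

lemma uhc_z_central: "uhc_z * u = u * (uhc_z :: 'v::real_inner uhc)"
proof (induction u rule: uhc_induct)
  case (gen x)
  have *: "hc_gen (0, 1) * hc_gen y = hc_gen y * hc_gen (0, 1)" if "hc_even y \<or> hc_odd y"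
    for y :: "'v \<times> real"
  proof -
    have "hc_gen (0, 1) * hc_gen y - hc_gen y * hc_gen (0, 1) = hc_gen (hc_bracket (0, 1) y)"
      by (rule hc_mapD(3)[OF hc_map_hc_gen]) (use that in \<open>simp add: hc_even_def\<close>)
    also have "\<dots> = 0"
      using linear_0[OF linear_hc_gen] by (simp add: hc_bracket_def zero_prod_def)
    finally show ?thesis by simp
  qed
  have "hc_gen x = hc_gen (fst x, 0) + hc_gen (0, snd x)"
    by (simp flip: linear_add[OF linear_hc_gen])
  moreover have "hc_gen (0, 1) * hc_gen (fst x, 0) = hc_gen (fst x, 0) * hc_gen (0, 1)"
    "hc_gen (0, 1) * hc_gen (0, snd x) = hc_gen (0, snd x) * (hc_gen (0, 1) :: 'v uhc)"
    by (rule *, simp add: hc_even_def hc_odd_def)+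
  ultimately show ?case by (simp add: uhc_z_def algebra_simps)
next
  case (scal c) then show ?case by (simp add: of_real_def)
next
  case (plus u v) then show ?case by (simp add: algebra_simps)
next
  case (times u v) then show ?case by (metis mult.assoc)
qed

lemma uhc_clifford:
  "uhc_vec v * uhc_vec w + uhc_vec w * uhc_vec v = (2 * inner v w) *\<^sub>R uhc_z"
  using hc_mapD(2)[OF hc_map_hc_gen, of "(v, 0)" "(w, 0)"]
  by (simp add: uhc_vec_def uhc_z_def hc_odd_def hc_bracket_def
      flip: linear_scale[OF linear_hc_gen])


section \<open>Superalgebras and their tensor product\<close>

text \<open>
  A \<open>\<int>/2\<close>-grading of a real algebra is given by its parity automorphism \<open>u \<mapsto> (-1)\<^bsup>|u|\<^esup> u\<close>, whose
  \<open>1\<close>- and \<open>-1\<close>-eigenspaces are the even and the odd part.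
\<close>

class real_superalgebra_1 = real_algebra_1 +
  fixes parity :: "'a \<Rightarrow> 'a"
  assumes parity_add: "parity (x + y) = parity x + parity y"
    and parity_scaleR: "parity (r *\<^sub>R x) = r *\<^sub>R parity x"
    and parity_mult: "parity (x * y) = parity x * parity y"
    and parity_one: "parity 1 = 1"
    and parity_parity: "parity (parity x) = x"

definition is_even :: "'a::real_superalgebra_1 \<Rightarrow> bool" where
  "is_even x \<longleftrightarrow> parity x = x"

definition is_odd :: "'a::real_superalgebra_1 \<Rightarrow> bool" where
  "is_odd x \<longleftrightarrow> parity x = - x"

definition homogeneous :: "'a::real_superalgebra_1 \<Rightarrow> bool" where
  "homogeneous x \<longleftrightarrow> is_even x \<or> is_odd x"

definition even_part :: "'a::real_superalgebra_1 \<Rightarrow> 'a" where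
  "even_part x = (1/2) *\<^sub>R (x + parity x)"

definition odd_part :: "'a::real_superalgebra_1 \<Rightarrow> 'a" where
  "odd_part x = (1/2) *\<^sub>R (x - parity x)"

lemma linear_parity: "linear parity"
  by unfold_locales (rule parity_add parity_scaleR)+

lemma parity_diff: "parity (x - y) = parity x - parity (y :: 'a::real_superalgebra_1)"
  by (rule linear_diff[OF linear_parity])

lemma parity_minus: "parity (- y) = - parity (y :: 'a::real_superalgebra_1)"
  by (rule linear_neg[OF linear_parity])

lemma even_part_add_odd_part: "even_part x + odd_part x = x"
  by (simp add: even_part_def odd_part_def flip: scaleR_add_right scaleR_2)

lemma is_even_even_part: "is_even (even_part x)"
  by (simp add: is_even_def even_part_def parity_scaleR parity_add parity_parity add.commute)

lemma is_odd_odd_part: "is_odd (odd_part x)"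
  by (simp add: is_odd_def odd_part_def parity_scaleR parity_diff parity_parity
      flip: scaleR_minus_right)

lemma linear_even_part: "linear even_part"
  by unfold_locales (simp_all add: even_part_def parity_add parity_scaleR algebra_simps)

lemma linear_odd_part: "linear odd_part"
  by unfold_locales (simp_all add: odd_part_def parity_add parity_scaleR algebra_simps)

instantiation uhc :: (real_inner) real_superalgebra_1
begin

definition parity_uhc :: "'a uhc \<Rightarrow> 'a uhc" where
  "parity_uhc = uhc_lift (\<lambda>(v, c). hc_gen (- v, c))"

lemma hc_map_parity: "hc_map (\<lambda>(v :: 'a, c). hc_gen (- v, c))"
proof -
  let ?f = "\<lambda>(v :: 'a, c). hc_gen (- v, c)"
  have lin: "linear (\<lambda>x :: 'a \<times> real. (- fst x, snd x))"
    by unfold_locales auto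
  have eq: "?f = hc_gen \<circ> (\<lambda>x. (- fst x, snd x))" by auto
  have "linear ?f" unfolding eq by (rule linear_compose[OF lin linear_hc_gen])
  moreover have f: "?f x = hc_gen (- fst x, snd x)" for x by (simp add: case_prod_beta)
  moreover have "hc_bracket (- fst x, snd x) (- fst y, snd y) = hc_bracket x y"
    for x y :: "'a \<times> real" by (simp add: hc_bracket_def)
  moreover have "?f (hc_bracket x y) = hc_gen (hc_bracket x y)"
    for x y :: "'a \<times> real" by (simp add: hc_bracket_def)
  moreover have "hc_even (- fst x, snd x) \<longleftrightarrow> hc_even x" "hc_odd (- fst x, snd x) \<longleftrightarrow> hc_odd x"
    for x :: "'a \<times> real" by (simp_all add: hc_even_def hc_odd_def)
  ultimately show ?thesis
    unfolding hc_map_def f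
    by (metis (no_types, lifting) hc_mapD(2)[OF hc_map_hc_gen] hc_mapD(3)[OF hc_map_hc_gen])
qed

instance
proof
  fix x y :: "'a uhc" and r :: real
  note L = uhc_lift[OF hc_map_parity]
  show add: "parity (x + y) = parity x + parity y" for x y :: "'a uhc"
    by (simp add: parity_uhc_def L)
  show scale: "parity (r *\<^sub>R x) = r *\<^sub>R parity x" for r and x :: "'a uhc"
    by (simp add: parity_uhc_def L)
  show mult: "parity (x * y) = parity x * parity y" for x y :: "'a uhc"
    by (simp add: parity_uhc_def L)
  show one: "parity (1 :: 'a uhc) = 1"
    by (simp add: parity_uhc_def L)
  have gen: "parity (hc_gen (v, c)) = hc_gen (- v, c)" for v :: 'a and c
    by (simp add: parity_uhc_def L)
  show "parity (parity x) = x"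
  proof (induction x rule: uhc_induct)
    case (gen x) then show ?case by (cases x) (simp add: \<open>\<And>v c. parity (hc_gen (v, c)) = _\<close>)
  next
    case (scal c) then show ?case by (simp add: of_real_def scale one)
  qed (simp_all add: add mult)
qed

end

lemma parity_uhc_vec: "parity (uhc_vec v) = - uhc_vec v"
proof -
  have "hc_gen (- v, 0) = - hc_gen (v, 0)"
    by (simp flip: linear_neg[OF linear_hc_gen])
  then show ?thesis by (simp add: uhc_vec_def parity_uhc_def uhc_lift[OF hc_map_parity])
qed

lemma parity_uhc_z: "parity uhc_z = uhc_z"
  by (simp add: uhc_z_def parity_uhc_def uhc_lift[OF hc_map_parity])

datatype ('a, 'b) tensor_term =
  TPure 'a 'b | TPlus "('a, 'b) tensor_term" "('a, 'b) tensor_term"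
  | TScale real "('a, 'b) tensor_term"

inductive tensor_cong ::
  "('a::real_vector, 'b::real_vector) tensor_term \<Rightarrow> ('a, 'b) tensor_term \<Rightarrow> bool" where
  tensor_refl: "tensor_cong s s"
| tensor_sym: "tensor_cong s t \<Longrightarrow> tensor_cong t s"
| tensor_trans: "tensor_cong s t \<Longrightarrow> tensor_cong t u \<Longrightarrow> tensor_cong s u"
| tensor_plus_cong: "tensor_cong s s' \<Longrightarrow> tensor_cong t t' \<Longrightarrow> tensor_cong (TPlus s t) (TPlus s' t')"
| tensor_scale_cong: "tensor_cong s t \<Longrightarrow> tensor_cong (TScale c s) (TScale c t)"
| tensor_plus_assoc: "tensor_cong (TPlus (TPlus s t) u) (TPlus s (TPlus t u))"
| tensor_plus_comm: "tensor_cong (TPlus s t) (TPlus t s)"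
| tensor_plus_zero: "tensor_cong (TPlus (TPure 0 0) s) s"
| tensor_plus_inv: "tensor_cong (TPlus (TScale (-1) s) s) (TPure 0 0)"
| tensor_scale_plus: "tensor_cong (TScale c (TPlus s t)) (TPlus (TScale c s) (TScale c t))"
| tensor_plus_scale: "tensor_cong (TScale (c + d) s) (TPlus (TScale c s) (TScale d s))"
| tensor_scale_scale: "tensor_cong (TScale c (TScale d s)) (TScale (c * d) s)"
| tensor_scale_one: "tensor_cong (TScale 1 s) s"
| tensor_pure_plus_left: "tensor_cong (TPure (a + a') b) (TPlus (TPure a b) (TPure a' b))"
| tensor_pure_plus_right: "tensor_cong (TPure a (b + b')) (TPlus (TPure a b) (TPure a b'))"
| tensor_pure_scale_left: "tensor_cong (TPure (c *\<^sub>R a) b) (TScale c (TPure a b))"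
| tensor_pure_scale_right: "tensor_cong (TPure a (c *\<^sub>R b)) (TScale c (TPure a b))"

quotient_type (overloaded) ('a, 'b) tensor =
  "('a::real_vector, 'b::real_vector) tensor_term" / tensor_cong
  by (rule equivpI) (auto intro: reflpI sympI transpI tensor_cong.intros)

lift_definition tensor_pure :: "'a::real_vector \<Rightarrow> 'b::real_vector \<Rightarrow> ('a, 'b) tensor"
    (infix "\<otimes>\<^sub>s" 75) is TPure .

instantiation tensor :: (real_vector, real_vector) real_vector
begin

lift_definition zero_tensor :: "('a, 'b) tensor" is "TPure 0 0" .
lift_definition plus_tensor :: "('a, 'b) tensor \<Rightarrow> ('a, 'b) tensor \<Rightarrow> ('a, 'b) tensor" is TPlus
  by (rule tensor_plus_cong)
lift_definition scaleR_tensor :: "real \<Rightarrow> ('a, 'b) tensor \<Rightarrow> ('a, 'b) tensor" is TScale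
  by (rule tensor_scale_cong)
lift_definition uminus_tensor :: "('a, 'b) tensor \<Rightarrow> ('a, 'b) tensor" is "TScale (-1)"
  by (rule tensor_scale_cong)
definition minus_tensor :: "('a, 'b) tensor \<Rightarrow> ('a, 'b) tensor \<Rightarrow> ('a, 'b) tensor" where
  "minus_tensor x y = x + - y"

instance
proof
  fix a b c :: "('a, 'b) tensor" and r s :: real
  show "a + b + c = a + (b + c)" by transfer (rule tensor_plus_assoc)
  show "a + b = b + a" by transfer (rule tensor_plus_comm)
  show "0 + a = a" by transfer (rule tensor_plus_zero)
  show "- a + a = 0" by transfer (rule tensor_plus_inv)
  show "a - b = a + - b" by (rule minus_tensor_def)
  show "r *\<^sub>R (a + b) = r *\<^sub>R a + r *\<^sub>R b" by transfer (rule tensor_scale_plus)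
  show "(r + s) *\<^sub>R a = r *\<^sub>R a + s *\<^sub>R a" by transfer (rule tensor_plus_scale)
  show "r *\<^sub>R s *\<^sub>R a = (r * s) *\<^sub>R a" by transfer (rule tensor_scale_scale)
  show "1 *\<^sub>R a = a" by transfer (rule tensor_scale_one)
qed

end

lemma bilinear_tensor_pure: "bilinear (\<otimes>\<^sub>s)"
proof -
  have "(a + a') \<otimes>\<^sub>s b = a \<otimes>\<^sub>s b + a' \<otimes>\<^sub>s b" for a a' :: 'a and b :: 'b
    by transfer (rule tensor_pure_plus_left)
  moreover have "a \<otimes>\<^sub>s (b + b') = a \<otimes>\<^sub>s b + a \<otimes>\<^sub>s b'" for a :: 'a and b b' :: 'b
    by transfer (rule tensor_pure_plus_right)
  moreover have "(c *\<^sub>R a) \<otimes>\<^sub>s b = c *\<^sub>R (a \<otimes>\<^sub>s b)" for a :: 'a and b :: 'b and c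
    by transfer (rule tensor_pure_scale_left)
  moreover have "a \<otimes>\<^sub>s (c *\<^sub>R b) = c *\<^sub>R (a \<otimes>\<^sub>s b)" for a :: 'a and b :: 'b and c
    by transfer (rule tensor_pure_scale_right)
  ultimately show ?thesis unfolding bilinear_def by (auto intro!: linearI)
qed

lemmas tensor_pure_simps =
  bilinear_ladd[OF bilinear_tensor_pure] bilinear_radd[OF bilinear_tensor_pure]
  bilinear_lmul[OF bilinear_tensor_pure] bilinear_rmul[OF bilinear_tensor_pure]
  bilinear_lneg[OF bilinear_tensor_pure] bilinear_rneg[OF bilinear_tensor_pure]
  bilinear_lzero[OF bilinear_tensor_pure] bilinear_rzero[OF bilinear_tensor_pure]

lemma tensor_induct [case_names pure plus]:
  assumes pure: "\<And>a b. P (a \<otimes>\<^sub>s b)" and plus: "\<And>s t. P s \<Longrightarrow> P t \<Longrightarrow> P (s + t)"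
  shows "P t"
proof -
  have "\<forall>c. P (c *\<^sub>R t)"
  proof (induction t rule: tensor.abs_induct)
    case (1 t)
    then show ?case
    proof (induction t)
      case (TPure a b)
      have "P (c *\<^sub>R (a \<otimes>\<^sub>s b))" for c
        using pure[of "c *\<^sub>R a" b] by (simp add: tensor_pure_simps)
      then show ?case by (simp add: tensor_pure.abs_eq)
    next
      case (TPlus s t)
      then show ?case
        using plus by (simp add: scaleR_add_right flip: plus_tensor.abs_eq)
    next
      case (TScale d t)
      then show ?case by (simp flip: scaleR_tensor.abs_eq)
    qed
  qed
  then show ?thesis by (metis scaleR_one)
qed

primrec tensor_eval :: "('a \<Rightarrow> 'b \<Rightarrow> 'c::real_vector) \<Rightarrow> ('a, 'b) tensor_term \<Rightarrow> 'c" where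
  "tensor_eval f (TPure a b) = f a b"
| "tensor_eval f (TPlus s t) = tensor_eval f s + tensor_eval f t"
| "tensor_eval f (TScale c t) = c *\<^sub>R tensor_eval f t"

definition tensor_lift ::
  "('a::real_vector \<Rightarrow> 'b::real_vector \<Rightarrow> 'c::real_vector) \<Rightarrow> ('a, 'b) tensor \<Rightarrow> 'c" where
  "tensor_lift f t = tensor_eval f (rep_tensor t)"

lemma tensor_eval_cong:
  assumes "bilinear f" "tensor_cong s t"
  shows "tensor_eval f s = tensor_eval f t"
  using assms(2)
  by (induction rule: tensor_cong.induct)
     (simp_all add: bilinear_ladd[OF assms(1)] bilinear_radd[OF assms(1)]
       bilinear_lmul[OF assms(1)] bilinear_rmul[OF assms(1)]
       bilinear_lzero[OF assms(1)] scaleR_add_right scaleR_add_left)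

lemma tensor_lift_abs: "bilinear f \<Longrightarrow> tensor_lift f (abs_tensor t) = tensor_eval f t"
  unfolding tensor_lift_def
  by (rule tensor_eval_cong) (simp_all add: Quotient3_rep_abs[OF Quotient3_tensor] tensor_refl)

lemma tensor_lift_pure: "bilinear f \<Longrightarrow> tensor_lift f (a \<otimes>\<^sub>s b) = f a b"
  by (simp add: tensor_pure.abs_eq tensor_lift_abs)

lemma linear_tensor_lift:
  assumes "bilinear f"
  shows "linear (tensor_lift f)"
proof
  note L = tensor_lift_abs[OF assms]
  show "tensor_lift f (s + t) = tensor_lift f s + tensor_lift f t" for s t
    by (induction s, induction t) (simp add: plus_tensor.abs_eq L)
  show "tensor_lift f (c *\<^sub>R t) = c *\<^sub>R tensor_lift f t" for c t
    by (induction t) (simp add: scaleR_tensor.abs_eq L)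
qed

text \<open>
  On homogeneous \<open>b, c\<close> this is \<open>(a \<otimes> b)(c \<otimes> d) = (-1)\<^bsup>|b||c|\<^esup> ac \<otimes> bd\<close>, see
  \<open>tensor_times_homogeneous\<close> below.
\<close>

definition pure_times :: "'a::real_superalgebra_1 \<Rightarrow> 'b::real_superalgebra_1 \<Rightarrow> 'a \<Rightarrow> 'b \<Rightarrow> ('a, 'b) tensor"
  where "pure_times a b c d =
    (a * even_part c) \<otimes>\<^sub>s (b * d) + (a * odd_part c) \<otimes>\<^sub>s (parity b * d)"

lemma bilinear_pure_times: "bilinear (pure_times a b)"
  unfolding bilinear_def pure_times_def
  by (auto intro!: linearI simp: linear_add[OF linear_even_part] linear_add[OF linear_odd_part]
      linear_scale[OF linear_even_part] linear_scale[OF linear_odd_part] algebra_simps tensor_pure_simps)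

lemma bilinear_pure_times': "bilinear (\<lambda>a b. pure_times a b c d)"
  unfolding bilinear_def pure_times_def
  by (auto intro!: linearI simp: parity_add parity_scaleR algebra_simps tensor_pure_simps)

lemma bilinear_lift_pure_times: "bilinear (\<lambda>a b. tensor_lift (pure_times a b) t)"
proof (induction t rule: tensor_induct)
  case (pure c d)
  then show ?case by (simp add: tensor_lift_pure bilinear_pure_times bilinear_pure_times')
next
  case (plus s t)
  then show ?case
    by (auto simp: bilinear_def linear_add[OF linear_tensor_lift[OF bilinear_pure_times]]
        intro!: linear_compose_add)
qed

instantiation tensor :: (real_superalgebra_1, real_superalgebra_1) real_algebra_1
begin

definition one_tensor :: "('a, 'b) tensor" where
  "one_tensor = 1 \<otimes>\<^sub>s 1"

definition times_tensor :: "('a, 'b) tensor \<Rightarrow> ('a, 'b) tensor \<Rightarrow> ('a, 'b) tensor" where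
  "times_tensor s t = tensor_lift (\<lambda>a b. tensor_lift (pure_times a b) t) s"

lemma pure_times_pure: "(a \<otimes>\<^sub>s b) * (c \<otimes>\<^sub>s d) = pure_times a b c d"
  for a c :: 'a and b d :: 'b
  by (simp add: times_tensor_def tensor_lift_pure bilinear_lift_pure_times bilinear_pure_times
      tensor_lift_pure[OF bilinear_pure_times'])

lemma parity_parts:
  "even_part (even_part x) = even_part x" "odd_part (odd_part x) = odd_part x"
  "even_part (odd_part x) = 0" "odd_part (even_part x) = 0"
  "parity (even_part x) = even_part x" "parity (odd_part x) = - odd_part x"
  for x :: "'c::real_superalgebra_1"
  using is_even_even_part[of x] is_odd_odd_part[of x] is_even_even_part[of x]
  unfolding is_even_def is_odd_def
  by (simp_all add: even_part_def[of "even_part x"] odd_part_def[of "even_part x"]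
      even_part_def[of "odd_part x"] odd_part_def[of "odd_part x"] flip: scaleR_2)

lemma parts_mult:
  "even_part (x * y) = even_part x * even_part y + odd_part x * odd_part y"
  "odd_part (x * y) = even_part x * odd_part y + odd_part x * even_part y"
  for x y :: "'c::real_superalgebra_1"
proof -
  have "(x + parity x) * (y + parity y) + (x - parity x) * (y - parity y) =
      2 *\<^sub>R (x * y + parity x * parity y)"
    "(x + parity x) * (y - parity y) + (x - parity x) * (y + parity y) =
      2 *\<^sub>R (x * y - parity x * parity y)"
    by (simp_all add: algebra_simps scaleR_2)
  then show "even_part (x * y) = even_part x * even_part y + odd_part x * odd_part y"
    "odd_part (x * y) = even_part x * odd_part y + odd_part x * even_part y"
    by (simp_all add: even_part_def odd_part_def parity_mult flip: scaleR_add_right)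
qed

instance
proof
  fix a b c :: "('a, 'b) tensor" and r s :: real
  have lin_r: "linear (\<lambda>t. s * t)" for s :: "('a, 'b) tensor"
  proof (induction s rule: tensor_induct)
    case (pure a b)
    then show ?case
      by (simp add: times_tensor_def tensor_lift_pure bilinear_lift_pure_times
          linear_tensor_lift bilinear_pure_times)
  next
    case (plus s t)
    then show ?case
      by (simp add: times_tensor_def linear_add[OF linear_tensor_lift[OF bilinear_lift_pure_times]]
          linear_compose_add)
  qed
  have lin_l: "linear (\<lambda>s. s * t)" for t :: "('a, 'b) tensor"
    unfolding times_tensor_def by (rule linear_tensor_lift[OF bilinear_lift_pure_times])
  show dl: "a * (b + c) = a * b + a * c" for a b c :: "('a, 'b) tensor"
    by (rule linear_add[OF lin_r])
  show dr: "(a + b) * c = a * c + b * c" for a b c :: "('a, 'b) tensor"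
    by (rule linear_add[OF lin_l])
  show "r *\<^sub>R a * b = r *\<^sub>R (a * b)" by (rule linear_scale[OF lin_l])
  show "a * r *\<^sub>R b = r *\<^sub>R (a * b)" by (rule linear_scale[OF lin_r])
  show "a * b * c = a * (b * c)"
  proof (induction a rule: tensor_induct)
    case a: (pure a1 a2)
    show ?case
    proof (induction b rule: tensor_induct)
      case b: (pure b1 b2)
      show ?case
      proof (induction c rule: tensor_induct)
        case c: (pure c1 c2)
        show ?case
          by (simp add: pure_times_pure pure_times_def dl dr parts_mult parity_parts
              parity_mult parity_parity distrib_left distrib_right tensor_pure_simps mult.assoc)
      qed (simp add: dl)
    qed (simp add: dl dr)
  qed (simp add: dr)
  have one: "even_part (1 :: 'c::real_superalgebra_1) = 1" "odd_part (1 :: 'c) = 0"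
    by (simp_all add: even_part_def odd_part_def parity_one flip: scaleR_2)
  show "1 * a = a"
  proof (induction a rule: tensor_induct)
    case (pure a1 a2)
    show ?case
      using even_part_add_odd_part[of a1]
      by (simp add: one_tensor_def pure_times_pure pure_times_def parity_one
          flip: bilinear_ladd[OF bilinear_tensor_pure])
  qed (simp add: dl)
  show "a * 1 = a"
  proof (induction a rule: tensor_induct)
    case (pure a1 a2)
    show ?case
      by (simp add: one_tensor_def pure_times_pure pure_times_def one tensor_pure_simps)
  qed (simp add: dr)
  show "(0 :: ('a, 'b) tensor) \<noteq> 1"
  proof
    assume eq: "(0 :: ('a, 'b) tensor) = 1"
    obtain f :: "'a \<Rightarrow> real" where f: "linear f" "f 1 = 1"
      using linear_independent_extend[of "{1::'a}" "\<lambda>_. 1::real"] by auto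
    obtain g :: "'b \<Rightarrow> real" where g: "linear g" "g 1 = 1"
      using linear_independent_extend[of "{1::'b}" "\<lambda>_. 1::real"] by auto
    have bil: "bilinear (\<lambda>a b. f a * g b)"
      unfolding bilinear_def
      by (auto intro!: linearI simp: linear_add[OF f(1)] linear_add[OF g(1)]
          linear_scale[OF f(1)] linear_scale[OF g(1)] algebra_simps)
    have "tensor_lift (\<lambda>a b. f a * g b) (1 :: ('a, 'b) tensor) = 1"
      by (simp add: one_tensor_def tensor_lift_pure[OF bil] f g)
    then show False
      using linear_0[OF linear_tensor_lift[OF bil]] by (simp flip: eq)
  qed
qed

end

lemma tensor_times_homogeneous:
  fixes a c :: "'a::real_superalgebra_1" and b d :: "'b::real_superalgebra_1"
  assumes "homogeneous b" "homogeneous c"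
  shows "(a \<otimes>\<^sub>s b) * (c \<otimes>\<^sub>s d) =
    (if is_even b \<or> is_even c then (a * c) \<otimes>\<^sub>s (b * d) else - ((a * c) \<otimes>\<^sub>s (b * d)))"
proof -
  consider "is_even c" | "is_odd c" using assms(2) unfolding homogeneous_def by auto
  then show ?thesis
  proof cases
    case 1
    then have "even_part c = c" "odd_part c = 0"
      by (simp_all add: is_even_def even_part_def odd_part_def flip: scaleR_2)
    then show ?thesis using 1 by (simp add: pure_times_pure pure_times_def tensor_pure_simps)
  next
    case 2
    then have c: "even_part c = 0" "odd_part c = c"
      by (simp_all add: is_odd_def even_part_def odd_part_def flip: scaleR_2)
    show ?thesis
    proof (cases "is_even b")
      case True
      then show ?thesis
        using c by (simp add: pure_times_pure pure_times_def tensor_pure_simps is_even_def)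
    next
      case False
      then have "is_odd b" using assms(1) unfolding homogeneous_def by simp
      then have "(a \<otimes>\<^sub>s b) * (c \<otimes>\<^sub>s d) = - ((a * c) \<otimes>\<^sub>s (b * d))"
        using c by (simp add: pure_times_pure pure_times_def tensor_pure_simps is_odd_def)
      moreover have "(a * c) \<otimes>\<^sub>s (b * d) = - ((a * c) \<otimes>\<^sub>s (b * d))" if "is_even c"
      proof -
        have "c = - c" using that 2 unfolding is_even_def is_odd_def by simp
        then have "a * c = - (a * c)" by (metis mult_minus_right)
        then show ?thesis by (metis bilinear_lneg[OF bilinear_tensor_pure])
      qed
      ultimately show ?thesis using False by auto
    qed
  qed
qed

text \<open>The coproduct of \<open>U(hc)\<close>, extending \<open>x \<mapsto> x \<otimes> 1 + 1 \<otimes> x\<close>.\<close>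

definition coproduct :: "'v::real_inner uhc \<Rightarrow> ('v uhc, 'v uhc) tensor" where
  "coproduct = uhc_lift (\<lambda>x. hc_gen x \<otimes>\<^sub>s 1 + 1 \<otimes>\<^sub>s hc_gen x)"

lemma hc_map_coproduct:
  "hc_map (\<lambda>x :: 'v::real_inner \<times> real. hc_gen x \<otimes>\<^sub>s (1 :: 'v uhc) + (1 :: 'v uhc) \<otimes>\<^sub>s hc_gen x)"
proof -
  let ?g = "hc_gen :: 'v \<times> real \<Rightarrow> 'v uhc"
  let ?f = "\<lambda>x. ?g x \<otimes>\<^sub>s (1 :: 'v uhc) + (1 :: 'v uhc) \<otimes>\<^sub>s ?g x"
  have even_gen: "parity (?g x) = ?g x" if "hc_even x" for x
    using that by (cases x) (simp add: hc_even_def parity_uhc_def uhc_lift[OF hc_map_parity])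
  have odd_gen: "parity (?g x) = - ?g x" if "hc_odd x" for x
    using that parity_uhc_vec[of "fst x"] by (cases x) (simp add: hc_odd_def uhc_vec_def)
  have hom: "homogeneous (?g x)" if "hc_even x \<or> hc_odd x" for x
    unfolding homogeneous_def is_even_def is_odd_def using that even_gen odd_gen by blast
  have hom1: "homogeneous (1 :: 'v uhc)" "is_even (1 :: 'v uhc)"
    by (simp_all add: homogeneous_def is_even_def parity_one)
  note T = tensor_times_homogeneous
  have "linear ?f"
    by (rule linearI)
      (simp_all add: linear_add[OF linear_hc_gen] linear_scale[OF linear_hc_gen] tensor_pure_simps
        scaleR_add_right algebra_simps)
  moreover have "?f x * ?f y + ?f y * ?f x = ?f (hc_bracket x y)" if "hc_odd x" "hc_odd y" for x y
  proof -
    have cross: "(1 \<otimes>\<^sub>s ?g x) * (?g y \<otimes>\<^sub>s 1) = - (?g y \<otimes>\<^sub>s ?g x)" if "hc_odd x" "hc_odd y" for x y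
    proof -
      have "is_odd (?g x)" "is_odd (?g y)" unfolding is_odd_def using odd_gen that by blast+
      then show ?thesis
        by (simp add: pure_times_pure pure_times_def is_odd_def even_part_def odd_part_def
            tensor_pure_simps flip: scaleR_2)
    qed
    have "?f x * ?f y + ?f y * ?f x =
        (?g x * ?g y + ?g y * ?g x) \<otimes>\<^sub>s 1 + 1 \<otimes>\<^sub>s (?g x * ?g y + ?g y * ?g x)"
    proof -
      have "?f x * ?f y + ?f y * ?f x =
          (?g x \<otimes>\<^sub>s 1) * (?g y \<otimes>\<^sub>s 1) + (?g x \<otimes>\<^sub>s 1) * (1 \<otimes>\<^sub>s ?g y) +
          (1 \<otimes>\<^sub>s ?g x) * (?g y \<otimes>\<^sub>s 1) + (1 \<otimes>\<^sub>s ?g x) * (1 \<otimes>\<^sub>s ?g y) +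
          ((?g y \<otimes>\<^sub>s 1) * (?g x \<otimes>\<^sub>s 1) + (?g y \<otimes>\<^sub>s 1) * (1 \<otimes>\<^sub>s ?g x) +
          (1 \<otimes>\<^sub>s ?g y) * (?g x \<otimes>\<^sub>s 1) + (1 \<otimes>\<^sub>s ?g y) * (1 \<otimes>\<^sub>s ?g x))"
        by (simp only: distrib_left distrib_right add.assoc add.commute add.left_commute)
      then show ?thesis
        by (simp add: cross that T[OF hom1(1)] T[OF _ hom1(1)] hom hom1 tensor_pure_simps)
    qed
    then show ?thesis by (simp only: hc_mapD(2)[OF hc_map_hc_gen that])
  qed
  moreover have "?f x * ?f y - ?f y * ?f x = ?f (hc_bracket x y)"
    if xy: "hc_even x \<and> (hc_even y \<or> hc_odd y) \<or> hc_odd x \<and> hc_even y" for x y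
  proof -
    have "is_even (?g x) \<or> is_even (?g y)" unfolding is_even_def using even_gen xy by blast
    moreover have "homogeneous (?g x)" "homogeneous (?g y)" using hom xy by blast+
    ultimately have "?f x * ?f y - ?f y * ?f x =
        (?g x * ?g y - ?g y * ?g x) \<otimes>\<^sub>s 1 + 1 \<otimes>\<^sub>s (?g x * ?g y - ?g y * ?g x)"
      by (auto simp: distrib_left distrib_right T hom1 tensor_pure_simps
          bilinear_lsub[OF bilinear_tensor_pure] bilinear_rsub[OF bilinear_tensor_pure])
    then show ?thesis by (simp only: hc_mapD(3)[OF hc_map_hc_gen xy])
  qed
  ultimately show ?thesis unfolding hc_map_def by blast
qed

lemma coproduct_hom:
  "coproduct 1 = 1"
  "coproduct (u + v) = coproduct u + coproduct v"
  "coproduct (u * v) = coproduct u * coproduct v"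
  "coproduct (c *\<^sub>R u) = c *\<^sub>R coproduct u"
  "coproduct (hc_gen x) = hc_gen x \<otimes>\<^sub>s 1 + 1 \<otimes>\<^sub>s hc_gen x"
  unfolding coproduct_def by (simp_all only: uhc_lift[OF hc_map_coproduct])


section \<open>Bases and the element \<open>\<gamma>\<close>\<close>

definition orthonormal_basis :: "(nat \<Rightarrow> 'v::euclidean_space) \<Rightarrow> bool" where
  "orthonormal_basis b \<longleftrightarrow>
    (\<forall>i\<in>{1..DIM('v)}. \<forall>j\<in>{1..DIM('v)}. inner (b i) (b j) = (if i = j then 1 else 0))"

definition gamma_elt :: "(nat \<Rightarrow> 'v::euclidean_space) \<Rightarrow> 'v uhc" where
  "gamma_elt b = prod_list (map (\<lambda>j. uhc_vec (b j)) [1..<Suc DIM('v)])"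

definition coproduct_expansion ::
  "(nat \<Rightarrow> 'v::euclidean_space) \<Rightarrow> ('v uhc \<times> 'v uhc) list \<Rightarrow> bool" where
  "coproduct_expansion b gs \<longleftrightarrow>
    coproduct (gamma_elt b) = sum_list (map (\<lambda>(x, y). x \<otimes>\<^sub>s y) gs) \<and>
    (\<forall>(x, y) \<in> set gs. homogeneous x \<and> homogeneous y)"

lemma coproduct_expansion_exists:
  fixes b :: "nat \<Rightarrow> 'v::euclidean_space"
  shows "\<exists>gs. coproduct_expansion b gs"
proof -
  have "\<exists>gs. t = sum_list (map (\<lambda>(x, y). x \<otimes>\<^sub>s y) gs) \<and>
      (\<forall>(x, y) \<in> set gs. homogeneous x \<and> homogeneous y)" for t :: "('v uhc, 'v uhc) tensor"
  proof (induction t rule: tensor_induct)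
    case (pure x y)
    have hom: "homogeneous (even_part u)" "homogeneous (odd_part u)" for u :: "'v uhc"
      by (simp_all add: homogeneous_def is_even_even_part is_odd_odd_part)
    have "x \<otimes>\<^sub>s y = (even_part x + odd_part x) \<otimes>\<^sub>s (even_part y + odd_part y)"
      by (simp add: even_part_add_odd_part)
    then show ?case
      by (intro exI[of _ "[(even_part x, even_part y), (even_part x, odd_part y),
            (odd_part x, even_part y), (odd_part x, odd_part y)]"])
        (simp add: hom tensor_pure_simps)
  next
    case (plus s t)
    then obtain gs hs where
      "s = sum_list (map (\<lambda>(x, y). x \<otimes>\<^sub>s y) gs)" "\<forall>(x, y) \<in> set gs. homogeneous x \<and> homogeneous y"
      "t = sum_list (map (\<lambda>(x, y). x \<otimes>\<^sub>s y) hs)" "\<forall>(x, y) \<in> set hs. homogeneous x \<and> homogeneous y"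
      by blast
    then show ?case by (intro exI[of _ "gs @ hs"]) auto
  qed
  then show ?thesis by (simp add: coproduct_expansion_def)
qed


section \<open>The algebras \<open>H\<^sub>\<zeta>\<close>\<close>

definition kron :: "complex mat \<Rightarrow> complex mat \<Rightarrow> complex mat" where
  "kron A B = Matrix.mat (dim_row A * dim_row B) (dim_col A * dim_col B)
    (\<lambda>(i, j). A $$ (i div dim_row B, j div dim_col B) * B $$ (i mod dim_row B, j mod dim_col B))"

definition krons :: "complex mat list \<Rightarrow> complex mat" where
  "krons Ms = foldr kron Ms (1\<^sub>m 1)"

definition sigma_mat :: "complex mat" where
  "sigma_mat = mat_of_rows_list 2 [[1, 0], [0, -1]]"

definition X_mat :: "complex \<Rightarrow> complex mat" where
  "X_mat \<zeta> = mat_of_rows_list 2 [[0, \<zeta>], [1, 0]]"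

definition Y_mat :: "complex \<Rightarrow> complex mat" where
  "Y_mat \<zeta> = mat_of_rows_list 2 [[0, \<i> * \<zeta>], [- \<i>, 0]]"

definition Gamma_mat :: "nat \<Rightarrow> complex mat" where
  "Gamma_mat k = krons (replicate k sigma_mat)"

definition even_clifford :: "nat \<Rightarrow> complex \<Rightarrow> nat \<Rightarrow> complex mat" where
  "even_clifford k \<zeta> m = (let j = (m + 1) div 2 in
    krons (replicate (j - 1) sigma_mat @ [if odd m then X_mat \<zeta> else Y_mat \<zeta>] @
      replicate (k - j) (1\<^sub>m 2)))"

text \<open>
  Uniformly in the parity of \<open>n\<close>, an element of \<open>H\<^sub>\<zeta>\<close> is a pair \<open>(M, N)\<close> of square matrices of
  size \<open>2\<^sup>k\<close>, \<open>k = \<lfloor>n/2\<rfloor>\<close>, standing for \<open>M + \<epsilon> N\<close>; for even \<open>n\<close> there is no \<open>\<epsilon>\<close> and \<open>N = 0\<close>.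
  In \<open>D\<^sub>\<zeta> \<otimes> Mat\<close> the element \<open>\<epsilon>\<close> commutes with matrices (ungraded tensor product of algebras),
  as needed for the \<open>c\<^sub>\<zeta>(a\<^sub>j)\<close> with \<open>j \<ge> 2\<close> to have square \<open>\<zeta>\<close>.
\<close>

type_synonym hmat = "complex mat \<times> complex mat"

definition H_dim :: "nat \<Rightarrow> nat" where
  "H_dim n = 2 ^ (n div 2)"

definition H_carrier :: "nat \<Rightarrow> hmat set" where
  "H_carrier n = {(M, N). M \<in> carrier_mat (H_dim n) (H_dim n) \<and> N \<in> carrier_mat (H_dim n) (H_dim n) \<and>
    (even n \<longrightarrow> N = 0\<^sub>m (H_dim n) (H_dim n))}"

definition H_zero :: "nat \<Rightarrow> hmat" where
  "H_zero n = (0\<^sub>m (H_dim n) (H_dim n), 0\<^sub>m (H_dim n) (H_dim n))"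

definition H_one :: "nat \<Rightarrow> hmat" where
  "H_one n = (1\<^sub>m (H_dim n), 0\<^sub>m (H_dim n) (H_dim n))"

definition H_add :: "hmat \<Rightarrow> hmat \<Rightarrow> hmat" where
  "H_add A B = (fst A + fst B, snd A + snd B)"

definition H_smult :: "complex \<Rightarrow> hmat \<Rightarrow> hmat" where
  "H_smult c A = (c \<cdot>\<^sub>m fst A, c \<cdot>\<^sub>m snd A)"

definition H_mult :: "complex \<Rightarrow> hmat \<Rightarrow> hmat \<Rightarrow> hmat" where
  "H_mult \<zeta> A B = (fst A * fst B + \<zeta> \<cdot>\<^sub>m (snd A * snd B), fst A * snd B + snd A * fst B)"

definition H_clifford :: "nat \<Rightarrow> complex \<Rightarrow> nat \<Rightarrow> hmat" where
  "H_clifford n \<zeta> j = (let k = n div 2; Z = 0\<^sub>m (2 ^ k) (2 ^ k) in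
    if even n then (even_clifford k \<zeta> j, Z)
    else if j = 1 then (Z, Gamma_mat k)
    else (Z, (- \<i>) \<cdot>\<^sub>m (Gamma_mat k * even_clifford k 1 (j - 1))))"

definition is_dpi :: "(nat \<Rightarrow> 'v::euclidean_space) \<Rightarrow> complex \<Rightarrow> ('v uhc \<Rightarrow> hmat) \<Rightarrow> bool" where
  "is_dpi b \<zeta> f \<longleftrightarrow>
    (\<forall>u. f u \<in> H_carrier DIM('v)) \<and>
    f 1 = H_one DIM('v) \<and>
    (\<forall>u v. f (u + v) = H_add (f u) (f v)) \<and>
    (\<forall>r u. f (r *\<^sub>R u) = H_smult (of_real r) (f u)) \<and>
    (\<forall>u v. f (u * v) = H_mult \<zeta> (f u) (f v)) \<and>
    (\<forall>j\<in>{1..DIM('v)}. f (uhc_vec (b j)) =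
       H_smult (exp (\<i> * of_real (pi / 4))) (H_clifford DIM('v) \<zeta> j)) \<and>
    f uhc_z = H_smult (\<i> * \<zeta>) (H_one DIM('v))"

subsection \<open>The Clifford relations\<close>

lemma kron_carrier:
  "A \<in> carrier_mat r c \<Longrightarrow> B \<in> carrier_mat r' c' \<Longrightarrow> kron A B \<in> carrier_mat (r * r') (c * c')"
  by (simp add: kron_def)

lemma kron_mult:
  assumes A: "A \<in> carrier_mat r m" and C: "C \<in> carrier_mat m c"
    and B: "B \<in> carrier_mat r' m'" and D: "D \<in> carrier_mat m' c'"
  shows "kron A B * kron C D = kron (A * C) (B * D)"
proof (rule eq_matI)
  note K = kron_carrier[OF A B] kron_carrier[OF C D] kron_carrier[of "A * C" r c "B * D" r' c']
  have AC: "A * C \<in> carrier_mat r c" "B * D \<in> carrier_mat r' c'" using assms by auto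
  fix i j assume "i < dim_row (kron (A * C) (B * D))" "j < dim_col (kron (A * C) (B * D))"
  then have i: "i < r * r'" and j: "j < c * c'" using K AC by auto
  have r': "i div r' < r" "i mod r' < r'" "j div c' < c" "j mod c' < c'"
    using i j by (auto simp: less_mult_imp_div_less mult.commute gr0_conv_Suc
        intro!: mod_less_divisor gr0I)
  have "(kron A B * kron C D) $$ (i, j) = (\<Sum>l<m * m'. kron A B $$ (i, l) * kron C D $$ (l, j))"
    using i j K by (simp add: scalar_prod_def lessThan_atLeast0)
  also have "\<dots> = (\<Sum>l<m * m'. (A $$ (i div r', l div m') * C $$ (l div m', j div c')) *
      (B $$ (i mod r', l mod m') * D $$ (l mod m', j mod c')))"
    using i j assms by (intro sum.cong) (auto simp: kron_def)
  also have "\<dots> = (\<Sum>p<m. \<Sum>q<m'. (A $$ (i div r', p) * C $$ (p, j div c')) *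
      (B $$ (i mod r', q) * D $$ (q, j mod c')))"
  proof (cases "m' = 0")
    case False
    have "(\<Sum>l<m * m'. f (l div m') (l mod m')) = (\<Sum>p<m. \<Sum>q<m'. f p q)"
      for f :: "nat \<Rightarrow> nat \<Rightarrow> complex"
    proof -
      have "(\<Sum>p<m. \<Sum>q<m'. f p q) = (\<Sum>(p, q)\<in>{..<m} \<times> {..<m'}. f p q)"
        by (simp add: sum.cartesian_product)
      also have "\<dots> = (\<Sum>l<m * m'. f (l div m') (l mod m'))"
      proof (rule sum.reindex_bij_witness[where j = "\<lambda>(p, q). p * m' + q"
            and i = "\<lambda>l. (l div m', l mod m')"])
        fix a assume a: "a \<in> {..<m} \<times> {..<m'}"
        show "(case a of (p, q) \<Rightarrow> p * m' + q) \<in> {..<m * m'}"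
        proof (cases a)
          case (Pair p q)
          then have "p * m' + q < Suc p * m'" using a by simp
          moreover have "Suc p * m' \<le> m * m'" using a Pair by (intro mult_le_mono1) simp
          ultimately have "p * m' + q < m * m'" by (rule less_le_trans)
          then show ?thesis using Pair by simp
        qed
      qed (use False in \<open>auto simp: less_mult_imp_div_less\<close>)
      finally show ?thesis by simp
    qed
    then show ?thesis .
  qed auto
  also have "\<dots> = (A * C) $$ (i div r', j div c') * (B * D) $$ (i mod r', j mod c')"
    using r' assms by (simp add: scalar_prod_def lessThan_atLeast0 sum_product)
  also have "\<dots> = kron (A * C) (B * D) $$ (i, j)"
    using i j assms by (simp add: kron_def)
  finally show "(kron A B * kron C D) $$ (i, j) = kron (A * C) (B * D) $$ (i, j)" .
qed (use assms in \<open>auto simp: kron_def\<close>)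

lemma kron_one: "kron (1\<^sub>m m) (1\<^sub>m l) = 1\<^sub>m (m * l)"
proof (rule eq_matI)
  fix i j assume "i < dim_row (1\<^sub>m (m * l) :: complex mat)" "j < dim_col (1\<^sub>m (m * l) :: complex mat)"
  then have ij: "i < m * l" "j < m * l" by auto
  then have l: "0 < l" by (auto intro!: gr0I)
  have "i div l < m" "i mod l < l" "j div l < m" "j mod l < l"
    using ij l by (auto simp: less_mult_imp_div_less)
  moreover have "i = j \<longleftrightarrow> i div l = j div l \<and> i mod l = j mod l"
    by (metis div_mult_mod_eq)
  ultimately show "kron (1\<^sub>m m) (1\<^sub>m l) $$ (i, j) = (1\<^sub>m (m * l) :: complex mat) $$ (i, j)"
    using ij by (auto simp: kron_def)
qed (auto simp: kron_def)

lemma kron_smult: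
  "kron (c \<cdot>\<^sub>m A) B = c \<cdot>\<^sub>m kron A B" "kron A (c \<cdot>\<^sub>m B) = c \<cdot>\<^sub>m kron A B"
proof -
  have bound: "i div l < m" "i mod l < l" if "i < m * l" for i l m :: nat
    using that by (auto simp: less_mult_imp_div_less intro!: mod_less_divisor gr0I)
  show "kron (c \<cdot>\<^sub>m A) B = c \<cdot>\<^sub>m kron A B" "kron A (c \<cdot>\<^sub>m B) = c \<cdot>\<^sub>m kron A B"
    by (rule eq_matI; auto simp: kron_def bound)+
qed

lemma krons_Cons: "krons (M # Ms) = kron M (krons Ms)"
  by (simp add: krons_def)

lemma krons_carrier:
  "set Ms \<subseteq> carrier_mat 2 2 \<Longrightarrow> krons Ms \<in> carrier_mat (2 ^ length Ms) (2 ^ length Ms)"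
proof (induction Ms)
  case Nil then show ?case by (simp add: krons_def)
next
  case (Cons M Ms)
  then show ?case using kron_carrier[of M 2 2 "krons Ms"] by (simp add: krons_Cons)
qed

lemma krons_mult:
  assumes "length Ms = length Ns" "set Ms \<subseteq> carrier_mat 2 2" "set Ns \<subseteq> carrier_mat 2 2"
  shows "krons Ms * krons Ns = krons (map2 (*) Ms Ns)"
  using assms
proof (induction Ms Ns rule: list_induct2)
  case Nil then show ?case by (simp add: krons_def)
next
  case (Cons M Ms N Ns)
  then show ?case
    using kron_mult[of M 2 2 N 2 "krons Ms" "2 ^ length Ms" "2 ^ length Ms" "krons Ns" "2 ^ length Ms"]
      krons_carrier[of Ms] krons_carrier[of Ns]
    by (simp add: krons_Cons)
qed

lemma krons_one: "krons (replicate k (1\<^sub>m 2)) = 1\<^sub>m (2 ^ k)"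
  by (induction k) (simp_all add: krons_Cons kron_one, simp add: krons_def)

lemma krons_smult:
  assumes "p < length Ms" "length Ns = length Ms" "Ns ! p = c \<cdot>\<^sub>m Ms ! p"
    "\<And>l. l < length Ms \<Longrightarrow> l \<noteq> p \<Longrightarrow> Ns ! l = Ms ! l"
  shows "krons Ns = c \<cdot>\<^sub>m krons Ms"
proof -
  have "Ns = Ms[p := c \<cdot>\<^sub>m Ms ! p]"
    using assms by (intro nth_equalityI) (auto simp: nth_list_update)
  moreover have "krons (Ms[p := c \<cdot>\<^sub>m Ms ! p]) = c \<cdot>\<^sub>m krons Ms"
    using assms(1)
  proof (induction Ms arbitrary: p)
    case (Cons M Ms)
    then show ?case by (cases p) (auto simp: krons_Cons kron_smult)
  qed simp
  ultimately show ?thesis by simp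
qed

lemma basic_carrier:
  "sigma_mat \<in> carrier_mat 2 2" "X_mat \<zeta> \<in> carrier_mat 2 2" "Y_mat \<zeta> \<in> carrier_mat 2 2"
  by (auto simp: sigma_mat_def X_mat_def Y_mat_def mat_of_rows_list_def)

lemma basic_mult:
  "sigma_mat * sigma_mat = 1\<^sub>m 2"
  "X_mat \<zeta> * X_mat \<zeta> = \<zeta> \<cdot>\<^sub>m 1\<^sub>m 2" "Y_mat \<zeta> * Y_mat \<zeta> = \<zeta> \<cdot>\<^sub>m 1\<^sub>m 2"
  "Y_mat \<zeta> * X_mat \<zeta> = (-1) \<cdot>\<^sub>m (X_mat \<zeta> * Y_mat \<zeta>)"
  "X_mat \<zeta> * Y_mat \<zeta> = (-1) \<cdot>\<^sub>m (Y_mat \<zeta> * X_mat \<zeta>)"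
  "sigma_mat * X_mat \<zeta> = (-1) \<cdot>\<^sub>m (X_mat \<zeta> * sigma_mat)"
  "X_mat \<zeta> * sigma_mat = (-1) \<cdot>\<^sub>m (sigma_mat * X_mat \<zeta>)"
  "sigma_mat * Y_mat \<zeta> = (-1) \<cdot>\<^sub>m (Y_mat \<zeta> * sigma_mat)"
  "Y_mat \<zeta> * sigma_mat = (-1) \<cdot>\<^sub>m (sigma_mat * Y_mat \<zeta>)"
proof -
  have i: "\<i> * \<zeta> * \<i> = - \<zeta>" by (metis complex_i_mult_minus mult.commute)
  show "sigma_mat * sigma_mat = 1\<^sub>m 2"
    "X_mat \<zeta> * X_mat \<zeta> = \<zeta> \<cdot>\<^sub>m 1\<^sub>m 2" "Y_mat \<zeta> * Y_mat \<zeta> = \<zeta> \<cdot>\<^sub>m 1\<^sub>m 2"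
    "Y_mat \<zeta> * X_mat \<zeta> = (-1) \<cdot>\<^sub>m (X_mat \<zeta> * Y_mat \<zeta>)"
    "X_mat \<zeta> * Y_mat \<zeta> = (-1) \<cdot>\<^sub>m (Y_mat \<zeta> * X_mat \<zeta>)"
    "sigma_mat * X_mat \<zeta> = (-1) \<cdot>\<^sub>m (X_mat \<zeta> * sigma_mat)"
    "X_mat \<zeta> * sigma_mat = (-1) \<cdot>\<^sub>m (sigma_mat * X_mat \<zeta>)"
    "sigma_mat * Y_mat \<zeta> = (-1) \<cdot>\<^sub>m (Y_mat \<zeta> * sigma_mat)"
    "Y_mat \<zeta> * sigma_mat = (-1) \<cdot>\<^sub>m (sigma_mat * Y_mat \<zeta>)"
    by (rule eq_matI; auto simp: sigma_mat_def X_mat_def Y_mat_def mat_of_rows_list_def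
        scalar_prod_def numeral_2_eq_2 less_Suc_eq i)+
qed

definition clifford_factors :: "nat \<Rightarrow> complex \<Rightarrow> nat \<Rightarrow> complex mat list" where
  "clifford_factors k \<zeta> m = (let j = (m + 1) div 2 in
    replicate (j - 1) sigma_mat @ [if odd m then X_mat \<zeta> else Y_mat \<zeta>] @ replicate (k - j) (1\<^sub>m 2))"

lemma even_clifford_eq: "even_clifford k \<zeta> m = krons (clifford_factors k \<zeta> m)"
  by (simp add: even_clifford_def clifford_factors_def Let_def)

lemma clifford_factors:
  assumes "m \<in> {1..2 * k}"
  shows "length (clifford_factors k \<zeta> m) = k"
    "set (clifford_factors k \<zeta> m) \<subseteq> carrier_mat 2 2"
    "l < k \<Longrightarrow> clifford_factors k \<zeta> m ! l = (if l + 1 < (m + 1) div 2 then sigma_mat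
      else if l + 1 = (m + 1) div 2 then (if odd m then X_mat \<zeta> else Y_mat \<zeta>) else 1\<^sub>m 2)"
proof -
  have j: "1 \<le> (m + 1) div 2" "(m + 1) div 2 \<le> k" using assms by auto
  then show "length (clifford_factors k \<zeta> m) = k"
    by (simp add: clifford_factors_def Let_def)
  show "set (clifford_factors k \<zeta> m) \<subseteq> carrier_mat 2 2"
    using basic_carrier by (auto simp: clifford_factors_def Let_def)
  show "clifford_factors k \<zeta> m ! l = (if l + 1 < (m + 1) div 2 then sigma_mat
      else if l + 1 = (m + 1) div 2 then (if odd m then X_mat \<zeta> else Y_mat \<zeta>) else 1\<^sub>m 2)" if "l < k"
    using that j unfolding clifford_factors_def Let_def
    by (auto simp: nth_append nth_Cons')
qed

lemma even_clifford_carrier: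
  "m \<in> {1..2 * k} \<Longrightarrow> even_clifford k \<zeta> m \<in> carrier_mat (2 ^ k) (2 ^ k)"
  using krons_carrier[of "clifford_factors k \<zeta> m"] clifford_factors(1,2)[of m k \<zeta>]
  by (simp add: even_clifford_eq)

lemma even_clifford_square:
  assumes "m \<in> {1..2 * k}"
  shows "even_clifford k \<zeta> m * even_clifford k \<zeta> m = \<zeta> \<cdot>\<^sub>m 1\<^sub>m (2 ^ k)"
proof -
  note F = clifford_factors[OF assms]
  have p: "(m + 1) div 2 - 1 < k" "(m + 1) div 2 \<ge> 1" using assms by (simp_all, presburger+)
  have "krons (map2 (*) (clifford_factors k \<zeta> m) (clifford_factors k \<zeta> m)) =
      \<zeta> \<cdot>\<^sub>m krons (replicate k (1\<^sub>m 2))"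
    by (rule krons_smult[of "(m + 1) div 2 - 1"]) (use p F(1,3) in \<open>auto simp: basic_mult(1-3)\<close>)
  then show ?thesis using F by (simp add: even_clifford_eq krons_mult krons_one)
qed

lemma even_clifford_anticommute:
  assumes "l \<in> {1..2 * k}" "m \<in> {1..2 * k}" "l < m"
  shows "even_clifford k \<zeta> l * even_clifford k \<zeta> m =
    (-1) \<cdot>\<^sub>m (even_clifford k \<zeta> m * even_clifford k \<zeta> l)"
proof -
  define L M where "L = clifford_factors k \<zeta> l" and "M = clifford_factors k \<zeta> m"
  obtain P Q where PQ: "P = (l + 1) div 2" "Q = (m + 1) div 2" by blast
  have P: "P - 1 < k" "1 \<le> P" "P \<le> Q" and same: "P = Q \<Longrightarrow> odd l \<and> even m"
    unfolding PQ using assms by (simp_all, presburger+)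
  have L: "L ! q = (if q + 1 < P then sigma_mat
      else if q + 1 = P then (if odd l then X_mat \<zeta> else Y_mat \<zeta>) else 1\<^sub>m 2)" if "q < k" for q
    unfolding L_def PQ by (rule clifford_factors(3)[OF assms(1) that])
  have M: "M ! q = (if q + 1 < Q then sigma_mat
      else if q + 1 = Q then (if odd m then X_mat \<zeta> else Y_mat \<zeta>) else 1\<^sub>m 2)" if "q < k" for q
    unfolding M_def PQ by (rule clifford_factors(3)[OF assms(2) that])
  have len: "length L = k" "length M = k"
    unfolding L_def M_def using clifford_factors(1) assms by auto
  have car: "set L \<subseteq> carrier_mat 2 2" "set M \<subseteq> carrier_mat 2 2"
    unfolding L_def M_def using clifford_factors(2) assms by blast+
  have "krons (map2 (*) L M) = (-1) \<cdot>\<^sub>m krons (map2 (*) M L)"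
  proof (rule krons_smult[of "P - 1"])
    have "L ! (P - 1) = (if odd l then X_mat \<zeta> else Y_mat \<zeta>)"
      using L[OF P(1)] P(2) by simp
    moreover have "M ! (P - 1) = (if P = Q then Y_mat \<zeta> else sigma_mat)"
      using M[OF P(1)] P(2,3) same by auto
    ultimately have "L ! (P - 1) * M ! (P - 1) = (-1) \<cdot>\<^sub>m (M ! (P - 1) * L ! (P - 1))"
      using same basic_mult(5,7,9)[of \<zeta>] by presburger
    then show "map2 (*) L M ! (P - 1) = (-1) \<cdot>\<^sub>m map2 (*) M L ! (P - 1)"
      using len P(1) by simp
    fix q assume q: "q < length (map2 (*) M L)" "q \<noteq> P - 1"
    then have k: "q < k" using len by simp
    have m: "M ! q \<in> carrier_mat 2 2" by (rule subsetD[OF car(2)]) (simp add: len k)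
    have "L ! q = M ! q \<or> L ! q = 1\<^sub>m 2"
      using L[OF k] M[OF k] P(2,3) q(2) by auto
    with m show "map2 (*) L M ! q = map2 (*) M L ! q"
      using len k by auto
  qed (use P(1) len in simp_all)
  then show ?thesis
    unfolding even_clifford_eq using len car by (simp add: krons_mult flip: L_def M_def)
qed

lemma Gamma_mat:
  "Gamma_mat k \<in> carrier_mat (2 ^ k) (2 ^ k)"
  "Gamma_mat k * Gamma_mat k = 1\<^sub>m (2 ^ k)"
proof -
  have sub: "set (replicate k sigma_mat) \<subseteq> carrier_mat 2 2" using basic_carrier by auto
  then show "Gamma_mat k \<in> carrier_mat (2 ^ k) (2 ^ k)"
    using krons_carrier[OF sub] by (simp add: Gamma_mat_def)
  show "Gamma_mat k * Gamma_mat k = 1\<^sub>m (2 ^ k)"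
    by (simp add: Gamma_mat_def krons_mult[OF _ sub sub] krons_one basic_mult)
qed

lemma Gamma_anticommute:
  assumes "m \<in> {1..2 * k}"
  shows "Gamma_mat k * even_clifford k \<zeta> m = (-1) \<cdot>\<^sub>m (even_clifford k \<zeta> m * Gamma_mat k)"
proof -
  define M where "M = clifford_factors k \<zeta> m"
  obtain Q where Q: "Q = (m + 1) div 2" by blast
  have Q': "Q - 1 < k" "1 \<le> Q" unfolding Q using assms by (simp_all, presburger+)
  have M: "M ! q = (if q + 1 < Q then sigma_mat
      else if q + 1 = Q then (if odd m then X_mat \<zeta> else Y_mat \<zeta>) else 1\<^sub>m 2)" if "q < k" for q
    unfolding M_def Q by (rule clifford_factors(3)[OF assms that])
  have len: "length M = k" and car: "set M \<subseteq> carrier_mat 2 2"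
    unfolding M_def using clifford_factors(1,2)[OF assms] by auto
  have sub: "set (replicate k sigma_mat) \<subseteq> carrier_mat 2 2" using basic_carrier by auto
  have "krons (map2 (*) (replicate k sigma_mat) M) =
      (-1) \<cdot>\<^sub>m krons (map2 (*) M (replicate k sigma_mat))"
  proof (rule krons_smult[of "Q - 1"])
    have "M ! (Q - 1) = (if odd m then X_mat \<zeta> else Y_mat \<zeta>)"
      using M[OF Q'(1)] Q'(2) by simp
    then have "sigma_mat * M ! (Q - 1) = (-1) \<cdot>\<^sub>m (M ! (Q - 1) * sigma_mat)"
      using basic_mult(6,8)[of \<zeta>] by presburger
    then show "map2 (*) (replicate k sigma_mat) M ! (Q - 1) =
        (-1) \<cdot>\<^sub>m map2 (*) M (replicate k sigma_mat) ! (Q - 1)"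
      using len Q'(1) by simp
    fix q assume q: "q < length (map2 (*) M (replicate k sigma_mat))" "q \<noteq> Q - 1"
    then have k: "q < k" using len by simp
    have "M ! q = sigma_mat \<or> M ! q = 1\<^sub>m 2" using M[OF k] q(2) Q'(2) by auto
    then show "map2 (*) (replicate k sigma_mat) M ! q = map2 (*) M (replicate k sigma_mat) ! q"
      using len k basic_carrier by auto
  qed (use Q'(1) len in simp_all)
  then show ?thesis
    unfolding even_clifford_eq Gamma_mat_def using len car sub
    by (simp add: krons_mult flip: M_def)
qed

lemma smult_smult_times: "c \<cdot>\<^sub>m (d \<cdot>\<^sub>m A) = (c * d) \<cdot>\<^sub>m A" for A :: "complex mat"
  by (rule eq_matI) auto

lemma one_smult_mat: "1 \<cdot>\<^sub>m A = A" for A :: "complex mat"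
  by (rule eq_matI) auto

lemma H_carrierD:
  assumes "A \<in> H_carrier n"
  shows "fst A \<in> carrier_mat (H_dim n) (H_dim n)" "snd A \<in> carrier_mat (H_dim n) (H_dim n)"
    "even n \<Longrightarrow> snd A = 0\<^sub>m (H_dim n) (H_dim n)"
  using assms by (auto simp: H_carrier_def)

lemma H_carrierI:
  assumes "fst A \<in> carrier_mat (H_dim n) (H_dim n)" "snd A \<in> carrier_mat (H_dim n) (H_dim n)"
    "even n \<Longrightarrow> snd A = 0\<^sub>m (H_dim n) (H_dim n)"
  shows "A \<in> H_carrier n"
  using assms by (cases A) (auto simp: H_carrier_def)

lemma H_closed:
  "H_zero n \<in> H_carrier n" "H_one n \<in> H_carrier n"
  "A \<in> H_carrier n \<Longrightarrow> H_smult c A \<in> H_carrier n"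
  "A \<in> H_carrier n \<Longrightarrow> B \<in> H_carrier n \<Longrightarrow> H_add A B \<in> H_carrier n"
  "A \<in> H_carrier n \<Longrightarrow> B \<in> H_carrier n \<Longrightarrow> H_mult \<zeta> A B \<in> H_carrier n"
proof -
  show "H_zero n \<in> H_carrier n" "H_one n \<in> H_carrier n"
    by (auto simp: H_carrier_def H_zero_def H_one_def)
  note D = H_carrierD
  show "H_smult c A \<in> H_carrier n" if "A \<in> H_carrier n"
    using D[OF that] by (intro H_carrierI) (auto simp: H_smult_def)
  show "H_add A B \<in> H_carrier n" if "A \<in> H_carrier n" "B \<in> H_carrier n"
    using D[OF that(1)] D[OF that(2)] by (intro H_carrierI) (auto simp: H_add_def)
  show "H_mult \<zeta> A B \<in> H_carrier n" if "A \<in> H_carrier n" "B \<in> H_carrier n"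
    using D[OF that(1)] D[OF that(2)] by (intro H_carrierI) (auto simp: H_mult_def)
qed

lemma H_dims:
  assumes "A \<in> H_carrier n"
  shows "dim_row (fst A) = H_dim n" "dim_col (fst A) = H_dim n"
    "dim_row (snd A) = H_dim n" "dim_col (snd A) = H_dim n"
  using H_carrierD[OF assms] by auto

lemma H_eqI:
  assumes "A \<in> H_carrier n" "B \<in> H_carrier n"
    "\<And>p q. p < H_dim n \<Longrightarrow> q < H_dim n \<Longrightarrow> fst A $$ (p, q) = fst B $$ (p, q)"
    "\<And>p q. p < H_dim n \<Longrightarrow> q < H_dim n \<Longrightarrow> snd A $$ (p, q) = snd B $$ (p, q)"
  shows "A = B"
  by (rule prod_eqI; rule eq_matI) (use assms H_dims[OF assms(1)] H_dims[OF assms(2)] in auto)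

lemma H_entries:
  assumes "p < H_dim n" "q < H_dim n"
  shows "fst (H_zero n) $$ (p, q) = 0" "snd (H_zero n) $$ (p, q) = 0"
    "fst (H_one n) $$ (p, q) = (if p = q then 1 else 0)" "snd (H_one n) $$ (p, q) = 0"
    "A \<in> H_carrier n \<Longrightarrow> fst (H_smult c A) $$ (p, q) = c * fst A $$ (p, q)"
    "A \<in> H_carrier n \<Longrightarrow> snd (H_smult c A) $$ (p, q) = c * snd A $$ (p, q)"
    "A \<in> H_carrier n \<Longrightarrow> B \<in> H_carrier n \<Longrightarrow>
      fst (H_add A B) $$ (p, q) = fst A $$ (p, q) + fst B $$ (p, q)"
    "A \<in> H_carrier n \<Longrightarrow> B \<in> H_carrier n \<Longrightarrow>
      snd (H_add A B) $$ (p, q) = snd A $$ (p, q) + snd B $$ (p, q)"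
    "A \<in> H_carrier n \<Longrightarrow> B \<in> H_carrier n \<Longrightarrow> fst (H_mult \<zeta> A B) $$ (p, q) =
      (\<Sum>r<H_dim n. fst A $$ (p, r) * fst B $$ (r, q) + \<zeta> * (snd A $$ (p, r) * snd B $$ (r, q)))"
    "A \<in> H_carrier n \<Longrightarrow> B \<in> H_carrier n \<Longrightarrow> snd (H_mult \<zeta> A B) $$ (p, q) =
      (\<Sum>r<H_dim n. fst A $$ (p, r) * snd B $$ (r, q) + snd A $$ (p, r) * fst B $$ (r, q))"
proof -
  show "fst (H_zero n) $$ (p, q) = 0" "snd (H_zero n) $$ (p, q) = 0"
    "fst (H_one n) $$ (p, q) = (if p = q then 1 else 0)" "snd (H_one n) $$ (p, q) = 0"
    using assms by (auto simp: H_zero_def H_one_def)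
  show "fst (H_smult c A) $$ (p, q) = c * fst A $$ (p, q)"
    "snd (H_smult c A) $$ (p, q) = c * snd A $$ (p, q)" if "A \<in> H_carrier n"
    using assms H_dims[OF that] by (simp_all add: H_smult_def)
  assume "A \<in> H_carrier n" "B \<in> H_carrier n"
  note dims = H_dims[OF this(1)] H_dims[OF this(2)]
  show "fst (H_add A B) $$ (p, q) = fst A $$ (p, q) + fst B $$ (p, q)"
    "snd (H_add A B) $$ (p, q) = snd A $$ (p, q) + snd B $$ (p, q)"
    using assms dims by (simp_all add: H_add_def)
  show "fst (H_mult \<zeta> A B) $$ (p, q) =
      (\<Sum>r<H_dim n. fst A $$ (p, r) * fst B $$ (r, q) + \<zeta> * (snd A $$ (p, r) * snd B $$ (r, q)))"
    "snd (H_mult \<zeta> A B) $$ (p, q) =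
      (\<Sum>r<H_dim n. fst A $$ (p, r) * snd B $$ (r, q) + snd A $$ (p, r) * fst B $$ (r, q))"
    using assms dims
    by (simp_all add: H_mult_def scalar_prod_def lessThan_atLeast0 sum.distrib sum_distrib_left)
qed

lemma H_mult_assoc:
  assumes "A \<in> H_carrier n" "B \<in> H_carrier n" "C \<in> H_carrier n"
  shows "H_mult \<zeta> (H_mult \<zeta> A B) C = H_mult \<zeta> A (H_mult \<zeta> B C)"
proof (rule H_eqI)
  let ?I = "{..<H_dim n}"
  fix p q assume pq: "p < H_dim n" "q < H_dim n"
  have swap: "(\<Sum>r\<in>?I. (\<Sum>s\<in>?I. f s r)) = (\<Sum>r\<in>?I. (\<Sum>s\<in>?I. f r s))" for f :: "nat \<Rightarrow> nat \<Rightarrow> complex"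
    by (rule sum.swap)
  show "fst (H_mult \<zeta> (H_mult \<zeta> A B) C) $$ (p, q) = fst (H_mult \<zeta> A (H_mult \<zeta> B C)) $$ (p, q)"
    using pq assms
    by (simp add: H_entries H_closed sum_distrib_left sum_distrib_right flip: sum.distrib)
      (subst swap, simp add: algebra_simps)
  show "snd (H_mult \<zeta> (H_mult \<zeta> A B) C) $$ (p, q) = snd (H_mult \<zeta> A (H_mult \<zeta> B C)) $$ (p, q)"
    using pq assms
    by (simp add: H_entries H_closed sum_distrib_left sum_distrib_right flip: sum.distrib)
      (subst swap, simp add: algebra_simps)
qed (use assms H_closed in auto)

lemma H_linear:
  "A \<in> H_carrier n \<Longrightarrow> B \<in> H_carrier n \<Longrightarrow> C \<in> H_carrier n \<Longrightarrow>
    H_add (H_add A B) C = H_add A (H_add B C)"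
  "A \<in> H_carrier n \<Longrightarrow> B \<in> H_carrier n \<Longrightarrow> H_add A B = H_add B A"
  "A \<in> H_carrier n \<Longrightarrow> H_add (H_zero n) A = A"
  "A \<in> H_carrier n \<Longrightarrow> H_add (H_smult (-1) A) A = H_zero n"
  "A \<in> H_carrier n \<Longrightarrow> H_smult (c + d) A = H_add (H_smult c A) (H_smult d A)"
  "A \<in> H_carrier n \<Longrightarrow> H_smult c (H_smult d A) = H_smult (c * d) A"
  "A \<in> H_carrier n \<Longrightarrow> H_smult 1 A = A"
  "A \<in> H_carrier n \<Longrightarrow> H_smult 0 A = H_zero n"
  "A \<in> H_carrier n \<Longrightarrow> B \<in> H_carrier n \<Longrightarrow> H_smult c (H_add A B) = H_add (H_smult c A) (H_smult c B)"
  by (rule H_eqI[where n = n]; simp add: H_entries H_closed algebra_simps)+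

lemma H_bilinear:
  "A \<in> H_carrier n \<Longrightarrow> B \<in> H_carrier n \<Longrightarrow> C \<in> H_carrier n \<Longrightarrow>
    H_mult \<zeta> (H_add A B) C = H_add (H_mult \<zeta> A C) (H_mult \<zeta> B C)"
  "A \<in> H_carrier n \<Longrightarrow> B \<in> H_carrier n \<Longrightarrow> C \<in> H_carrier n \<Longrightarrow>
    H_mult \<zeta> A (H_add B C) = H_add (H_mult \<zeta> A B) (H_mult \<zeta> A C)"
  "A \<in> H_carrier n \<Longrightarrow> B \<in> H_carrier n \<Longrightarrow> H_mult \<zeta> (H_smult c A) B = H_smult c (H_mult \<zeta> A B)"
  "A \<in> H_carrier n \<Longrightarrow> B \<in> H_carrier n \<Longrightarrow> H_mult \<zeta> A (H_smult c B) = H_smult c (H_mult \<zeta> A B)"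
  by (rule H_eqI[where n = n];
      simp add: H_entries H_closed algebra_simps sum.distrib sum_distrib_left)+

lemma H_one:
  assumes "A \<in> H_carrier n"
  shows "H_mult \<zeta> (H_one n) A = A" "H_mult \<zeta> A (H_one n) = A"
  using H_carrierD(1,2)[OF assms] by (auto simp: H_mult_def H_one_def intro!: prod_eqI)

definition odd_clifford :: "nat \<Rightarrow> nat \<Rightarrow> complex mat" where
  "odd_clifford k j =
    (if j = 1 then Gamma_mat k else (- \<i>) \<cdot>\<^sub>m (Gamma_mat k * even_clifford k 1 (j - 1)))"

lemma odd_clifford:
  assumes "i \<in> {1..2 * k + 1}" "j \<in> {1..2 * k + 1}"
  shows "odd_clifford k i \<in> carrier_mat (2 ^ k) (2 ^ k)"
    "odd_clifford k i * odd_clifford k i = 1\<^sub>m (2 ^ k)"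
    "i < j \<Longrightarrow> odd_clifford k i * odd_clifford k j = (-1) \<cdot>\<^sub>m (odd_clifford k j * odd_clifford k i)"
proof -
  let ?d = "2 ^ k :: nat" and ?G = "Gamma_mat k" and ?C = "even_clifford k 1"
  note G = Gamma_mat[of k]
  have C: "?C m \<in> carrier_mat ?d ?d" if "m \<in> {1..2 * k}" for m
    using that by (rule even_clifford_carrier)
  show "odd_clifford k i \<in> carrier_mat ?d ?d"
  proof (cases "i = 1")
    case False
    then have "i - 1 \<in> {1..2 * k}" using assms(1) by auto
    then show ?thesis
      using False mult_carrier_mat[OF G(1) C] by (simp add: odd_clifford_def)
  qed (use G in \<open>simp add: odd_clifford_def\<close>)
  have CG: "?C m * ?G = (-1) \<cdot>\<^sub>m (?G * ?C m)" if "m \<in> {1..2 * k}" for m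
    unfolding Gamma_anticommute[OF that] using G C[OF that] by (auto simp: smult_smult_times one_smult_mat)
  have GC: "?G * (?G * ?C m) = ?C m" if "m \<in> {1..2 * k}" for m
    using G C[OF that] by (simp flip: assoc_mult_mat[of _ ?d ?d _ ?d _ ?d])
  have CGC: "?G * ?C m * ?G = (-1) \<cdot>\<^sub>m ?C m" if "m \<in> {1..2 * k}" for m
  proof -
    have "?G * ?C m * ?G = ?G * (?C m * ?G)"
      using G C[OF that] by (simp add: assoc_mult_mat[of _ ?d ?d _ ?d _ ?d])
    also have "\<dots> = (-1) \<cdot>\<^sub>m (?G * (?G * ?C m))"
      unfolding CG[OF that] using G C[OF that] by (intro mult_smult_distrib) auto
    finally show ?thesis by (simp add: GC[OF that])
  qed
  have prod: "odd_clifford k (Suc l) * odd_clifford k (Suc m) = ?C l * ?C m"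
    if l: "l \<in> {1..2 * k}" and m: "m \<in> {1..2 * k}" for l m
  proof -
    have c: "?C l \<in> carrier_mat ?d ?d" "?C m \<in> carrier_mat ?d ?d" using C l m by auto
    have "odd_clifford k (Suc l) * odd_clifford k (Suc m) =
        ((- \<i>) \<cdot>\<^sub>m (?G * ?C l)) * ((- \<i>) \<cdot>\<^sub>m (?G * ?C m))"
      using l m by (simp add: odd_clifford_def)
    also have "\<dots> = (- \<i>) \<cdot>\<^sub>m ((- \<i>) \<cdot>\<^sub>m ((?G * ?C l) * (?G * ?C m)))"
      using G c by (subst mult_smult_assoc_mat[of _ ?d ?d _ ?d], auto)
    also have "(?G * ?C l) * (?G * ?C m) = (?G * ?C l * ?G) * ?C m"
      using G c by (subst assoc_mult_mat[of "?G * ?C l" ?d ?d ?G ?d "?C m" ?d]) auto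
    also have "\<dots> = (-1) \<cdot>\<^sub>m (?C l * ?C m)"
      unfolding CGC[OF l] using c by (intro mult_smult_assoc_mat) auto
    finally show ?thesis by (simp add: smult_smult_times one_smult_mat)
  qed
  have cases: "i = 1 \<or> (\<exists>m \<in> {1..2 * k}. i = Suc m)" if "i \<in> {1..2 * k + 1}" for i
  proof (cases "i = 1")
    case False
    then have "i - 1 \<in> {1..2 * k}" "i = Suc (i - 1)" using that by auto
    then show ?thesis by blast
  qed simp
  have sq: "?C m * ?C m = 1\<^sub>m ?d" if "m \<in> {1..2 * k}" for m
    using even_clifford_square[OF that, of 1] by (simp add: one_smult_mat)
  from cases[OF assms(1)] show "odd_clifford k i * odd_clifford k i = 1\<^sub>m ?d"
  proof
    assume "i = 1"
    then show ?thesis using G by (simp add: odd_clifford_def)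
  next
    assume "\<exists>m \<in> {1..2 * k}. i = Suc m"
    then show ?thesis using prod sq by auto
  qed
  show "odd_clifford k i * odd_clifford k j = (-1) \<cdot>\<^sub>m (odd_clifford k j * odd_clifford k i)" if less: "i < j"
  proof -
    obtain m where m: "m \<in> {1..2 * k}" "j = Suc m" using cases[OF assms(2)] less assms(1) by auto
    from cases[OF assms(1)] show ?thesis
    proof
      assume i: "i = 1"
      have "odd_clifford k i * odd_clifford k j = (- \<i>) \<cdot>\<^sub>m (?G * (?G * ?C m))"
        using i m G C[OF m(1)] mult_smult_distrib[of ?G ?d ?d "?G * ?C m" ?d "- \<i>"]
        by (simp add: odd_clifford_def)
      moreover have "odd_clifford k j * odd_clifford k i = (- \<i>) \<cdot>\<^sub>m (?G * ?C m * ?G)"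
        using i m G C[OF m(1)] mult_smult_assoc_mat[of "?G * ?C m" ?d ?d ?G ?d "- \<i>"]
        by (simp add: odd_clifford_def)
      ultimately show ?thesis
        unfolding GC[OF m(1)] CGC[OF m(1)] by (simp add: smult_smult_times one_smult_mat)
    next
      assume "\<exists>l \<in> {1..2 * k}. i = Suc l"
      then obtain l where l: "l \<in> {1..2 * k}" "i = Suc l" by blast
      then show ?thesis
        using prod[OF l(1) m(1)] prod[OF m(1) l(1)] less m
          even_clifford_anticommute[OF l(1) m(1), of 1] by simp
    qed
  qed
qed

lemma H_clifford_odd:
  "odd n \<Longrightarrow> H_clifford n \<zeta> j = (0\<^sub>m (H_dim n) (H_dim n), odd_clifford (n div 2) j)"
  by (simp add: H_clifford_def odd_clifford_def H_dim_def Let_def)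

lemma H_clifford:
  assumes "i \<in> {1..n}" "j \<in> {1..n}"
  shows "H_clifford n \<zeta> i \<in> H_carrier n"
    "H_add (H_mult \<zeta> (H_clifford n \<zeta> i) (H_clifford n \<zeta> j))
      (H_mult \<zeta> (H_clifford n \<zeta> j) (H_clifford n \<zeta> i)) =
      H_smult (if i = j then 2 * \<zeta> else 0) (H_one n)"
proof -
  let ?d = "H_dim n" and ?c = "H_clifford n \<zeta>"
  have car: "?c j \<in> H_carrier n" if "j \<in> {1..n}" for j
  proof (cases "even n")
    case True
    then show ?thesis using that even_clifford_carrier[of j "n div 2" \<zeta>]
      by (auto simp: H_carrier_def H_clifford_def H_dim_def Let_def)
  next
    case False
    then have "j \<in> {1..2 * (n div 2) + 1}" using that by simp
    then show ?thesis
      using odd_clifford(1) False by (auto simp: H_carrier_def H_clifford_odd H_dim_def)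
  qed
  then show "?c i \<in> H_carrier n" using assms by blast
  have sq: "H_mult \<zeta> (?c j) (?c j) = H_smult \<zeta> (H_one n)" if "j \<in> {1..n}" for j
  proof (cases "even n")
    case True
    then show ?thesis
      using that even_clifford_square[of j "n div 2" \<zeta>] even_clifford_carrier[of j "n div 2" \<zeta>]
      by (simp add: H_mult_def H_clifford_def H_dim_def H_smult_def H_one_def Let_def)
  next
    case False
    then have "j \<in> {1..2 * (n div 2) + 1}" using that by simp
    note O = odd_clifford[OF this this]
    show ?thesis
      using O(1,2) False by (simp add: H_mult_def H_clifford_odd H_dim_def H_smult_def H_one_def)
  qed
  have anti: "H_mult \<zeta> (?c i) (?c j) = H_smult (-1) (H_mult \<zeta> (?c j) (?c i))"
    if "i \<in> {1..n}" "j \<in> {1..n}" "i < j" for i j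
  proof (cases "even n")
    case True
    then show ?thesis
      using that even_clifford_anticommute[of i "n div 2" j \<zeta>]
        even_clifford_carrier[of i "n div 2" \<zeta>] even_clifford_carrier[of j "n div 2" \<zeta>]
      by (simp add: H_mult_def H_clifford_def H_dim_def H_smult_def Let_def)
  next
    case False
    then have ij: "i \<in> {1..2 * (n div 2) + 1}" "j \<in> {1..2 * (n div 2) + 1}" using that by simp_all
    show ?thesis
      using odd_clifford(1)[OF ij] odd_clifford(1)[OF ij(2) ij(1)] odd_clifford(3)[OF ij that(3)] False
      by (simp add: H_mult_def H_clifford_odd H_dim_def H_smult_def smult_smult_times one_smult_mat)
  qed
  have m: "H_mult \<zeta> (?c i) (?c j) \<in> H_carrier n" "H_mult \<zeta> (?c j) (?c i) \<in> H_carrier n"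
    using car assms H_closed(5) by auto
  have one: "H_one n \<in> H_carrier n" by (rule H_closed)
  consider "i = j" | "i < j" | "j < i" by linarith
  then show "H_add (H_mult \<zeta> (?c i) (?c j)) (H_mult \<zeta> (?c j) (?c i)) =
      H_smult (if i = j then 2 * \<zeta> else 0) (H_one n)"
  proof cases
    case 1
    then show ?thesis
      using sq[OF assms(2)] H_linear(5)[OF one, of \<zeta> \<zeta>] by simp
  next
    case 2
    then show ?thesis
      using anti[OF assms 2] H_linear(4)[OF m(2)] H_linear(8)[OF one] by simp
  next
    case 3
    then show ?thesis
      using anti[OF assms(2) assms(1) 3] H_linear(4)[OF m(1)] H_linear(8)[OF one]
        H_linear(2)[OF m] by simp
  qed
qed

lemma orthonormal_basis_expand:
  fixes b :: "nat \<Rightarrow> 'v::euclidean_space"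
  assumes "orthonormal_basis b"
  shows "w = (\<Sum>j\<in>{1..DIM('v)}. inner w (b j) *\<^sub>R b j)"
proof -
  let ?J = "{1..DIM('v)}"
  have on: "inner (b i) (b j) = (if i = j then 1 else 0)" if "i \<in> ?J" "j \<in> ?J" for i j
    using assms that unfolding orthonormal_basis_def by blast
  have inj: "inj_on b ?J"
  proof (rule inj_onI)
    fix i j assume ij: "i \<in> ?J" "j \<in> ?J" "b i = b j"
    then have "inner (b i) (b j) = 1" using on[of i i] by simp
    then show "i = j" using on[OF ij(1,2)] by (simp split: if_splits)
  qed
  have orth: "pairwise real_inner_class.orthogonal (b ` ?J)"
    unfolding pairwise_def real_inner_class.orthogonal_def using on by fastforce
  have nz: "0 \<notin> b ` ?J" using on by force
  have ind: "independent (b ` ?J)" by (rule pairwise_orthogonal_independent[OF orth nz])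
  have span: "span (b ` ?J) = UNIV"
  proof -
    have "DIM('v) = card (b ` ?J)" using inj by (simp add: card_image)
    then have "UNIV \<subseteq> span (b ` ?J)"
      by (intro card_ge_dim_independent ind) (simp_all add: dim_UNIV)
    then show ?thesis by blast
  qed
  define r where "r = w - (\<Sum>j\<in>?J. inner w (b j) *\<^sub>R b j)"
  have "real_inner_class.orthogonal r x" if "x \<in> b ` ?J" for x
  proof -
    obtain i where i: "i \<in> ?J" "x = b i" using \<open>x \<in> b ` ?J\<close> by blast
    have "inner (\<Sum>j\<in>?J. inner w (b j) *\<^sub>R b j) (b i) = (\<Sum>j\<in>?J. inner w (b j) * inner (b j) (b i))"
      by (simp add: inner_sum_left)
    also have "\<dots> = (\<Sum>j\<in>?J. if j = i then inner w (b i) else 0)"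
      by (rule sum.cong) (use on i(1) in auto)
    finally show ?thesis
      using i by (simp add: real_inner_class.orthogonal_def r_def inner_diff_left)
  qed
  then have "real_inner_class.orthogonal r r" using orthogonal_to_span[of r "b ` ?J" r] span by simp
  then show ?thesis by (simp add: r_def real_inner_class.orthogonal_self)
qed

lemma orthonormal_basis_inner:
  fixes b :: "nat \<Rightarrow> 'v::euclidean_space"
  assumes "orthonormal_basis b"
  shows "inner v w = (\<Sum>j\<in>{1..DIM('v)}. inner v (b j) * inner w (b j))"
  by (subst orthonormal_basis_expand[OF assms, of w])
    (simp add: inner_sum_right mult.commute)

definition H_gen :: "(nat \<Rightarrow> 'v::euclidean_space) \<Rightarrow> complex \<Rightarrow> nat \<Rightarrow> hmat" where
  "H_gen b \<zeta> j = H_smult (exp (\<i> * of_real (pi / 4))) (H_clifford DIM('v) \<zeta> j)"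

definition H_vec :: "(nat \<Rightarrow> 'v::euclidean_space) \<Rightarrow> complex \<Rightarrow> 'v \<Rightarrow> hmat" where
  "H_vec b \<zeta> v = (let d = H_dim DIM('v) in
    (Matrix.mat d d (\<lambda>(p, q). \<Sum>j\<in>{1..DIM('v)}. of_real (inner v (b j)) * fst (H_gen b \<zeta> j) $$ (p, q)),
     Matrix.mat d d (\<lambda>(p, q). \<Sum>j\<in>{1..DIM('v)}. of_real (inner v (b j)) * snd (H_gen b \<zeta> j) $$ (p, q))))"

definition H_hc :: "(nat \<Rightarrow> 'v::euclidean_space) \<Rightarrow> complex \<Rightarrow> 'v \<times> real \<Rightarrow> hmat" where
  "H_hc b \<zeta> x = H_add (H_vec b \<zeta> (fst x)) (H_smult (\<i> * \<zeta> * of_real (snd x)) (H_one DIM('v)))"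

primrec H_eval :: "(nat \<Rightarrow> 'v::euclidean_space) \<Rightarrow> complex \<Rightarrow> ('v \<times> real) alg_term \<Rightarrow> hmat" where
  "H_eval b \<zeta> (Gen x) = H_hc b \<zeta> x"
| "H_eval b \<zeta> (Scal c) = H_smult (of_real c) (H_one DIM('v))"
| "H_eval b \<zeta> (Plus s t) = H_add (H_eval b \<zeta> s) (H_eval b \<zeta> t)"
| "H_eval b \<zeta> (Times s t) = H_mult \<zeta> (H_eval b \<zeta> s) (H_eval b \<zeta> t)"

lemma H_gen:
  fixes b :: "nat \<Rightarrow> 'v::euclidean_space"
  assumes "i \<in> {1..DIM('v)}" "j \<in> {1..DIM('v)}"
  shows "H_gen b \<zeta> i \<in> H_carrier DIM('v)"
    "H_add (H_mult \<zeta> (H_gen b \<zeta> i) (H_gen b \<zeta> j)) (H_mult \<zeta> (H_gen b \<zeta> j) (H_gen b \<zeta> i)) =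
      H_smult (if i = j then 2 * \<i> * \<zeta> else 0) (H_one DIM('v))"
proof -
  let ?n = "DIM('v)"
  define e where "e = exp (\<i> * of_real (pi / 4))"
  have g: "H_gen b \<zeta> j = H_smult e (H_clifford ?n \<zeta> j)" for j
    by (simp only: H_gen_def e_def)
  note c = H_clifford(1)[OF assms, of \<zeta>] H_clifford(1)[OF assms(2,1), of \<zeta>]
  have "cis (pi / 4) * cis (pi / 4) = \<i>" by (simp add: cis_mult)
  then have e: "e * e = \<i>" by (simp only: cis_conv_exp e_def)
  show "H_gen b \<zeta> i \<in> H_carrier ?n" using c H_closed(3) by (simp add: g)
  have "H_mult \<zeta> (H_gen b \<zeta> i) (H_gen b \<zeta> j) = H_smult \<i> (H_mult \<zeta> (H_clifford ?n \<zeta> i) (H_clifford ?n \<zeta> j))"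
    "H_mult \<zeta> (H_gen b \<zeta> j) (H_gen b \<zeta> i) = H_smult \<i> (H_mult \<zeta> (H_clifford ?n \<zeta> j) (H_clifford ?n \<zeta> i))"
    unfolding g
    using c by (simp_all add: H_bilinear(3,4)[where n = ?n] H_linear(6)[where n = ?n] H_closed e)
  then have "H_add (H_mult \<zeta> (H_gen b \<zeta> i) (H_gen b \<zeta> j)) (H_mult \<zeta> (H_gen b \<zeta> j) (H_gen b \<zeta> i)) =
      H_smult \<i> (H_add (H_mult \<zeta> (H_clifford ?n \<zeta> i) (H_clifford ?n \<zeta> j))
        (H_mult \<zeta> (H_clifford ?n \<zeta> j) (H_clifford ?n \<zeta> i)))"
    using c by (simp add: H_linear(9)[where n = ?n] H_closed)
  also have "\<dots> = H_smult (if i = j then 2 * \<i> * \<zeta> else 0) (H_one ?n)"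
    unfolding H_clifford(2)[OF assms]
    by (simp add: H_linear(6)[where n = ?n] H_closed mult.left_commute mult.commute)
  finally show "H_add (H_mult \<zeta> (H_gen b \<zeta> i) (H_gen b \<zeta> j)) (H_mult \<zeta> (H_gen b \<zeta> j) (H_gen b \<zeta> i)) =
      H_smult (if i = j then 2 * \<i> * \<zeta> else 0) (H_one ?n)" .
qed

lemma H_vec_carrier: "H_vec b \<zeta> v \<in> H_carrier DIM('v)" for b :: "nat \<Rightarrow> 'v::euclidean_space"
proof -
  have "snd (H_gen b \<zeta> j) $$ (p, q) = 0"
    if "even DIM('v)" "j \<in> {1..DIM('v)}" "p < H_dim DIM('v)" "q < H_dim DIM('v)" for j p q
    using that H_carrierD(3)[OF H_gen(1)[of j j b \<zeta>]] by simp
  then show ?thesis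
    by (intro H_carrierI) (auto simp: H_vec_def Let_def intro!: eq_matI sum.neutral)
qed

lemma H_vec_entries:
  fixes b :: "nat \<Rightarrow> 'v::euclidean_space"
  assumes "p < H_dim DIM('v)" "q < H_dim DIM('v)"
  shows
    "fst (H_vec b \<zeta> v) $$ (p, q) = (\<Sum>j\<in>{1..DIM('v)}. of_real (inner v (b j)) * fst (H_gen b \<zeta> j) $$ (p, q))"
    "snd (H_vec b \<zeta> v) $$ (p, q) = (\<Sum>j\<in>{1..DIM('v)}. of_real (inner v (b j)) * snd (H_gen b \<zeta> j) $$ (p, q))"
  using assms by (simp_all add: H_vec_def Let_def)

lemma H_vec_mult:
  fixes b :: "nat \<Rightarrow> 'v::euclidean_space"
  assumes b: "orthonormal_basis b"
  shows "H_add (H_mult \<zeta> (H_vec b \<zeta> v) (H_vec b \<zeta> w)) (H_mult \<zeta> (H_vec b \<zeta> w) (H_vec b \<zeta> v)) =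
    H_smult (\<i> * \<zeta> * of_real (2 * inner v w)) (H_one DIM('v))"
proof -
  let ?n = "DIM('v)" and ?J = "{1..DIM('v)}" and ?g = "H_gen b \<zeta>"
  let ?cv = "\<lambda>i. complex_of_real (inner v (b i))" and ?cw = "\<lambda>i. complex_of_real (inner w (b i))"
  note V = H_vec_carrier[of b \<zeta>]
  have g: "?g j \<in> H_carrier ?n" if "j \<in> ?J" for j using H_gen(1)[OF that that] .
  have expand: "fst (H_mult \<zeta> (H_vec b \<zeta> v) (H_vec b \<zeta> w)) $$ (p, q) =
      (\<Sum>i\<in>?J. \<Sum>j\<in>?J. of_real (inner v (b i)) * of_real (inner w (b j)) * fst (H_mult \<zeta> (?g i) (?g j)) $$ (p, q))"
    "snd (H_mult \<zeta> (H_vec b \<zeta> v) (H_vec b \<zeta> w)) $$ (p, q) =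
      (\<Sum>i\<in>?J. \<Sum>j\<in>?J. of_real (inner v (b i)) * of_real (inner w (b j)) * snd (H_mult \<zeta> (?g i) (?g j)) $$ (p, q))"
    if pq: "p < H_dim ?n" "q < H_dim ?n" for p q v w
  proof -
    let ?R = "{..<H_dim ?n}"
    have sw: "(\<Sum>r\<in>?R. \<Sum>i\<in>?J. \<Sum>j\<in>?J. f r i j) = (\<Sum>i\<in>?J. \<Sum>j\<in>?J. \<Sum>r\<in>?R. f r i j)"
      for f :: "nat \<Rightarrow> nat \<Rightarrow> nat \<Rightarrow> complex"
      by (subst sum.swap) (rule sum.cong[OF refl], rule sum.swap)
    have prod: "(\<Sum>i\<in>?J. of_real (inner v (b i)) * x i) * (\<Sum>j\<in>?J. of_real (inner w (b j)) * y j) =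
      (\<Sum>i\<in>?J. \<Sum>j\<in>?J. of_real (inner v (b i)) * of_real (inner w (b j)) * (x i * y j))"
      for x y :: "nat \<Rightarrow> complex"
      unfolding sum_product by (simp add: mult_ac)
    have "fst (H_mult \<zeta> (H_vec b \<zeta> v) (H_vec b \<zeta> w)) $$ (p, q) =
      (\<Sum>r\<in>?R. \<Sum>i\<in>?J. \<Sum>j\<in>?J. of_real (inner v (b i)) * of_real (inner w (b j)) *
        (fst (?g i) $$ (p, r) * fst (?g j) $$ (r, q) + \<zeta> * (snd (?g i) $$ (p, r) * snd (?g j) $$ (r, q))))"
      using pq V
      by (simp add: H_entries H_vec_entries prod del: One_nat_def)
        (simp add: sum.distrib sum_distrib_left algebra_simps)
    then show "fst (H_mult \<zeta> (H_vec b \<zeta> v) (H_vec b \<zeta> w)) $$ (p, q) =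
      (\<Sum>i\<in>?J. \<Sum>j\<in>?J. of_real (inner v (b i)) * of_real (inner w (b j)) * fst (H_mult \<zeta> (?g i) (?g j)) $$ (p, q))"
      unfolding sw using pq g by (simp add: H_entries sum_distrib_left)
    have "snd (H_mult \<zeta> (H_vec b \<zeta> v) (H_vec b \<zeta> w)) $$ (p, q) =
      (\<Sum>r\<in>?R. \<Sum>i\<in>?J. \<Sum>j\<in>?J. of_real (inner v (b i)) * of_real (inner w (b j)) *
        (fst (?g i) $$ (p, r) * snd (?g j) $$ (r, q) + snd (?g i) $$ (p, r) * fst (?g j) $$ (r, q)))"
      using pq V
      by (simp add: H_entries H_vec_entries prod del: One_nat_def)
        (simp add: sum.distrib sum_distrib_left algebra_simps)
    then show "snd (H_mult \<zeta> (H_vec b \<zeta> v) (H_vec b \<zeta> w)) $$ (p, q) =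
      (\<Sum>i\<in>?J. \<Sum>j\<in>?J. of_real (inner v (b i)) * of_real (inner w (b j)) * snd (H_mult \<zeta> (?g i) (?g j)) $$ (p, q))"
      unfolding sw using pq g by (simp add: H_entries sum_distrib_left)
  qed
  have sym: "(\<Sum>i\<in>?J. \<Sum>j\<in>?J. ?cv i * ?cw j * f i j) + (\<Sum>i\<in>?J. \<Sum>j\<in>?J. ?cw i * ?cv j * f i j) =
      (\<Sum>i\<in>?J. \<Sum>j\<in>?J. ?cv i * ?cw j * (f i j + f j i))" for f :: "nat \<Rightarrow> nat \<Rightarrow> complex"
    by (subst (2) sum.swap) (simp add: algebra_simps flip: sum.distrib)
  have m: "H_mult \<zeta> (?g i) (?g j) \<in> H_carrier ?n" if "i \<in> ?J" "j \<in> ?J" for i j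
    using g that H_closed(5) by blast
  have rel: "fst (H_mult \<zeta> (?g i) (?g j)) $$ (p, q) + fst (H_mult \<zeta> (?g j) (?g i)) $$ (p, q) =
      (if i = j \<and> p = q then 2 * \<i> * \<zeta> else 0)"
    "snd (H_mult \<zeta> (?g i) (?g j)) $$ (p, q) + snd (H_mult \<zeta> (?g j) (?g i)) $$ (p, q) = 0"
    if pq: "p < H_dim ?n" "q < H_dim ?n" and ij: "i \<in> ?J" "j \<in> ?J" for p q i j
  proof -
    let ?X = "H_add (H_mult \<zeta> (?g i) (?g j)) (H_mult \<zeta> (?g j) (?g i))"
    have "fst ?X $$ (p, q) = (if i = j \<and> p = q then 2 * \<i> * \<zeta> else 0)" "snd ?X $$ (p, q) = 0"
      unfolding H_gen(2)[OF ij] using pq H_closed(2)[of ?n] by (auto simp: H_entries)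
    then show "fst (H_mult \<zeta> (?g i) (?g j)) $$ (p, q) + fst (H_mult \<zeta> (?g j) (?g i)) $$ (p, q) =
      (if i = j \<and> p = q then 2 * \<i> * \<zeta> else 0)"
      "snd (H_mult \<zeta> (?g i) (?g j)) $$ (p, q) + snd (H_mult \<zeta> (?g j) (?g i)) $$ (p, q) = 0"
      using m[OF ij] m[OF ij(2,1)] pq by (simp_all add: H_entries(7,8)[of p ?n q])
  qed
  show ?thesis
  proof (rule H_eqI)
    show car: "H_add (H_mult \<zeta> (H_vec b \<zeta> v) (H_vec b \<zeta> w)) (H_mult \<zeta> (H_vec b \<zeta> w) (H_vec b \<zeta> v)) \<in> H_carrier ?n"
      "H_smult (\<i> * \<zeta> * of_real (2 * inner v w)) (H_one ?n) \<in> H_carrier ?n"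
      using V H_closed by auto
    have vw: "H_mult \<zeta> (H_vec b \<zeta> v) (H_vec b \<zeta> w) \<in> H_carrier ?n" for v w
      using V H_closed(5) by blast
    fix p q assume pq: "p < H_dim ?n" "q < H_dim ?n"
    have "(\<Sum>i\<in>?J. \<Sum>j\<in>?J. ?cv i * ?cw j * (if i = j \<and> p = q then 2 * \<i> * \<zeta> else 0)) =
        (\<Sum>i\<in>?J. ?cv i * ?cw i * (if p = q then 2 * \<i> * \<zeta> else 0))"
    proof (rule sum.cong[OF refl])
      fix i assume "i \<in> ?J"
      then show "(\<Sum>j\<in>?J. ?cv i * ?cw j * (if i = j \<and> p = q then 2 * \<i> * \<zeta> else 0)) =
          ?cv i * ?cw i * (if p = q then 2 * \<i> * \<zeta> else 0)"
        by (subst sum.remove[of _ i]) (auto intro!: sum.neutral)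
    qed
    also have "\<dots> = of_real (inner v w) * (if p = q then 2 * \<i> * \<zeta> else 0)"
      by (simp add: orthonormal_basis_inner[OF b, of v w] sum_distrib_right)
    finally have key: "(\<Sum>i\<in>?J. \<Sum>j\<in>?J. ?cv i * ?cw j * (if i = j \<and> p = q then 2 * \<i> * \<zeta> else 0)) =
        of_real (inner v w) * (if p = q then 2 * \<i> * \<zeta> else 0)" .
    have relsum: "(\<Sum>i\<in>?J. \<Sum>j\<in>?J. ?cv i * ?cw j *
          (fst (H_mult \<zeta> (?g i) (?g j)) $$ (p, q) + fst (H_mult \<zeta> (?g j) (?g i)) $$ (p, q))) =
        (\<Sum>i\<in>?J. \<Sum>j\<in>?J. ?cv i * ?cw j * (if i = j \<and> p = q then 2 * \<i> * \<zeta> else 0))"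
      "(\<Sum>i\<in>?J. \<Sum>j\<in>?J. ?cv i * ?cw j *
          (snd (H_mult \<zeta> (?g i) (?g j)) $$ (p, q) + snd (H_mult \<zeta> (?g j) (?g i)) $$ (p, q))) = 0"
      using rel[OF pq] by (auto intro!: sum.cong sum.neutral)
    show "fst (H_add (H_mult \<zeta> (H_vec b \<zeta> v) (H_vec b \<zeta> w)) (H_mult \<zeta> (H_vec b \<zeta> w) (H_vec b \<zeta> v))) $$ (p, q) =
        fst (H_smult (\<i> * \<zeta> * of_real (2 * inner v w)) (H_one ?n)) $$ (p, q)"
      unfolding H_entries(7)[OF pq vw vw] expand[OF pq] sym
      unfolding relsum key using pq
      by (simp add: H_entries(3) H_entries(5)[OF pq H_closed(2)])
    show "snd (H_add (H_mult \<zeta> (H_vec b \<zeta> v) (H_vec b \<zeta> w)) (H_mult \<zeta> (H_vec b \<zeta> w) (H_vec b \<zeta> v))) $$ (p, q) =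
        snd (H_smult (\<i> * \<zeta> * of_real (2 * inner v w)) (H_one ?n)) $$ (p, q)"
      unfolding H_entries(8)[OF pq vw vw] expand[OF pq] sym
      unfolding relsum using pq
      by (simp add: H_entries(4) H_entries(6)[OF pq H_closed(2)])
  qed
qed

lemma H_vec_linear:
  fixes b :: "nat \<Rightarrow> 'v::euclidean_space"
  shows "H_vec b \<zeta> (v + w) = H_add (H_vec b \<zeta> v) (H_vec b \<zeta> w)"
    "H_vec b \<zeta> (c *\<^sub>R v) = H_smult (of_real c) (H_vec b \<zeta> v)"
    "H_vec b \<zeta> 0 = H_zero DIM('v)"
  by (rule H_eqI[where n = "DIM('v)"]; use H_vec_carrier[of b \<zeta>] H_closed in
      \<open>simp add: H_entries H_vec_entries inner_add_left algebra_simps sum.distrib sum_distrib_left\<close>)+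

lemma H_hc_carrier: "H_hc b \<zeta> x \<in> H_carrier DIM('v)" for b :: "nat \<Rightarrow> 'v::euclidean_space"
  unfolding H_hc_def by (intro H_closed H_vec_carrier)

lemma H_eval_carrier: "H_eval b \<zeta> t \<in> H_carrier DIM('v)" for b :: "nat \<Rightarrow> 'v::euclidean_space"
  by (induction t) (auto intro: H_closed H_hc_carrier)

lemma H_hc_linear:
  fixes b :: "nat \<Rightarrow> 'v::euclidean_space"
  shows "H_hc b \<zeta> (x + y) = H_add (H_hc b \<zeta> x) (H_hc b \<zeta> y)"
    "H_hc b \<zeta> (c *\<^sub>R x) = H_smult (of_real c) (H_hc b \<zeta> x)"
  unfolding H_hc_def
  by (rule H_eqI[where n = "DIM('v)"]; use H_vec_carrier[of b \<zeta>] H_closed in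
      \<open>simp add: H_entries H_vec_linear algebra_simps\<close>)+

lemma H_hc_simps:
  fixes b :: "nat \<Rightarrow> 'v::euclidean_space"
  shows "hc_odd x \<Longrightarrow> H_hc b \<zeta> x = H_vec b \<zeta> (fst x)"
    "hc_even x \<Longrightarrow> H_hc b \<zeta> x = H_smult (\<i> * \<zeta> * of_real (snd x)) (H_one DIM('v))"
proof -
  have "H_hc b \<zeta> x = H_add (H_zero DIM('v)) (H_vec b \<zeta> (fst x))" if "snd x = 0"
    unfolding H_hc_def
    using H_linear(2)[OF H_closed(1) H_vec_carrier[of b \<zeta> "fst x"]]
      H_linear(8)[OF H_closed(2), of "DIM('v)"]
    by (simp add: that)
  then show "H_hc b \<zeta> x = H_vec b \<zeta> (fst x)" if "hc_odd x"
    using that H_linear(3)[OF H_vec_carrier[of b \<zeta> "fst x"]] by (simp add: hc_odd_def)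
  show "H_hc b \<zeta> x = H_smult (\<i> * \<zeta> * of_real (snd x)) (H_one DIM('v))" if "hc_even x"
    using that
    by (simp add: hc_even_def H_hc_def H_vec_linear H_linear(3) H_closed)
qed

lemma H_eval_cong:
  fixes b :: "nat \<Rightarrow> 'v::euclidean_space"
  assumes b: "orthonormal_basis b" and "hc_cong s t"
  shows "H_eval b \<zeta> s = H_eval b \<zeta> t"
  using assms(2)
proof (induction rule: hc_cong.induct)
  case (hc_bracket_odd x y)
  then show ?case
    using H_vec_mult[OF b, of \<zeta> "fst x" "fst y"]
    by (simp add: H_hc_simps(1)) (simp add: H_hc_simps(2) hc_even_def hc_bracket_def)
next
  case (hc_bracket_even x y)
  let ?n = "DIM('v)"
  note E = H_hc_carrier[of b \<zeta>] and O = H_closed(2)[of ?n]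
  have z: "H_hc b \<zeta> (hc_bracket x y) = H_zero ?n"
    using hc_bracket_even O
    by (auto simp: hc_even_def hc_bracket_def H_hc_simps(2) H_linear(8)[where n = ?n])
  have comm: "H_mult \<zeta> (H_hc b \<zeta> x) (H_hc b \<zeta> y) = H_mult \<zeta> (H_hc b \<zeta> y) (H_hc b \<zeta> x)"
    if "hc_even x" for x y
    using E[of y] O by (simp add: H_hc_simps(2)[OF that] H_bilinear(3,4)[where n = ?n] H_one[where n = ?n])
  have c: "H_mult \<zeta> (H_hc b \<zeta> x) (H_hc b \<zeta> y) = H_mult \<zeta> (H_hc b \<zeta> y) (H_hc b \<zeta> x)"
    using hc_bracket_even comm[of x y] comm[of y x] by auto
  let ?m = "H_mult \<zeta> (H_hc b \<zeta> y) (H_hc b \<zeta> x)"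
  have m: "?m \<in> H_carrier ?n" "H_smult (-1) ?m \<in> H_carrier ?n" by (intro H_closed E)+
  have "H_add ?m (H_smult (-1) ?m) = H_zero ?n"
    using H_linear(2)[OF m] H_linear(4)[OF m(1)] by simp
  then show ?case
    using O m by (simp add: z c H_bilinear(3)[where n = ?n] H_one[where n = ?n])
next
  case (hc_scal_central s c)
  then show ?case
    by (simp add: H_bilinear(3,4)[where n = "DIM('v)"] H_one[where n = "DIM('v)"]
        H_eval_carrier H_closed)
next
  case (hc_plus_comm s t)
  show ?case
    using H_linear(2)[OF H_eval_carrier[of b \<zeta> s] H_eval_carrier[of b \<zeta> t]] by simp
qed (simp_all add: H_linear(1,3-9)[where n = "DIM('v)"] mult.commute H_bilinear[where n = "DIM('v)"]
    H_one[where n = "DIM('v)"] H_mult_assoc[where n = "DIM('v)"] H_hc_linear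
    H_eval_carrier H_hc_carrier H_closed)

lemma is_dpi_unique_existence:
  fixes b :: "nat \<Rightarrow> 'v::euclidean_space"
  assumes b: "orthonormal_basis b"
  shows "\<exists>!f. is_dpi b \<zeta> f"
proof (rule ex_ex1I)
  let ?n = "DIM('v)"
  let ?f = "\<lambda>u. H_eval b \<zeta> (rep_uhc u)"
  have abs: "?f (abs_uhc t) = H_eval b \<zeta> t" for t
    by (rule H_eval_cong[OF b]) (simp_all add: Quotient3_rep_abs[OF Quotient3_uhc] hc_refl)
  note O = H_closed(2)[of ?n]
  have vec: "H_vec b \<zeta> (b j) = H_gen b \<zeta> j" if j: "j \<in> {1..?n}" for j
  proof (rule H_eqI[OF H_vec_carrier H_gen(1)[OF j j]])
    have *: "(\<Sum>i\<in>{1..?n}. complex_of_real (inner (b j) (b i)) * h i) = h j" for h :: "nat \<Rightarrow> complex"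
    proof -
      have "(\<Sum>i\<in>{1..?n}. complex_of_real (inner (b j) (b i)) * h i) =
          (\<Sum>i\<in>{1..?n}. if i = j then h j else 0)"
        using b j unfolding orthonormal_basis_def by (intro sum.cong) auto
      also have "\<dots> = h j" using j by simp
      finally show ?thesis .
    qed
    fix p q assume pq: "p < H_dim ?n" "q < H_dim ?n"
    show "fst (H_vec b \<zeta> (b j)) $$ (p, q) = fst (H_gen b \<zeta> j) $$ (p, q)"
      "snd (H_vec b \<zeta> (b j)) $$ (p, q) = snd (H_gen b \<zeta> j) $$ (p, q)"
      by (simp_all only: H_vec_entries[OF pq] *)
  qed
  have "is_dpi b \<zeta> ?f"
    unfolding is_dpi_def
  proof (intro conjI allI ballI)
    fix u v :: "'v uhc" and r :: real and j
    show "?f u \<in> H_carrier ?n" by (rule H_eval_carrier)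
    show "?f 1 = H_one ?n" using O by (simp add: one_uhc.abs_eq abs H_linear(7)[where n = ?n])
    show "?f (u + v) = H_add (?f u) (?f v)"
      by (induction u, induction v) (simp add: plus_uhc.abs_eq abs)
    show "?f (r *\<^sub>R u) = H_smult (of_real r) (?f u)"
      using O H_eval_carrier[of b \<zeta>]
      by (induction u rule: uhc.abs_induct)
        (simp only: scaleR_uhc.abs_eq abs, simp add: H_bilinear(3)[where n = ?n] H_one[where n = ?n])
    show "?f (u * v) = H_mult \<zeta> (?f u) (?f v)"
      by (induction u, induction v) (simp add: times_uhc.abs_eq abs)
    show "?f (uhc_vec (b j)) = H_smult (exp (\<i> * of_real (pi / 4))) (H_clifford ?n \<zeta> j)"
      if "j \<in> {1..?n}"
      using vec[OF that]
      by (simp add: uhc_vec_def hc_gen.abs_eq abs H_hc_simps(1) hc_odd_def H_gen_def)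
    show "?f uhc_z = H_smult (\<i> * \<zeta>) (H_one ?n)"
      by (simp add: uhc_z_def hc_gen.abs_eq abs H_hc_simps(2) hc_even_def)
  qed
  then show "\<exists>f. is_dpi b \<zeta> f" by blast
next
  let ?n = "DIM('v)"
  fix f g assume f: "is_dpi b \<zeta> f" and g: "is_dpi b \<zeta> g"
  have zero: "f 0 = g 0"
  proof -
    have "f (0 *\<^sub>R 1) = g (0 *\<^sub>R 1)" using f g unfolding is_dpi_def by metis
    then show ?thesis by simp
  qed
  have gen_eq: "f (hc_gen x) = g (hc_gen x)" for x
  proof -
    have "hc_gen x = uhc_vec (fst x) + snd x *\<^sub>R uhc_z"
      by (simp add: uhc_vec_def uhc_z_def flip: linear_scale[OF linear_hc_gen] linear_add[OF linear_hc_gen])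
    also have "uhc_vec (fst x) = (\<Sum>j\<in>{1..?n}. inner (fst x) (b j) *\<^sub>R uhc_vec (b j))"
    proof -
      have lin: "linear (uhc_vec :: 'v \<Rightarrow> 'v uhc)"
        by (rule linearI) (simp_all add: uhc_vec_def
            flip: linear_scale[OF linear_hc_gen] linear_add[OF linear_hc_gen])
      show ?thesis
        by (subst orthonormal_basis_expand[OF b, of "fst x"])
          (simp add: linear_sum[OF lin] linear_scale[OF lin])
    qed
    finally have x: "hc_gen x = (\<Sum>j\<in>{1..?n}. inner (fst x) (b j) *\<^sub>R uhc_vec (b j)) + snd x *\<^sub>R uhc_z" .
    have sums: "f (\<Sum>j\<in>J. inner (fst x) (b j) *\<^sub>R uhc_vec (b j)) =
        g (\<Sum>j\<in>J. inner (fst x) (b j) *\<^sub>R uhc_vec (b j))" if "finite J" "J \<subseteq> {1..?n}" for J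
      using that
    proof (induction J rule: finite_induct)
      case empty
      then show ?case using zero by simp
    next
      case (insert j J)
      then have "f (uhc_vec (b j)) = g (uhc_vec (b j))" using f g unfolding is_dpi_def by simp
      then show ?case using insert f g unfolding is_dpi_def by simp
    qed
    have z: "f uhc_z = g uhc_z" using f g unfolding is_dpi_def by simp
    have lin: "h (u + c *\<^sub>R v) = H_add (h u) (H_smult (of_real c) (h v))" if "is_dpi b \<zeta> h" for h u c v
      using that unfolding is_dpi_def by simp
    show ?thesis
      unfolding x lin[OF f] lin[OF g] z using sums[of "{1..?n}"] by simp
  qed
  show "f = g"
  proof
    fix u
    show "f u = g u"
    proof (induction u rule: uhc_induct)
      case (gen x) then show ?case by (simp add: gen_eq)
    next
      case (scal c) then show ?case using f g unfolding is_dpi_def of_real_def by simp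
    next
      case (plus u v) then show ?case using f g unfolding is_dpi_def by simp
    next
      case (times u v) then show ?case using f g unfolding is_dpi_def by simp
    qed
  qed
qed

subsection \<open>The homomorphism, the functional \<open>T\<close>, and entire functions\<close>

definition dpi :: "(nat \<Rightarrow> 'v::euclidean_space) \<Rightarrow> complex \<Rightarrow> 'v uhc \<Rightarrow> hmat" where
  "dpi b \<zeta> = (THE f. is_dpi b \<zeta> f)"

lemma is_dpi_dpi: "orthonormal_basis b \<Longrightarrow> is_dpi b \<zeta> (dpi b \<zeta>)"
  unfolding dpi_def by (rule theI'[OF is_dpi_unique_existence])

definition mat_trace :: "complex mat \<Rightarrow> complex" where
  "mat_trace M = (\<Sum>i<dim_row M. M $$ (i, i))"

text \<open>
  The matrix of the endomorphism \<open>M + \<epsilon> N\<close> of \<open>D\<^sub>\<zeta> \<otimes> \<complex>\<^bsup>2^k\<^esup> = \<complex>\<^bsup>2^k\<^esup> \<oplus> \<epsilon> \<complex>\<^bsup>2^k\<^esup>\<close>.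
\<close>

definition D_endomorphism :: "complex \<Rightarrow> hmat \<Rightarrow> complex mat" where
  "D_endomorphism \<zeta> A = four_block_mat (fst A) (\<zeta> \<cdot>\<^sub>m snd A) (snd A) (fst A)"

definition H_functional :: "nat \<Rightarrow> complex \<Rightarrow> hmat \<Rightarrow> complex" where
  "H_functional n \<zeta> A =
    (if even n then mat_trace (Gamma_mat (n div 2) * fst A)
     else mat_trace (D_endomorphism \<zeta>
       (H_mult \<zeta> (H_smult (exp (\<i> * of_real (pi / 4))) (0\<^sub>m (H_dim n) (H_dim n), 1\<^sub>m (H_dim n))) A)))"

definition H_entire :: "nat \<Rightarrow> (complex \<Rightarrow> hmat) \<Rightarrow> bool" where
  "H_entire n A \<longleftrightarrow> (\<forall>\<zeta>. A \<zeta> \<in> H_carrier n) \<and>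
    (\<forall>p<H_dim n. \<forall>q<H_dim n. (\<lambda>\<zeta>. fst (A \<zeta>) $$ (p, q)) holomorphic_on UNIV \<and>
      (\<lambda>\<zeta>. snd (A \<zeta>) $$ (p, q)) holomorphic_on UNIV)"


section \<open>Function spaces and the Fourier transform\<close>

definition smooth :: "(real \<Rightarrow> complex) \<Rightarrow> bool" where
  "smooth f \<longleftrightarrow> (\<forall>k. ((\<lambda>g x. vector_derivative g (at x)) ^^ k) f differentiable_on UNIV)"

definition HC_smooth :: "('v::real_inner uhc \<Rightarrow> real \<Rightarrow> complex) set" where
  "HC_smooth = {F. (\<forall>u. smooth (F u)) \<and> (\<forall>x. linear (\<lambda>u. F u x)) \<and>
    (\<forall>u x. (F u has_vector_derivative F (uhc_z * u) x) (at x))}"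

definition HC_smooth_supported :: "real \<Rightarrow> ('v::real_inner uhc \<Rightarrow> real \<Rightarrow> complex) set" where
  "HC_smooth_supported a = {F \<in> HC_smooth. \<forall>u. closure {x. F u x \<noteq> 0} \<subseteq> {-a..a}}"

text \<open>The value does not depend on the choice of the expansion of \<open>\<Delta>(\<gamma>)\<close>.\<close>

definition HC_fourier ::
  "(nat \<Rightarrow> 'v::euclidean_space) \<Rightarrow> ('v uhc \<Rightarrow> real \<Rightarrow> complex) \<Rightarrow> complex \<Rightarrow> hmat" where
  "HC_fourier b F \<zeta> = foldr
    (\<lambda>(x, y). H_add (H_smult (\<integral>t. F x t * exp (- \<i> * \<zeta> * of_real t) \<partial>lborel) (dpi b (- \<zeta>) y)))
    (SOME gs. coproduct_expansion b gs) (H_zero DIM('v))"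

definition paley_wiener :: "(nat \<Rightarrow> 'v::euclidean_space) \<Rightarrow> real \<Rightarrow> (complex \<Rightarrow> hmat) set" where
  "paley_wiener b a = {A. H_entire DIM('v) A \<and>
    (\<forall>(N::nat) u. \<exists>C. \<forall>\<zeta>. \<zeta> \<noteq> 0 \<longrightarrow>
      cmod (H_functional DIM('v) (- \<zeta>) (H_mult (- \<zeta>) (A \<zeta>) (dpi b (- \<zeta>) u)) /
          \<zeta> ^ ((DIM('v) + 1) div 2))
        \<le> C * exp (a * \<bar>Im \<zeta>\<bar>) / (1 + cmod \<zeta>) ^ N)}"

end

theory Submission
  imports Defs "HOL-Complex_Analysis.Complex_Analysis" "HOL-Probability.Characteristic_Functions"
    "HOL-Probability.Sinc_Integral" "HOL-Real_Asymp.Real_Asymp" "Jordan_Normal_Form.Determinant"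
begin

text \<open>
  The products \<open>\<gamma>\<^sub>I\<close> of the \<open>a\<^sub>i\<close> with \<open>i \<in>
      I\<close> form a basis of the enveloping algebra over \<open>\<real>[z]\<close>, so
  an element \<open>F\<close> of the function space is the same thing as the family of smooth
      functions \<open>F(\<gamma>\<^sub>I)\<close>.
  Since \<open>\<Delta>(\<gamma>) = \<Sum>\<^sub>I \<plusminus> \<gamma>\<^sub>I \<otimes>
      \<gamma>\<^sub>J\<close>, where \<open>J\<close> is the complement of \<open>I\<close>, the
          transform of \<open>F\<close> at \<open>\<zeta>\<close> is
  the combination of the \<open>d\<pi>(\<gamma>\<^sub>J)\<close> whose coefficients are, up to sign,
      the ordinary Fourier transforms
  of the \<open>F(\<gamma>\<^sub>I)\<close>. The functional \<open>T\<close> is a (super)trace,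
      hence kills \<open>d\<pi>(\<gamma>\<^sub>K)\<close> unless \<open>K\<close> is the full
  index set, where it is a nonzero multiple of \<open>\<zeta>\<^bsup>[n]\<^esup>\<close>; therefore
      pairing with \<open>d\<pi>(\<gamma>\<^sub>I)\<close> and
  dividing by \<open>\<zeta>\<^bsup>[n]\<^esup>\<close> recovers the Fourier transform of
      \<open>F(\<gamma>\<^sub>I)\<close>, and for \<open>\<zeta> \<noteq> 0\<close> a dimension count
  makes the pairing nondegenerate. This reduces the claim to the classical Paley--Wiener theorem; the
  singularity of the quotients at \<open>\<zeta> = 0\<close> is removable because the growth
      condition bounds them there.
\<close>

section \<open>The classical Paley--Wiener theorem\<close>

text \<open>The obstacle is \<zeta> = 0: there z acts by 0 and the pairing T(AX) degenerates. Hence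
  trace identities are stated for \<zeta> \<noteq> 0, with constants independent of \<zeta>, and
  equalities of entire functions reach 0 by continuity. Signs of reordered products are only known
  to lie in {1, -1}; this suffices because all that matters about the constants is that they do not
  vanish.

  The presentation shows only that the z^k \<open>\<gamma>\<^sub>I\<close> span. Their independence
  comes from the representations: pairing with the complementary monomial isolates one I and leaves
  a polynomial in i\<zeta>. Surjectivity rests on this basis: F is prescribed on z^k
  \<open>\<gamma>\<^sub>I\<close> as the k-th derivative of one function, so that F(zu) = F(u)'
  holds by construction.

  The exponent [n] has two sources. The product of all generators yields \<zeta>^k with k = n div 2;
  for odd n the functional T inserts one more \<epsilon>, and \<epsilon>^2 = \<zeta> adds one. The
  dimension count compares the 2^n subsets I with the matrix coordinates, which number 2^n in both
  parities.\<close>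

lemma integrable_inverse_one_plus_square: "integrable lborel (\<lambda>x::real. 1 / (1 + x\<^sup>2))"
proof -
  let ?f = "\<lambda>x::real. indicator {0<..} x *\<^sub>R (1 / (1 + x\<^sup>2))"
  have f: "integrable lborel ?f"
    using integrable_I0i_1_div_plus_square
    by (simp add: interval_lebesgue_integrable_def set_integrable_def zero_ereal_def)
  have "integrable lborel (\<lambda>x. ?f (0 + (-1) * x))"
    by (rule lborel_integrable_real_affine[OF f]) simp
  moreover have "integrable lborel (indicator {0::real} :: real \<Rightarrow> real)" by simp
  ultimately have "integrable lborel (\<lambda>x. ?f x + ?f (0 + (-1) * x) + indicator {0} x)"
    using f by (intro Bochner_Integration.integrable_add)
  moreover have "?f x + ?f (0 + (-1) * x) + indicator {0} x = 1 / (1 + x\<^sup>2)" for x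
    by (cases x "0::real" rule: linorder_cases) auto
  ultimately show ?thesis by simp
qed

text \<open>The known characteristic function of the standard normal distribution, freed from the
  factor 1 / sqrt(2 pi) of its density.\<close>

lemma gaussian_fourier_transform:
  fixes v :: real
  shows "integrable lborel (\<lambda>t. exp (\<i> * of_real (v * t)) * complex_of_real (exp (-
      t\<^sup>2 / 2)))"
    and "(\<integral>t. exp (\<i> * of_real (v * t)) * complex_of_real (exp (- t\<^sup>2 / 2))
        \<partial>lborel) =
      of_real (sqrt (2 * pi) * exp (- v\<^sup>2 / 2))"
proof -
  have d: "std_normal_density t *\<^sub>R exp (\<i> * of_real (v * t)) =
      of_real (1 / sqrt (2 * pi)) * (exp (\<i> * of_real (v * t)) * complex_of_real (exp (-
          t\<^sup>2 / 2)))" for t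
    by (simp add: std_normal_density_def scaleR_conv_of_real exp_of_real)
  have "integrable lborel (\<lambda>t. std_normal_density t *\<^sub>R exp (\<i> * of_real (v * t)))"
  proof (rule Bochner_Integration.integrable_bound[OF integrable_normal_density[of 1 0]])
    show "AE t in lborel. norm (std_normal_density t *\<^sub>R exp (\<i> * complex_of_real (v * t)))
      \<le> norm (std_normal_density t)"
      by (intro always_eventually allI) (simp add: norm_exp_i_times)
  qed simp_all
  then have "integrable lborel (\<lambda>t. complex_of_real (sqrt (2 * pi)) *
      (std_normal_density t *\<^sub>R exp (\<i> * of_real (v * t))))"
    by (rule integrable_mult_right)
  moreover have "complex_of_real (sqrt (2 * pi)) * (std_normal_density t *\<^sub>R exp (\<i> *
      of_real (v * t))) =
      exp (\<i> * of_real (v * t)) * complex_of_real (exp (- t\<^sup>2 / 2))" for t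
    unfolding d by (simp flip: of_real_mult)
  ultimately show "integrable lborel (\<lambda>t. exp (\<i> * of_real (v * t)) * complex_of_real
      (exp (- t\<^sup>2 / 2)))"
    by simp
  have "char std_normal_distribution v =
      (\<integral>t. std_normal_density t *\<^sub>R exp (\<i> * of_real (v * t)) \<partial>lborel)"
    unfolding char_def by (subst integral_density) auto
  also have "\<dots> = of_real (1 / sqrt (2 * pi)) *
      (\<integral>t. exp (\<i> * of_real (v * t)) * complex_of_real (exp (- t\<^sup>2 / 2))
          \<partial>lborel)"
    unfolding d by simp
  finally show "(\<integral>t. exp (\<i> * of_real (v * t)) * complex_of_real (exp (- t\<^sup>2 /
      2)) \<partial>lborel) =
      of_real (sqrt (2 * pi) * exp (- v\<^sup>2 / 2))"
    by (simp add: char_std_normal_distribution field_simps)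
qed

definition fourier :: "(real \<Rightarrow> complex) \<Rightarrow> complex \<Rightarrow> complex" where
  "fourier h \<zeta> = (\<integral>t. h t * exp (- \<i> * \<zeta> * of_real t) \<partial>lborel)"

lemma integral_real_scale:
  fixes f :: "real \<Rightarrow> 'a::euclidean_space" and c :: real
  assumes "c > 0"
  shows "(\<integral>t. f (t / c) \<partial>lborel) = c *\<^sub>R (\<integral>t. f t \<partial>lborel)"
  using lborel_integral_real_affine[of "1 / c" f 0] assms by simp

text \<open>The factor \<open>G (e n * t)\<close> makes the double integral absolutely convergent,
  so Fubini applies, and integrating out t leaves a Gaussian average of \<open>h\<close> around
  \<open>x\<close> of width \<open>e n\<close>. When \<open>e n\<close> tends to 0, the integrable
  transform dominates one side and \<open>B\<close> times the Gaussian the other.\<close>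

lemma fourier_inversion:
  fixes h :: "real \<Rightarrow> complex"
  assumes h: "integrable lborel h" and cont: "continuous_on UNIV h"
    and bound: "\<And>x. norm (h x) \<le> B"
    and H: "integrable lborel (\<lambda>t. fourier h (of_real t))"
  shows "(\<integral>t. fourier h (of_real t) * exp (\<i> * of_real (t * x)) \<partial>lborel) = 2 *
      of_real pi * h x"
proof -
  define e where "e n = inverse (real (Suc n))" for n
  have e0: "e n > 0" for n by (simp add: e_def)
  have e_lim: "e \<longlonglongrightarrow> 0" unfolding e_def using LIMSEQ_inverse_real_of_nat by simp
  define G where "G t = complex_of_real (exp (- t\<^sup>2 / 2))" for t :: real
  have G_meas[measurable]: "G \<in> borel_measurable borel" unfolding G_def by measurable
  have G_le: "norm (G t) \<le> 1" for t unfolding G_def by simp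
  have G_int: "integrable lborel G"
    unfolding G_def using gaussian_fourier_transform(1)[of 0] by simp
  have h_meas[measurable]: "h \<in> borel_measurable borel" using cont
      by (rule borel_measurable_continuous_onI)
  have H_meas[measurable]: "(\<lambda>t. fourier h (of_real t)) \<in> borel_measurable borel"
    using H by (simp add: borel_measurable_integrable)
  have Gscale: "integrable lborel (\<lambda>t. G (e n * t))" for n
    using lborel_integrable_real_affine[OF G_int, of "e n" 0] e0[of n] by simp
  have swap: "(\<integral>t. fourier h (of_real t) * exp (\<i> * of_real (t * x)) * G (e n * t)
      \<partial>lborel) =
      of_real (sqrt (2 * pi)) * (\<integral>s. h (x + e n * s) * G s \<partial>lborel)" for n
  proof -
    let ?F = "\<lambda>t y. h y * exp (\<i> * of_real ((x - y) * t)) * G (e n * t)"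
    have "integrable (lborel \<Otimes>\<^sub>M lborel) (\<lambda>(t, y). ?F t y)"
    proof (rule lborel_pair.Fubini_integrable)
      show "(\<lambda>(t, y). ?F t y) \<in> borel_measurable (lborel \<Otimes>\<^sub>M lborel)" by
          measurable
      have nrm: "norm (?F t y) = norm (G (e n * t)) * norm (h y)" for t y
        by (simp add: norm_mult norm_exp_i_times mult.commute)
      show "integrable lborel (\<lambda>t. LBINT y. norm (case (t, y) of (t, y) \<Rightarrow> ?F t y))"
        using Gscale[of n] by (simp only: case_prod_conv nrm) simp
      have "integrable lborel (?F t)" for t
        by (rule Bochner_Integration.integrable_bound[of _ "\<lambda>y. norm (G (e n * t)) * norm (h
            y)"])
          (use h in \<open>simp_all only: nrm, simp_all\<close>)
      then show "AE t in lborel. integrable lborel (\<lambda>y. case (t, y) of (t, y) \<Rightarrow>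
          ?F t y)" by simp
    qed
    then have "(\<integral>y. (\<integral>t. ?F t y \<partial>lborel) \<partial>lborel) =
        (\<integral>t. (\<integral>y. ?F t y \<partial>lborel) \<partial>lborel)"
      by (rule lborel_pair.Fubini_integral)
    moreover have "(\<integral>y. ?F t y \<partial>lborel) = fourier h (of_real t) * exp (\<i> *
        of_real (t * x)) * G (e n * t)" for t
    proof -
      have eq: "?F t y = h y * exp (- \<i> * of_real t * of_real y) * (exp (\<i> * of_real (t * x))
          * G (e n * t))" for y
        by (simp add: algebra_simps flip: exp_add)
      show ?thesis unfolding fourier_def eq integral_mult_left_zero by (simp only: mult.assoc)
    qed
    \<comment> \<open>Rescaling t by \<open>e n\<close> reduces this to the transform of the
      Gaussian, which is again a Gaussian times sqrt(2 pi).\<close>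
    moreover have "(\<integral>t. ?F t y \<partial>lborel) = h y * of_real (sqrt (2 * pi) / e n) * G
        ((y - x) / e n)" for y
    proof -
      have eq: "?F (t / e n) y = h y * (exp (\<i> * of_real ((x - y) / e n * t)) * G t)" for t
        using e0[of n] by simp
      have "(\<integral>t. ?F (t / e n) y \<partial>lborel) = h y * of_real (sqrt (2 * pi) * exp (-
          ((x - y) / e n)\<^sup>2 / 2))"
        unfolding eq unfolding G_def integral_mult_right_zero gaussian_fourier_transform(2)
            by (rule refl)
      also have "(\<integral>t. ?F (t / e n) y \<partial>lborel) = e n *\<^sub>R (\<integral>t. ?F t
          y \<partial>lborel)"
        by (rule integral_real_scale[OF e0])
      finally show ?thesis using e0[of n]
        by (simp add: G_def scaleR_conv_of_real field_simps power2_commute[of x y])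
    qed
    moreover have "(\<integral>y. h y * of_real (sqrt (2 * pi) / e n) * G ((y - x) / e n)
        \<partial>lborel) =
        \<bar>e n\<bar> *\<^sub>R (\<integral>s. h (x + e n * s) * of_real (sqrt (2 * pi) / e n) * G
            (((x + e n * s) - x) / e n) \<partial>lborel)"
      using e0[of n] by (intro lborel_integral_real_affine) auto
    moreover have "\<dots> = of_real (sqrt (2 * pi)) * (\<integral>s. h (x + e n * s) * G s
        \<partial>lborel)"
    proof -
      have eq: "h (x + e n * s) * of_real (sqrt (2 * pi) / e n) * G (((x + e n * s) - x) / e n) =
        of_real (sqrt (2 * pi) / e n) * (h (x + e n * s) * G s)" for s using e0[of n] by simp
      show ?thesis unfolding eq integral_mult_right_zero using e0[of n]
          by (simp add: scaleR_conv_of_real)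
    qed
    ultimately show ?thesis by (simp only:)
  qed
  have lim1: "(\<lambda>n. \<integral>t. fourier h (of_real t) * exp (\<i> * of_real (t * x)) * G (e
      n * t) \<partial>lborel) \<longlonglongrightarrow>
      (\<integral>t. fourier h (of_real t) * exp (\<i> * of_real (t * x)) \<partial>lborel)"
  proof (rule integral_dominated_convergence[where w = "\<lambda>t. norm (fourier h (of_real t))"])
    show "AE t in lborel. (\<lambda>n. fourier h (of_real t) * exp (\<i> * of_real (t * x)) * G (e n
        * t))
      \<longlonglongrightarrow> fourier h (of_real t) * exp (\<i> * of_real (t * x))"
    proof (intro always_eventually allI)
      fix t
      have "(\<lambda>n. fourier h (of_real t) * exp (\<i> * of_real (t * x)) * of_real (exp (- (e n
          * t)\<^sup>2 / 2))) \<longlonglongrightarrow>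
        fourier h (of_real t) * exp (\<i> * of_real (t * x)) * of_real (exp (- (0 * t)\<^sup>2 / 2))"
        by (intro tendsto_intros e_lim) auto
      then show "(\<lambda>n. fourier h (of_real t) * exp (\<i> * of_real (t * x)) * G (e n * t))
      \<longlonglongrightarrow> fourier h (of_real t) * exp (\<i> * of_real (t * x))"
          by (simp add: G_def)
    qed
    show "AE t in lborel. norm (fourier h (of_real t) * exp (\<i> * of_real (t * x)) * G (e n * t))
      \<le> norm (fourier h (of_real t))" for n
      by (intro always_eventually allI) (simp add: norm_mult norm_exp_i_times G_le mult_left_le)
  qed (use H in simp_all)
  have lim2: "(\<lambda>n. of_real (sqrt (2 * pi)) * (\<integral>s. h (x + e n * s) * G s
      \<partial>lborel)) \<longlonglongrightarrow>
      of_real (sqrt (2 * pi)) * (\<integral>s. h x * G s \<partial>lborel)"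
  proof (intro tendsto_mult tendsto_const integral_dominated_convergence[where w = "\<lambda>s. B *
      norm (G s)"])
    show "AE s in lborel. (\<lambda>n. h (x + e n * s) * G s) \<longlonglongrightarrow> h x * G s"
    proof (intro always_eventually allI)
      fix s
      have "(\<lambda>n. x + e n * s) \<longlonglongrightarrow> x + 0 * s"
          by (intro tendsto_intros e_lim)
      then have "(\<lambda>n. h (x + e n * s)) \<longlonglongrightarrow> h (x + 0 * s)"
        using cont by (intro isCont_tendsto_compose[of _ h]) (auto simp: continuous_on_eq_continuous_at)
      then show "(\<lambda>n. h (x + e n * s) * G s) \<longlonglongrightarrow> h x * G s"
          by (intro tendsto_intros) simp
    qed
    show "AE s in lborel. norm (h (x + e n * s) * G s) \<le> B * norm (G s)" for n
      by (intro always_eventually allI) (simp add: norm_mult bound mult_right_mono)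
  qed (use G_int in simp_all)
  \<comment> \<open>The mass sqrt(2 pi) of the Gaussian enters a second time, which makes the
    constant 2 pi.\<close>
  have "(\<integral>s. h x * G s \<partial>lborel) = h x * of_real (sqrt (2 * pi))"
    using gaussian_fourier_transform(2)[of 0] by (simp add: G_def)
  then have "(\<integral>t. fourier h (of_real t) * exp (\<i> * of_real (t * x)) \<partial>lborel) =
      of_real (sqrt (2 * pi)) * (h x * of_real (sqrt (2 * pi)))"
    using LIMSEQ_unique[OF lim1[unfolded swap] lim2] by (simp only:)
  also have "\<dots> = of_real (sqrt (2 * pi) * sqrt (2 * pi)) * h x"
      by (simp only: of_real_mult ac_simps)
  finally show ?thesis by simp
qed

section \<open>The Fourier transform of compactly supported functions\<close>

lemma compact_support_integrable:
  fixes f :: "real \<Rightarrow> 'a::euclidean_space"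
  assumes "continuous_on UNIV f" "\<And>x. \<bar>x\<bar> > a \<Longrightarrow> f x = 0"
  shows "integrable lborel f" "(f has_integral (\<integral>x. f x \<partial>lborel)) {-a..a}"
proof -
  have ind: "(\<lambda>x. indicator {-a..a} x *\<^sub>R f x) = f"
    by (rule ext) (metis assms(2) abs_le_iff atLeastAtMost_iff indicator_simps minus_le_iff not_le
        scaleR_one scaleR_zero_left)
  have s: "set_integrable lborel {-a..a} f"
    by (rule borel_integrable_atLeastAtMost') (rule continuous_on_subset[OF assms(1)], simp)
  then show "integrable lborel f" by (simp add: set_integrable_def ind)
  show "(f has_integral (\<integral>x. f x \<partial>lborel)) {-a..a}"
    using set_borel_integral_eq_integral[OF s] by (simp add: set_lebesgue_integral_def ind
        has_integral_iff)
qed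

lemma compact_support_integrable_exp:
  assumes "continuous_on UNIV f" "\<And>x. \<bar>x\<bar> > a \<Longrightarrow> f x = 0"
  shows "integrable lborel (\<lambda>t. f t * exp (- \<i> * \<zeta> * of_real t))"
    "((\<lambda>t. f t * exp (- \<i> * \<zeta> * of_real t)) has_integral fourier f \<zeta>) {-a..a}"
proof -
  have "continuous_on UNIV (\<lambda>t. f t * exp (- \<i> * \<zeta> * of_real t))"
    by (intro continuous_intros assms(1))
  moreover have "f x * exp (- \<i> * \<zeta> * of_real x) = 0" if "\<bar>x\<bar> > a" for x
      using assms(2)[OF that] by simp
  ultimately show "integrable lborel (\<lambda>t. f t * exp (- \<i> * \<zeta> * of_real t))"
    "((\<lambda>t. f t * exp (- \<i> * \<zeta> * of_real t)) has_integral fourier f \<zeta>) {-a..a}"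
    using compact_support_integrable[of "\<lambda>t. f t * exp (- \<i> * \<zeta> * of_real t)" a]
    unfolding fourier_def by auto
qed

text \<open>The integral runs over a compact interval, where joint continuity of the derivative
  justifies differentiating under the integral sign.\<close>

lemma fourier_holomorphic:
  assumes "continuous_on UNIV f" "\<And>x. \<bar>x\<bar> > a \<Longrightarrow> f x = 0"
  shows "fourier f holomorphic_on UNIV"
proof -
  have eq: "fourier f = (\<lambda>\<zeta>. integral (cbox (-a) a) (\<lambda>t. f t * exp (- \<i> *
      \<zeta> * of_real t)))"
    using compact_support_integrable_exp(2)[OF assms] by (auto simp: has_integral_iff)
  show ?thesis
    unfolding eq
  proof (rule leibniz_rule_holomorphic)
    show "((\<lambda>\<zeta>. f t * exp (- \<i> * \<zeta> * of_real t)) has_field_derivative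
      f t * (exp (- \<i> * \<zeta> * of_real t) * (- \<i> * of_real t))) (at \<zeta> within UNIV)"
          for \<zeta> t
      by (auto intro!: derivative_eq_intros)
    show "(\<lambda>t. f t * exp (- \<i> * \<zeta> * of_real t)) integrable_on cbox (-a) a" for \<zeta>
      using compact_support_integrable_exp(2)[OF assms] by (auto simp: has_integral_iff)
    have "continuous_on (UNIV \<times> cbox (-a) a) (\<lambda>p. f (snd p) * (exp (- \<i> * fst p *
        of_real (snd p)) * (- \<i> * of_real (snd p))))"
      by (intro continuous_intros continuous_on_compose2[OF assms(1)]) auto
    then show "continuous_on (UNIV \<times> cbox (-a) a) (\<lambda>(\<zeta>, t). f t * (exp (- \<i>
        * \<zeta> * of_real t) * (- \<i> * of_real t)))"
      by (simp add: case_prod_beta)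
  qed simp
qed

text \<open>The kernel has modulus exp(t Im \<zeta>), at most exp(a |Im \<zeta>|) on the support:
  the size of the support becomes the exponential type.\<close>

lemma fourier_bound:
  assumes "continuous_on UNIV f" "\<And>x. \<bar>x\<bar> > a \<Longrightarrow> f x = 0"
  shows "norm (fourier f \<zeta>) \<le> (\<integral>t. norm (f t) \<partial>lborel) * exp (a *
      \<bar>Im \<zeta>\<bar>)"
proof -
  have f: "integrable lborel f" by (rule compact_support_integrable(1)[OF assms])
  have "norm (fourier f \<zeta>) \<le> (\<integral>t. norm (f t) * exp (a * \<bar>Im \<zeta>\<bar>)
      \<partial>lborel)"
    unfolding fourier_def
  proof (rule order_trans[OF integral_norm_bound integral_mono])
    show "integrable lborel (\<lambda>t. norm (f t * exp (- \<i> * \<zeta> * of_real t)))"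
      by (rule integrable_norm[OF compact_support_integrable_exp(1)[OF assms]])
    show "integrable lborel (\<lambda>t. norm (f t) * exp (a * \<bar>Im \<zeta>\<bar>))" using f by simp
    fix t
    show "norm (f t * exp (- \<i> * \<zeta> * of_real t)) \<le> norm (f t) * exp (a * \<bar>Im
        \<zeta>\<bar>)"
    proof (cases "\<bar>t\<bar> > a")
      case False
      have "t * Im \<zeta> \<le> \<bar>t\<bar> * \<bar>Im \<zeta>\<bar>" by (metis abs_ge_self abs_mult)
      also have "\<dots> \<le> a * \<bar>Im \<zeta>\<bar>" using False by (intro mult_right_mono) auto
      finally show ?thesis by (simp add: norm_mult mult_left_mono mult.commute)
    qed (simp add: assms(2))
  qed
  then show ?thesis by simp
qed

lemma fourier_derivative:
  assumes f': "\<And>x. (f has_vector_derivative f' x) (at x)" and "continuous_on UNIV f'"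
    and "\<And>x. \<bar>x\<bar> > a \<Longrightarrow> f x = 0" "\<And>x. \<bar>x\<bar> > a
        \<Longrightarrow> f' x = 0"
  shows "fourier f' \<zeta> = \<i> * \<zeta> * fourier f \<zeta>"
proof -
  \<comment> \<open>An interval strictly larger than [-a,a]: \<open>f\<close> is known to vanish
    only where |x| > a, and integration by parts needs vanishing boundary values.\<close>
  define c where "c = max a 0 + 1"
  have c: "c > 0" "c > a" "- c \<le> c" by (auto simp: c_def)
  have cf: "continuous_on UNIV f"
    using f' by (auto simp: continuous_on_eq_continuous_at intro: has_vector_derivative_continuous)
  have z: "\<And>x. \<bar>x\<bar> > c \<Longrightarrow> f x = 0" "\<And>x. \<bar>x\<bar> > c
      \<Longrightarrow> f' x = 0" using assms(3,4) c by auto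
  let ?E = "\<lambda>t. exp (- \<i> * \<zeta> * of_real t)"
  have E: "(?E has_vector_derivative (- \<i> * \<zeta> * ?E t)) (at t within S)" for t S
    by (rule has_vector_derivative_at_within)
      (auto intro!: derivative_eq_intros has_vector_derivative_real_field simp: mult.commute mult.assoc)
  have "((\<lambda>t. f t * (- \<i> * \<zeta> * ?E t) + f' t * ?E t) has_integral f c * ?E c - f (-
      c) * ?E (- c)) {-c..c}"
    by (rule fundamental_theorem_of_calculus[OF c(3)])
      (intro has_vector_derivative_mult E has_vector_derivative_at_within[OF f'])
  moreover have "f c = 0" "f (- c) = 0" using assms(3) c by auto
  ultimately have i: "((\<lambda>t. f t * (- \<i> * \<zeta> * ?E t) + f' t * ?E t) has_integral 0)
      {-c..c}" by simp
  have "((\<lambda>t. - \<i> * \<zeta> * (f t * ?E t) + f' t * ?E t) has_integral - \<i> * \<zeta> *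
      fourier f \<zeta> + fourier f' \<zeta>) {-c..c}"
    by (intro has_integral_add has_integral_mult_right compact_support_integrable_exp(2) cf assms(2) z)
  then have "- \<i> * \<zeta> * fourier f \<zeta> + fourier f' \<zeta> = 0"
    by (rule has_integral_unique) (use i in \<open>simp add: mult.left_commute mult.assoc\<close>)
  then show ?thesis by (simp add: mult.assoc)
qed

text \<open>Inversion applied to a transform that vanishes on the real line. The bound required
  there comes from compactness of [-a,a].\<close>

lemma fourier_eq_0_imp_eq_0:
  assumes f: "continuous_on UNIV f" "\<And>x. \<bar>x\<bar> > a \<Longrightarrow> f x = 0"
    and z: "\<And>t::real. fourier f (of_real t) = 0"
  shows "f x = 0"
proof -
  have "compact (f ` {-a..a})" by (intro compact_continuous_image continuous_on_subset[OF f(1)]) auto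
  then obtain B where B: "\<And>x. x \<in> {-a..a} \<Longrightarrow> norm (f x) \<le> B"
    by (metis bounded_iff compact_imp_bounded imageI)
  have "norm (f x) \<le> max B 0" for x
  proof (cases "\<bar>x\<bar> > a")
    case False
    then have "x \<in> {-a..a}" by auto
    then show ?thesis using B[of x] by simp
  qed (simp add: f(2))
  then have "(\<integral>t. fourier f (of_real t) * exp (\<i> * of_real (t * x)) \<partial>lborel) =
      2 * of_real pi * f x"
    by (intro fourier_inversion compact_support_integrable(1)[OF f] f(1)) (simp_all add: z)
  then show ?thesis by (simp add: z)
qed

section \<open>Inverse transforms of entire functions of exponential type\<close>

text \<open>Prepares differentiation under an integral over the whole line: the Taylor estimate for
  the exponential gives a remainder of exactly this quadratic form.\<close>

lemma has_vector_derivative_quadratic: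
  fixes f :: "real \<Rightarrow> 'a::real_normed_vector"
  assumes "\<And>y. norm (f y - f x - (y - x) *\<^sub>R d) \<le> K * (y - x)\<^sup>2"
  shows "(f has_vector_derivative d) (at x)"
  unfolding has_vector_derivative_def has_derivative_iff_norm
proof
  have "((\<lambda>y. norm (f y - f x - (y - x) *\<^sub>R d) / norm (y - x)) \<longlongrightarrow>
      0) (at x)"
  proof (rule Lim_null_comparison)
    show "\<forall>\<^sub>F y in at x. norm (norm (f y - f x - (y - x) *\<^sub>R d) / norm (y - x))
        \<le> K * \<bar>y - x\<bar>"
    proof (intro always_eventually allI)
      fix y
      show "norm (norm (f y - f x - (y - x) *\<^sub>R d) / norm (y - x)) \<le> K * \<bar>y - x\<bar>"
        using assms[of y] by (cases "y = x") (simp_all add: divide_le_eq power2_eq_square mult.assoc)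
    qed
    show "((\<lambda>y. K * \<bar>y - x\<bar>) \<longlongrightarrow> 0) (at x)"
      by (rule tendsto_eq_intros tendsto_rabs_zero LIM_zero refl | simp)+
  qed
  then show "((\<lambda>y. norm (f y - f x - (y - x) *\<^sub>R d) / norm (y - x))
      \<longlongrightarrow> 0) (at x)" .
qed (rule bounded_linear_scaleR_left)

text \<open>Since |e^{is} - 1 - is| \<le> s^2/2 for real s, taking s = t(y - x) bounds the remainder
  by (y - x)^2/2 times the integral of t^2 |g(t)|. This is why the second moment of \<open>g\<close>
  is assumed integrable.\<close>

lemma inverse_fourier_derivative:
  fixes g :: "real \<Rightarrow> complex"
  assumes g: "integrable lborel g" "integrable lborel (\<lambda>t. of_real t * g t)"
    "integrable lborel (\<lambda>t. of_real t * (of_real t * g t))"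
  shows "((\<lambda>x. \<integral>t. g t * exp (\<i> * of_real (t * x)) \<partial>lborel)
      has_vector_derivative
    (\<integral>t. \<i> * of_real t * g t * exp (\<i> * of_real (t * x)) \<partial>lborel)) (at x)"
proof (rule has_vector_derivative_quadratic)
  have int: "integrable lborel (\<lambda>t. h t * exp (\<i> * of_real (t * x)))"
      if "integrable lborel h" for h :: "real \<Rightarrow> complex" and x
    by (rule Bochner_Integration.integrable_bound[OF integrable_norm[OF that]])
      (use that in \<open>auto simp: norm_mult norm_exp_i_times borel_measurable_integrable\<close>)
  have int': "integrable lborel (\<lambda>t. \<i> * of_real t * g t * exp (\<i> * of_real (t * x)))"
      for x
    using int[OF integrable_mult_right[OF g(2), of \<i>], of x] by (simp add: mult.assoc)
  fix y
  let ?q = "\<lambda>t. g t * exp (\<i> * of_real (t * y)) - g t * exp (\<i> * of_real (t * x)) -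
      (y - x) *\<^sub>R (\<i> * of_real t * g t * exp (\<i> * of_real (t * x)))"
  have "norm (?q t) \<le> norm (of_real t * (of_real t * g t)) / 2 * (y - x)\<^sup>2" for t
  proof -
    have q: "?q t = g t * exp (\<i> * of_real (t * x)) *
        (exp (\<i> * of_real (t * (y - x))) - (\<Sum>k\<le>1. (\<i> * of_real (t * (y - x))) ^ k /
            fact k))"
      by (simp add: algebra_simps scaleR_conv_of_real flip: exp_add)
    have "norm (exp (\<i> * of_real (t * (y - x))) - (\<Sum>k\<le>1. (\<i> * of_real (t * (y - x)))
        ^ k / fact k))
        \<le> \<bar>t * (y - x)\<bar> ^ Suc 1 / fact (Suc 1)"
      by (rule iexp_approx1)
    then have "norm (?q t) \<le> norm (g t) * (\<bar>t * (y - x)\<bar> ^ Suc 1 / fact (Suc 1))"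
      unfolding q norm_mult norm_exp_i_times mult_1_right by (rule mult_left_mono) simp
    moreover have "norm (g t) * (\<bar>t * (y - x)\<bar> ^ Suc 1 / fact (Suc 1)) =
        norm (of_real t * (of_real t * g t)) / 2 * (y - x)\<^sup>2"
    proof -
      have "\<bar>t * (y - x)\<bar> ^ Suc 1 / fact (Suc 1) = (t * (y - x))\<^sup>2 / 2"
        by (simp add: power2_eq_square)
      moreover have "norm (of_real t * (of_real t * g t)) = t\<^sup>2 * norm (g t)"
        by (simp add: norm_mult power2_eq_square flip: mult.assoc)
      ultimately show ?thesis by (simp only: power_mult_distrib) simp
    qed
    ultimately show ?thesis by (simp only:)
  qed
  then have "norm (\<integral>t. ?q t \<partial>lborel) \<le> (\<integral>t. norm (of_real t *
      (of_real t * g t)) / 2 * (y - x)\<^sup>2 \<partial>lborel)"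
    by (intro order_trans[OF integral_norm_bound integral_mono] integrable_norm
        Bochner_Integration.integrable_diff integrable_scaleR_right int int' g
        integrable_mult_left integrable_divide)
  also have "\<dots> = (\<integral>t. norm (of_real t * (of_real t * g t)) \<partial>lborel) / 2 *
      (y - x)\<^sup>2"
    by simp
  also have "(\<integral>t. ?q t \<partial>lborel) = (\<integral>t. g t * exp (\<i> * of_real (t *
      y)) \<partial>lborel) -
      (\<integral>t. g t * exp (\<i> * of_real (t * x)) \<partial>lborel) -
      (y - x) *\<^sub>R (\<integral>t. \<i> * of_real t * g t * exp (\<i> * of_real (t * x))
          \<partial>lborel)"
    by (subst Bochner_Integration.integral_diff Bochner_Integration.integral_scaleR_right;
        (intro Bochner_Integration.integrable_diff integrable_scaleR_right int int' g)?)+ simp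
  finally show "norm ((\<integral>t. g t * exp (\<i> * of_real (t * y)) \<partial>lborel) -
      (\<integral>t. g t * exp (\<i> * of_real (t * x)) \<partial>lborel) -
      (y - x) *\<^sub>R (\<integral>t. \<i> * of_real t * g t * exp (\<i> * of_real (t * x))
          \<partial>lborel))
    \<le> (\<integral>t. norm (of_real t * (of_real t * g t)) \<partial>lborel) / 2 * (y - x)\<^sup>2" .
qed

text \<open>Cauchy's theorem for a long rectangle, phrased through a primitive \<open>P\<close>: its
  four sides are differences of \<open>P\<close> at the corners, and the vertical ones vanish in the
  limit. The two conditions on \<open>s\<close> say that it lies between 0 and
  \<open>\<eta>\<close>.\<close>

lemma integral_horizontal_shift:
  fixes G :: "complex \<Rightarrow> complex"
  assumes hol: "G holomorphic_on UNIV"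
    and bound: "\<And>t s. \<bar>s\<bar> \<le> \<bar>\<eta>\<bar> \<Longrightarrow> s * \<eta> \<ge>
        0 \<Longrightarrow> norm (G (Complex t s)) \<le> M / (1 + t\<^sup>2)"
  shows "(\<integral>t. G (Complex t 0) \<partial>lborel) = (\<integral>t. G (Complex t \<eta>)
      \<partial>lborel)"
proof -
  obtain P where P: "\<And>z. (P has_field_derivative G z) (at z)"
    using holomorphic_convex_primitive[of UNIV "{}" G] hol
    by (auto simp: holomorphic_on_imp_continuous_on holomorphic_on_def)
  have contG: "continuous_on UNIV G" by (rule holomorphic_on_imp_continuous_on[OF hol])
  have Cc: "continuous_on S (\<lambda>t. Complex t s)" for S s unfolding Complex_eq
      by (intro continuous_intros)
  have lim: "(\<lambda>n. P (Complex (real n) s) - P (Complex (- real n) s))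
      \<longlonglongrightarrow> (\<integral>t. G (Complex t s) \<partial>lborel)"
    if s: "\<bar>s\<bar> \<le> \<bar>\<eta>\<bar>" "s * \<eta> \<ge> 0" for s
  proof -
    have "(\<integral>t. indicator {- real n..real n} t *\<^sub>R G (Complex t s) \<partial>lborel) =
        P (Complex (real n) s) - P (Complex (- real n) s)" for n
    proof (rule integral_FTC_Icc)
      fix x
      have "((\<lambda>t. Complex t s) has_vector_derivative 1) (at x within {- real n..real n})"
        unfolding Complex_eq by (auto intro!: derivative_eq_intros)
      then show "((\<lambda>t. P (Complex t s)) has_vector_derivative G (Complex x s)) (at x within
          {- real n..real n})"
        using field_vector_diff_chain_within[OF _ has_field_derivative_at_within[OF P]]
        by (fastforce simp: o_def)
    qed (auto intro!: continuous_on_compose2[OF contG Cc])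
    moreover have "(\<lambda>n. \<integral>t. indicator {- real n..real n} t *\<^sub>R G (Complex t
        s) \<partial>lborel)
        \<longlonglongrightarrow> (\<integral>t. G (Complex t s) \<partial>lborel)"
    proof (rule integral_dominated_convergence[where w = "\<lambda>t. M * (1 / (1 + t\<^sup>2))"])
      have meas: "(\<lambda>t. G (Complex t s)) \<in> borel_measurable borel"
        by (intro borel_measurable_continuous_onI continuous_on_compose2[OF contG Cc]) simp
      then show "(\<lambda>t. G (Complex t s)) \<in> borel_measurable lborel"
        "(\<lambda>t. indicator {- real n..real n} t *\<^sub>R G (Complex t s)) \<in>
            borel_measurable lborel" for n
        by measurable
      show "integrable lborel (\<lambda>t. M * (1 / (1 + t\<^sup>2)))"
        by (intro integrable_mult_right integrable_inverse_one_plus_square)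
      show "AE t in lborel. (\<lambda>n. indicator {- real n..real n} t *\<^sub>R G (Complex t s))
          \<longlonglongrightarrow> G (Complex t s)"
      proof (rule always_eventually, rule allI, rule tendsto_eventually)
        fix t
        obtain N where "\<bar>t\<bar> \<le> real N" using real_arch_simple by blast
        then show "\<forall>\<^sub>F n in sequentially. indicator {- real n..real n} t *\<^sub>R G
            (Complex t s) = G (Complex t s)"
          by (intro eventually_sequentiallyI[of N]) (auto simp: indicator_def)
      qed
      have "norm (indicator {- real n..real n} t *\<^sub>R G (Complex t s)) \<le> norm (G (Complex t
          s))" for n t
        by (simp add: indicator_def)
      then show "AE t in lborel. norm (indicator {- real n..real n} t *\<^sub>R G (Complex t s))
          \<le> M * (1 / (1 + t\<^sup>2))" for n
        using bound[OF s] by (auto intro!: always_eventually intro: order_trans)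
    qed
    ultimately show ?thesis by simp
  qed
  \<comment> \<open>Both vertical sides at once, with \<open>r n\<close> equal to n or -n. The mean
    value bound gives length |\<eta>| times the bound for \<open>G\<close> on the side.\<close>
  have side: "(\<lambda>n. P (Complex (r n) \<eta>) - P (Complex (r n) 0)) \<longlonglongrightarrow> 0"
    if r: "\<And>n. (r n)\<^sup>2 = (real n)\<^sup>2" for r
  proof (rule Lim_null_comparison)
    show "\<forall>\<^sub>F n in sequentially. norm (P (Complex (r n) \<eta>) - P (Complex (r n) 0))
        \<le> M / (1 + (real n)\<^sup>2) * \<bar>\<eta>\<bar>"
    proof (intro always_eventually allI)
      fix n
      have "norm (P (Complex (r n) \<eta>) - P (Complex (r n) 0)) \<le>
          M / (1 + (real n)\<^sup>2) * norm (Complex (r n) \<eta> - Complex (r n) 0)"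
      proof (rule field_differentiable_bound[OF convex_closed_segment])
        fix z assume "z \<in> closed_segment (Complex (r n) 0) (Complex (r n) \<eta>)"
        then obtain u where u: "0 \<le> u" "u \<le> 1" "z = Complex (r n) (u * \<eta>)"
          by (auto simp: closed_segment_def complex_eq_iff algebra_simps)
        then have "\<bar>u * \<eta>\<bar> \<le> \<bar>\<eta>\<bar>" "u * \<eta> * \<eta> \<ge> 0"
          by (auto simp: abs_mult mult_left_le_one_le mult.assoc)
        from bound[OF this, of "r n"] show "norm (G z) \<le> M / (1 + (real n)\<^sup>2)"
            using u r by simp
        show "(P has_field_derivative G z) (at z within closed_segment (Complex (r n) 0) (Complex (r
            n) \<eta>))"
          by (rule has_field_derivative_at_within[OF P])
      qed auto
      then show "norm (P (Complex (r n) \<eta>) - P (Complex (r n) 0)) \<le> M / (1 + (real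
          n)\<^sup>2) * \<bar>\<eta>\<bar>"
        by (simp add: norm_complex_def)
    qed
    have "(\<lambda>n. 1 / (1 + (real n)\<^sup>2)) \<longlonglongrightarrow> 0" by real_asymp
    from tendsto_mult_left[OF this, of "M * \<bar>\<eta>\<bar>"]
    show "(\<lambda>n. M / (1 + (real n)\<^sup>2) * \<bar>\<eta>\<bar>) \<longlonglongrightarrow> 0"
        by (simp add: mult.commute)
  qed
  \<comment> \<open>The same four corner values are grouped once by vertical and once by horizontal
    sides.\<close>
  have "(\<lambda>n. (P (Complex (real n) \<eta>) - P (Complex (real n) 0)) -
      (P (Complex (- real n) \<eta>) - P (Complex (- real n) 0))) \<longlonglongrightarrow> 0 - 0"
    by (intro tendsto_diff side) auto
  moreover have "(\<lambda>n. (P (Complex (real n) \<eta>) - P (Complex (- real n) \<eta>)) -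
      (P (Complex (real n) 0) - P (Complex (- real n) 0))) \<longlonglongrightarrow>
      (\<integral>t. G (Complex t \<eta>) \<partial>lborel) - (\<integral>t. G (Complex t 0)
          \<partial>lborel)"
    by (intro tendsto_diff lim) auto
  ultimately have "(\<integral>t. G (Complex t \<eta>) \<partial>lborel) - (\<integral>t. G (Complex
      t 0) \<partial>lborel) = 0"
    by (intro LIMSEQ_unique[of "\<lambda>n. (P (Complex (real n) \<eta>) - P (Complex (- real n)
        \<eta>)) -
      (P (Complex (real n) 0) - P (Complex (- real n) 0))"]) (simp_all add: algebra_simps)
  then show ?thesis by simp
qed

lemma integrable_inverse_square_bound:
  fixes h :: "real \<Rightarrow> 'a::euclidean_space"
  assumes "continuous_on UNIV h" "\<And>t. norm (h t) \<le> C / (1 + t\<^sup>2)"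
  shows "integrable lborel h"
proof (rule Bochner_Integration.integrable_bound)
  show "integrable lborel (\<lambda>t. C * (1 / (1 + t\<^sup>2)))"
    by (intro integrable_mult_right integrable_inverse_one_plus_square)
  have "norm (h t) \<le> norm (C * (1 / (1 + t\<^sup>2)))" for t
    using assms(2)[of t] abs_ge_self[of "C * (1 / (1 + t\<^sup>2))"] by simp
  then show "AE t in lborel. norm (h t) \<le> norm (C * (1 / (1 + t\<^sup>2)))" by simp
qed (simp add: assms(1) borel_measurable_continuous_onI)

text \<open>The scalar form of the growth condition. It includes \<zeta> = 0, about which the
  condition in \<open>paley_wiener\<close> is silent.\<close>

definition rapid_exponential :: "real \<Rightarrow> (complex \<Rightarrow> complex) \<Rightarrow>
    bool" where
  "rapid_exponential a g \<longleftrightarrow> (\<forall>N::nat. \<exists>C. \<forall>\<zeta>. norm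
      (g \<zeta>) \<le> C * exp (a * \<bar>Im \<zeta>\<bar>) / (1 + norm \<zeta>) ^ N)"

text \<open>Decay of order k + 2 is used: k powers absorb |t|^k, and the remaining two leave the
  integrable weight 1/(1 + t^2).\<close>

lemma rapid_exponentialD:
  assumes "rapid_exponential a g"
  shows "\<exists>C\<ge>0. \<forall>t s. norm (g (Complex t s)) * \<bar>t\<bar> ^ k \<le> C * exp (a
      * \<bar>s\<bar>) / (1 + t\<^sup>2)"
proof -
  obtain C where C: "\<And>\<zeta>. norm (g \<zeta>) \<le> C * exp (a * \<bar>Im \<zeta>\<bar>) / (1
      + norm \<zeta>) ^ (k + 2)"
    using assms unfolding rapid_exponential_def by blast
  have "0 \<le> norm (g 0)" by simp
  also have "\<dots> \<le> C" using C[of 0] by simp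
  finally have C0: "C \<ge> 0" .
  have "norm (g (Complex t s)) * \<bar>t\<bar> ^ k \<le> C * exp (a * \<bar>s\<bar>) / (1 +
      t\<^sup>2)" for t s
  proof -
    let ?r = "1 + norm (Complex t s)"
    have t: "\<bar>t\<bar> \<le> norm (Complex t s)" using abs_Re_le_cmod[of "Complex t s"] by simp
    have r: "?r > 0" by (smt (verit) norm_ge_zero)
    have sq: "1 + t\<^sup>2 \<le> ?r\<^sup>2"
    proof -
      have "1 + t\<^sup>2 \<le> (1 + \<bar>t\<bar>)\<^sup>2"
          by (simp add: power2_eq_square algebra_simps)
      also have "\<dots> \<le> ?r\<^sup>2" using t by (intro power_mono) auto
      finally show ?thesis .
    qed
    have tk: "\<bar>t\<bar> ^ k \<le> ?r ^ k" using t by (intro power_mono) auto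
    have "norm (g (Complex t s)) * \<bar>t\<bar> ^ k \<le> C * exp (a * \<bar>s\<bar>) / ?r ^ (k +
        2) * ?r ^ k"
      using C[of "Complex t s"] tk by (intro mult_mono) (auto simp: C0)
    also have "\<dots> = C * exp (a * \<bar>s\<bar>) / ?r\<^sup>2" using r
        by (simp add: power_add power2_eq_square)
    also have "\<dots> \<le> C * exp (a * \<bar>s\<bar>) / (1 + t\<^sup>2)"
      using sq C0 zero_less_power[OF r, of 2] by (intro divide_left_mono mult_pos_pos) (auto simp:
          add_pos_nonneg simp del: zero_less_power2)
    finally show ?thesis .
  qed
  with C0 show ?thesis by blast
qed

text \<open>The line of integration moves to height r on the side given by the sign of
  \<open>x\<close>. There the integral is at most a constant times exp(r(a - |x|)), which tends to 0
  as r grows.\<close>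

lemma paley_wiener_support:
  assumes hol: "g holomorphic_on UNIV" and g: "rapid_exponential a g" and x: "\<bar>x\<bar> > a"
  shows "(\<integral>t. g (of_real t) * exp (\<i> * of_real (t * x)) \<partial>lborel) = 0"
proof -
  obtain C where C: "C \<ge> 0" "\<And>t s. norm (g (Complex t s)) * \<bar>t\<bar> ^ 0 \<le> C * exp
      (a * \<bar>s\<bar>) / (1 + t\<^sup>2)"
    using rapid_exponentialD[OF g, of 0] by blast
  let ?G = "\<lambda>w. g w * exp (\<i> * w * of_real x)"
  define e where "e = (if x \<ge> 0 then 1 else -1 :: real)"
  have e: "\<bar>e\<bar> = 1" "e * x = \<bar>x\<bar>" by (auto simp: e_def)
  have bnd: "norm (?G (Complex t (e * r))) \<le> C * exp (r * (a - \<bar>x\<bar>)) / (1 +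
      t\<^sup>2)" if "r \<ge> 0" for t r
  proof -
    have "norm (?G (Complex t (e * r))) = norm (g (Complex t (e * r))) * exp (- (r * \<bar>x\<bar>))"
      by (simp add: norm_mult flip: e(2))
    also have "\<dots> \<le> C * exp (a * \<bar>e * r\<bar>) / (1 + t\<^sup>2) * exp (- (r *
        \<bar>x\<bar>))"
      using C(2)[of t "e * r"] by (intro mult_right_mono) auto
    also have "\<dots> = C * exp (r * (a - \<bar>x\<bar>)) / (1 + t\<^sup>2)"
      using that e by (simp add: abs_mult algebra_simps exp_diff exp_minus divide_inverse)
    finally show ?thesis .
  qed
  let ?I = "\<integral>t. ?G (Complex t 0) \<partial>lborel" and ?K = "\<integral>t. 1 / (1 +
      (t::real)\<^sup>2) \<partial>lborel"
  have K: "integrable lborel (\<lambda>t::real. c * (1 / (1 + t\<^sup>2)))" for c :: real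
    by (intro integrable_mult_right integrable_inverse_one_plus_square)
  have "norm ?I \<le> C * exp (r * (a - \<bar>x\<bar>)) * ?K" if r: "r \<ge> 0" for r
  proof -
    have "?I = (\<integral>t. ?G (Complex t (e * r)) \<partial>lborel)"
    proof (rule integral_horizontal_shift)
      show "?G holomorphic_on UNIV" by (intro holomorphic_intros hol)
      fix t s assume s: "\<bar>s\<bar> \<le> \<bar>e * r\<bar>" "s * (e * r) \<ge> 0"
      have es: "s = e * (e * s)" by (simp add: e_def)
      have "e * s \<ge> 0" using s r by (cases "r = 0") (auto simp: e_def zero_le_mult_iff split:
          if_splits)
      from bnd[OF this, of t] have "norm (?G (Complex t s)) \<le> C * exp (e * s * (a -
          \<bar>x\<bar>)) / (1 + t\<^sup>2)"
        using es by simp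
      also have "\<dots> \<le> C * 1 / (1 + t\<^sup>2)"
        using \<open>e * s \<ge> 0\<close> x C(1)
        by (intro divide_right_mono mult_left_mono) (auto simp: mult_nonneg_nonpos)
      finally show "norm (?G (Complex t s)) \<le> C / (1 + t\<^sup>2)" by simp
    qed
    also have "norm \<dots> \<le> (\<integral>t. C * exp (r * (a - \<bar>x\<bar>)) * (1 / (1 +
        t\<^sup>2)) \<partial>lborel)"
    proof (rule order_trans[OF integral_norm_bound integral_mono])
      have "continuous_on UNIV (\<lambda>t. ?G (Complex t (e * r)))"
        unfolding Complex_eq
        by (intro continuous_intros continuous_on_compose2[OF holomorphic_on_imp_continuous_on[OF
            hol]]) auto
      then show "integrable lborel (\<lambda>t. norm (?G (Complex t (e * r))))"
        using bnd[OF r] by (intro integrable_norm integrable_inverse_square_bound)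
    qed (use K bnd[OF r] in auto)
    also have "\<dots> = C * exp (r * (a - \<bar>x\<bar>)) * ?K" by (rule integral_mult_right_zero)
    finally show ?thesis .
  qed
  moreover have "((\<lambda>r. C * exp (r * (a - \<bar>x\<bar>)) * ?K) \<longlongrightarrow> 0) at_top"
  proof -
    have "((\<lambda>r. exp (r * (a - \<bar>x\<bar>))) \<longlongrightarrow> 0) at_top"
      using x by (intro filterlim_compose[OF exp_at_bot] filterlim_tendsto_neg_mult_at_bot[OF
          tendsto_const, of "a - \<bar>x\<bar>", simplified mult.commute] filterlim_ident) auto
    from tendsto_mult_left_zero[OF tendsto_mult_right_zero[OF this]] show ?thesis .
  qed
  ultimately have "norm ?I \<le> 0"
    by (intro tendsto_lowerbound[of _ 0 at_top]) (auto simp: eventually_at_top_linorder intro!: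
        exI[of _ 0])
  moreover have "?G (Complex t 0) = g (of_real t) * exp (\<i> * of_real (t * x))" for t
    by (simp add: complex_of_real_def[symmetric] mult.assoc)
  ultimately show ?thesis by simp
qed

text \<open>\<open>f k\<close> is the inverse transform of (it)^k g(t). The whole sequence of
  derivatives is returned because \<open>f k\<close> later becomes the value of F on z^k
  \<open>\<gamma>\<^sub>I\<close>.\<close>

theorem paley_wiener_surjective:
  assumes hol: "g holomorphic_on UNIV" and g: "rapid_exponential a g"
  obtains f :: "nat \<Rightarrow> real \<Rightarrow> complex" where
    "\<And>k x. (f k has_vector_derivative f (Suc k) x) (at x)"
    "\<And>k x. \<bar>x\<bar> > a \<Longrightarrow> f k x = 0" "\<And>\<zeta>. fourier (f 0) \<zeta>
        = g \<zeta>"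
proof -
  define h where "h k t = (\<i> * of_real t) ^ k * g (of_real t)" for k t
  define f where "f k x = (1 / (2 * pi)) *\<^sub>R (\<integral>t. h k t * exp (\<i> * of_real (t *
      x)) \<partial>lborel)" for k x
  have ch: "continuous_on UNIV (h k)" for k
    unfolding h_def by (intro continuous_intros continuous_on_compose2[OF
        holomorphic_on_imp_continuous_on[OF hol]]) auto
  have bound: "\<exists>C\<ge>0. \<forall>t. norm (h k t) \<le> C / (1 + t\<^sup>2)" for k
  proof -
    obtain C where C: "C \<ge> 0" "\<And>t s. norm (g (Complex t s)) * \<bar>t\<bar> ^ k \<le> C *
        exp (a * \<bar>s\<bar>) / (1 + t\<^sup>2)"
      using rapid_exponentialD[OF g, of k] by blast
    have "norm (h k t) \<le> C / (1 + t\<^sup>2)" for t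
      using C(2)[of t 0] by (simp add: h_def norm_mult norm_power mult.commute flip: complex_of_real_def)
    then show ?thesis using C(1) by blast
  qed
  have int: "integrable lborel (h k)" for k
    using bound[of k] ch[of k] by (blast intro: integrable_inverse_square_bound)
  have hS: "h (Suc k) t = \<i> * of_real t * h k t" for k t by (simp add: h_def)
  have deriv: "(f k has_vector_derivative f (Suc k) x) (at x)" for k x
  proof -
    have 1: "(\<lambda>t. of_real t * h k t) = (\<lambda>t. - \<i> * h (Suc k) t)"
      "(\<lambda>t. of_real t * (of_real t * h k t)) = (\<lambda>t. - h (Suc (Suc k)) t)"
      by (simp_all add: hS algebra_simps)
    have "integrable lborel (\<lambda>t. of_real t * h k t)" "integrable lborel (\<lambda>t. of_real
        t * (of_real t * h k t))"
      unfolding 1 by (intro integrable_mult_right integrable_minus int)+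
    from inverse_fourier_derivative[OF int this, of x]
    show ?thesis unfolding f_def hS[symmetric] by (rule bounded_linear.has_vector_derivative[OF
        bounded_linear_scaleR_right])
  qed
  have zero0: "f 0 x = 0" if "\<bar>x\<bar> > a" for x
    using paley_wiener_support[OF hol g that] by (simp add: f_def h_def)
  have zero: "f k x = 0" if "\<bar>x\<bar> > a" for k x
    using that
  proof (induction k arbitrary: x)
    case (Suc k)
    have "open {x. \<bar>x\<bar> > a}" by (intro open_Collect_less continuous_intros)
    then have "((\<lambda>_. 0) has_vector_derivative f (Suc k) x) (at x)"
      by (rule has_vector_derivative_transform_within_open[OF deriv]) (use Suc in auto)
    then show ?case using vector_derivative_unique_at has_vector_derivative_const by blast
  qed (rule zero0)
  have cf: "continuous_on UNIV (f 0)"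
    using deriv by (auto simp: continuous_on_eq_continuous_at intro: has_vector_derivative_continuous)
  have real: "fourier (f 0) (of_real s) = g (of_real s)" for s :: real
  proof -
    \<comment> \<open>Inversion is applied to \<open>g\<close> on the real line, not to
      \<open>f 0\<close>: the transform of \<open>g\<close> is a reflected multiple of
      \<open>f 0\<close>, integrable because its support is compact. The identity obtained for real
      arguments then extends analytically.\<close>
    have F: "fourier (h 0) (of_real t) = 2 * of_real pi * f 0 (- t)" for t :: real
      by (simp add: fourier_def f_def scaleR_conv_of_real mult.commute mult.left_commute)
    have fi: "integrable lborel (f 0)" by (rule compact_support_integrable(1)[OF cf zero0])
    obtain C where "C \<ge> 0" "\<And>t. norm (h 0 t) \<le> C / (1 + t\<^sup>2)"
        using bound[of 0] by auto
    then have "norm (h 0 t) \<le> C" for t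
      by (rule_tac order_trans[of _ "C / (1 + t\<^sup>2)"]) (auto simp: divide_le_eq
          mult_le_cancel_left1 add_pos_nonneg)
    then have "(\<integral>t. fourier (h 0) (of_real t) * exp (\<i> * of_real (t * s))
        \<partial>lborel) = 2 * of_real pi * h 0 s"
      using lborel_integrable_real_affine[OF fi, of "-1" 0]
      by (intro fourier_inversion int ch) (auto simp: F)
    moreover have "(\<integral>t. f 0 t * exp (- \<i> * of_real s * of_real t) \<partial>lborel) =
        (\<integral>t. f 0 (- t) * exp (\<i> * of_real (t * s)) \<partial>lborel)"
      by (subst lborel_integral_real_affine[of "-1" _ 0]) (simp_all add: mult.commute mult.left_commute)
    moreover have "(\<integral>t. fourier (h 0) (of_real t) * exp (\<i> * of_real (t * s))
        \<partial>lborel) =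
        2 * of_real pi * (\<integral>t. f 0 (- t) * exp (\<i> * of_real (t * s)) \<partial>lborel)"
      by (simp only: F mult.assoc integral_mult_right_zero)
    ultimately have "2 * of_real pi * fourier (f 0) (of_real s) = 2 * of_real pi * h 0 s"
      by (simp only: fourier_def)
    then show ?thesis by (simp add: h_def)
  qed
  have "fourier (f 0) w - g w = 0" for w
  proof (rule analytic_continuation[of "\<lambda>w. fourier (f 0) w - g w" UNIV "\<real>" 0])
    show "(\<lambda>w. fourier (f 0) w - g w) holomorphic_on UNIV"
      by (intro holomorphic_intros fourier_holomorphic[OF cf zero0] hol)
    show "(0::complex) islimpt \<real>"
      unfolding islimpt_approachable
    proof (intro allI impI)
      fix e :: real assume "e > 0"
      then show "\<exists>x'\<in>\<real>. x' \<noteq> 0 \<and> dist x' (0::complex) < e"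
        by (intro bexI[of _ "of_real (e / 2)"]) auto
    qed
  qed (auto simp: real Reals_def)
  then show ?thesis using that[of f] deriv zero by simp
qed

section \<open>Clifford monomials\<close>

text \<open>The list keeps the order of the factors and is what inductions run over.
  \<open>I\<close> may be any set of indices, so that complements can be written
  \<open>- I\<close>.\<close>

definition clifford_word :: "(nat \<Rightarrow> 'v::euclidean_space) \<Rightarrow> nat set
    \<Rightarrow> nat list \<Rightarrow> 'v uhc" where
  "clifford_word b I xs = prod_list (map (\<lambda>j. uhc_vec (b j)) (filter (\<lambda>j. j \<in> I)
      xs))"

definition monomial :: "(nat \<Rightarrow> 'v::euclidean_space) \<Rightarrow> nat set \<Rightarrow>
    'v uhc" where
  "monomial b I = clifford_word b I [1..<Suc DIM('v)]"

lemma clifford_word_simps [simp]: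
  "clifford_word b I [] = 1"
  "clifford_word b I (x # xs) = (if x \<in> I then uhc_vec (b x) * clifford_word b I xs else
      clifford_word b I xs)"
  by (simp_all add: clifford_word_def)

lemma clifford_word_cong: "(\<And>x. x \<in> set xs \<Longrightarrow> x \<in> I
    \<longleftrightarrow> x \<in> J) \<Longrightarrow> clifford_word b I xs = clifford_word b J xs"
  by (induction xs) auto

lemma uhc_vec_basis:
  fixes b :: "nat \<Rightarrow> 'v::euclidean_space"
  assumes b: "orthonormal_basis b" and i: "i \<in> {1..DIM('v)}" and j: "j \<in> {1..DIM('v)}"
  shows "uhc_vec (b i) * uhc_vec (b i) = uhc_z"
    and "i \<noteq> j \<Longrightarrow> uhc_vec (b i) * uhc_vec (b j) = - (uhc_vec (b j) * uhc_vec
        (b i))"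
proof -
  have on: "inner (b i) (b i) = 1" "i \<noteq> j \<Longrightarrow> inner (b i) (b j) = 0"
    using b i j unfolding orthonormal_basis_def by auto
  have "2 *\<^sub>R (uhc_vec (b i) * uhc_vec (b i)) = 2 *\<^sub>R uhc_z"
    using uhc_clifford[of "b i" "b i"] on(1) by (simp add: scaleR_2)
  then show "uhc_vec (b i) * uhc_vec (b i) = uhc_z" by simp
  show "uhc_vec (b i) * uhc_vec (b j) = - (uhc_vec (b j) * uhc_vec (b i))" if "i \<noteq> j"
    using uhc_clifford[of "b i" "b j"] on(2)[OF that] by (simp add: eq_neg_iff_add_eq_0)
qed

lemma vec_z_power_left_commute: "uhc_vec x * (uhc_z ^ k * v) = uhc_z ^ k * (uhc_vec x * v)"
proof -
  have "u * uhc_z ^ k = uhc_z ^ k * u" for u :: "'a uhc"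
    by (induction k) (simp_all add: mult.assoc uhc_z_central, simp flip: mult.assoc add: uhc_z_central)
  then show ?thesis by (simp flip: mult.assoc)
qed

text \<open>The generator \<open>b j\<close> is moved to its place in the word, changing the sign at
  each factor it passes. There it is inserted, or meets its own copy and leaves z.\<close>

lemma vec_mult_clifford_word:
  fixes b :: "nat \<Rightarrow> 'v::euclidean_space"
  assumes b: "orthonormal_basis b"
  assumes "distinct xs" "set xs \<subseteq> {1..DIM('v)}" "j \<in> set xs"
  shows "\<exists>s\<in>{1, -1}. uhc_vec (b j) * clifford_word b I xs =
    s *\<^sub>R (uhc_z ^ (if j \<in> I then 1 else 0) * clifford_word b (sym_diff I {j}) xs)"
  using assms(2-)
proof (induction xs)
  case (Cons x xs)
  note rel = uhc_vec_basis[OF b]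
  show ?case
  proof (cases "j = x")
    case True
    then have "clifford_word b (sym_diff I {j}) xs = clifford_word b I xs"
      using Cons.prems by (intro clifford_word_cong) auto
    then show ?thesis
      using True Cons.prems rel(1)[of x] by (auto simp flip: mult.assoc)
  next
    case False
    have "\<exists>s\<in>{1, -1}. uhc_vec (b j) * clifford_word b I xs =
        s *\<^sub>R (uhc_z ^ (if j \<in> I then 1 else 0) * clifford_word b (sym_diff I {j}) xs)"
      by (rule Cons.IH) (use False Cons.prems in auto)
    then obtain s where s: "s \<in> {1, -1}" "uhc_vec (b j) * clifford_word b I xs =
        s *\<^sub>R (uhc_z ^ (if j \<in> I then 1 else 0) * clifford_word b (sym_diff I {j}) xs)" by
            blast
    show ?thesis
    proof (cases "x \<in> I")
      case True
      have "uhc_vec (b j) * (uhc_vec (b x) * clifford_word b I xs) = - (uhc_vec (b x) * (uhc_vec (b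
          j) * clifford_word b I xs))"
      proof -
        have "uhc_vec (b j) * uhc_vec (b x) = - (uhc_vec (b x) * uhc_vec (b j))"
          by (rule rel(2)) (use Cons.prems False in auto)
        then show ?thesis by (simp flip: mult.assoc)
      qed
      then show ?thesis
        using s True False by (intro bexI[of _ "- s"]) (auto simp: vec_z_power_left_commute)
    qed (use s False in \<open>auto\<close>)
  qed
qed simp

text \<open>The left factors enter one at a time, so the induction runs over \<open>ys\<close> with
  \<open>xs\<close> fixed. Each factor toggles its index in the set reached so far and gives a z
  exactly when that index was already in \<open>I\<close>.\<close>

lemma clifford_word_mult:
  fixes b :: "nat \<Rightarrow> 'v::euclidean_space"
  assumes b: "orthonormal_basis b"
  assumes xs: "distinct xs" "set xs \<subseteq> {1..DIM('v)}" and "distinct ys" "set ys \<subseteq>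
      set xs"
  shows "\<exists>s\<in>{1, -1}. clifford_word b J ys * clifford_word b I xs =
    s *\<^sub>R (uhc_z ^ card (J \<inter> set ys \<inter> I) * clifford_word b (sym_diff (J \<inter>
        set ys) I) xs)"
  using assms(4-)
proof (induction ys)
  case Nil
  then show ?case by (auto intro!: bexI[of _ 1])
next
  case (Cons y ys)
  have "\<exists>s\<in>{1, -1}. clifford_word b J ys * clifford_word b I xs =
      s *\<^sub>R (uhc_z ^ card (J \<inter> set ys \<inter> I) * clifford_word b (sym_diff (J
          \<inter> set ys) I) xs)"
    by (rule Cons.IH) (use Cons.prems in auto)
  then obtain s where s: "s \<in> {1, -1}" "clifford_word b J ys * clifford_word b I xs =
      s *\<^sub>R (uhc_z ^ card (J \<inter> set ys \<inter> I) * clifford_word b (sym_diff (J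
          \<inter> set ys) I) xs)" by blast
  show ?case
  proof (cases "y \<in> J")
    case True
    let ?I = "sym_diff (J \<inter> set ys) I"
    have "y \<in> set xs" using Cons.prems by simp
    from vec_mult_clifford_word[OF b xs this, of ?I]
    obtain t where t: "t \<in> {1, -1}" "uhc_vec (b y) * clifford_word b ?I xs =
        t *\<^sub>R (uhc_z ^ (if y \<in> ?I then 1 else 0) * clifford_word b (sym_diff ?I {y}) xs)"
            by blast
    have eq1: "sym_diff ?I {y} = sym_diff (J \<inter> set (y # ys)) I" using True Cons.prems by auto
    have eq2: "card (J \<inter> set (y # ys) \<inter> I) = card (J \<inter> set ys \<inter> I) + (if
        y \<in> ?I then 1 else 0)"
      using True Cons.prems by (auto simp: card_insert_if)
    have eq3: "clifford_word b J (y # ys) * clifford_word b I xs =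
        (s * t) *\<^sub>R (uhc_z ^ (card (J \<inter> set ys \<inter> I) + (if y \<in> ?I then 1 else
            0)) * clifford_word b (sym_diff ?I {y}) xs)"
    proof -
      have "clifford_word b J (y # ys) * clifford_word b I xs =
          uhc_vec (b y) * (s *\<^sub>R (uhc_z ^ card (J \<inter> set ys \<inter> I) * clifford_word
            b ?I xs))"
        using True by (simp add: mult.assoc s(2))
      also have "\<dots> = s *\<^sub>R (uhc_z ^ card (J \<inter> set ys \<inter> I) * (uhc_vec (b y)
          * clifford_word b ?I xs))"
        by (simp only: vec_z_power_left_commute mult_scaleR_right)
      finally show ?thesis
        by (simp only: t(2) mult_scaleR_right scaleR_scaleR power_add mult.assoc)
    qed
    have "s * t \<in> {1, -1}" using s(1) t(1) by auto
    then show ?thesis by (rule bexI[rotated]) (simp only: eq1 eq2 eq3)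
  next
    case False
    then have "J \<inter> set (y # ys) = J \<inter> set ys" by auto
    then show ?thesis using s False by auto
  qed
qed

lemma monomial_mult:
  fixes b :: "nat \<Rightarrow> 'v::euclidean_space"
  assumes "orthonormal_basis b" "J \<subseteq> {1..DIM('v)}"
  shows "\<exists>s\<in>{1, -1}. monomial b J * monomial b I =
    s *\<^sub>R (uhc_z ^ card (J \<inter> I) * monomial b (sym_diff J I))"
proof -
  have J: "J \<inter> set [1..<Suc DIM('v)] = J" using assms(2) by auto
  show ?thesis
    using clifford_word_mult[OF assms(1), of "[1..<Suc DIM('v)]" "[1..<Suc DIM('v)]" J I]
    unfolding monomial_def J by (simp add: atLeastLessThanSuc_atLeastAtMost del: upt_Suc)
qed

lemma vec_mult_monomial:
  fixes b :: "nat \<Rightarrow> 'v::euclidean_space"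
  assumes "orthonormal_basis b" "j \<in> {1..DIM('v)}"
  shows "\<exists>s\<in>{1, -1}. uhc_vec (b j) * monomial b I =
    s *\<^sub>R (uhc_z ^ (if j \<in> I then 1 else 0) * monomial b (sym_diff I {j}))"
  unfolding monomial_def by (rule vec_mult_clifford_word[OF assms(1)]) (use assms(2) in auto)

lemma monomial_empty [simp]: "monomial b {} = 1"
  by (simp add: monomial_def clifford_word_def)

lemma monomial_full: "monomial b {1..DIM('v)} = gamma_elt b"
    for b :: "nat \<Rightarrow> 'v::euclidean_space"
proof -
  have "monomial b {1..DIM('v)} = clifford_word b UNIV [1..<Suc DIM('v)]"
    unfolding monomial_def by (rule clifford_word_cong) auto
  then show ?thesis by (simp add: clifford_word_def gamma_elt_def del: upt_Suc)
qed

lemma vec_clifford_word_commute: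
  fixes b :: "nat \<Rightarrow> 'v::euclidean_space"
  assumes b: "orthonormal_basis b" and "j \<in> {1..DIM('v)}" "j \<notin> I" "set xs \<subseteq>
      {1..DIM('v)}"
  shows "uhc_vec (b j) * clifford_word b I xs =
    (-1) ^ length (filter (\<lambda>j. j \<in> I) xs) *\<^sub>R (clifford_word b I xs * uhc_vec (b j))"
  using assms(4)
proof (induction xs)
  case (Cons x xs)
  show ?case
  proof (cases "x \<in> I")
    case True
    then have "uhc_vec (b j) * (uhc_vec (b x) * clifford_word b I xs) = - (uhc_vec (b x) * (uhc_vec
        (b j) * clifford_word b I xs))"
      using uhc_vec_basis(2)[OF b, of j x] assms(2,3) Cons.prems by (fastforce simp flip: mult.assoc)
    then show ?thesis using True Cons by (simp add: mult.assoc)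
  qed (use Cons in simp)
qed simp

lemma vec_monomial_commute:
  fixes b :: "nat \<Rightarrow> 'v::euclidean_space"
  assumes "orthonormal_basis b" "j \<in> {1..DIM('v)}" "j \<notin> I" "I \<subseteq> {1..DIM('v)}"
  shows "uhc_vec (b j) * monomial b I = (-1) ^ card I *\<^sub>R (monomial b I * uhc_vec (b j))"
proof -
  have "I \<inter> set [1..<Suc DIM('v)] = I" using assms(4) by auto
  then have "length (filter (\<lambda>j. j \<in> I) [1..<Suc DIM('v)]) = card I"
    by (simp add: distinct_length_filter del: upt_Suc)
  then show ?thesis
    using vec_clifford_word_commute[OF assms(1-3), of "[1..<Suc DIM('v)]"]
        by (simp add: monomial_def atLeastLessThanSuc_atLeastAtMost del: upt_Suc)
qed

text \<open>The span contains 1 and is stable under left multiplication by z and by each basis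
  vector, hence by every generator and then by every element.\<close>

lemma span_monomials:
  fixes b :: "nat \<Rightarrow> 'v::euclidean_space" and u :: "'v uhc"
  assumes b: "orthonormal_basis b"
  shows "u \<in> span {uhc_z ^ k * monomial b I | k I. I \<subseteq> {1..DIM('v)}}" (is "_ \<in>
      span ?M")
proof -
  let ?J = "{1..DIM('v)}"
  have left: "u * v \<in> span ?M" if "v \<in> span ?M" for u v
    using that
  proof (induction u arbitrary: v rule: uhc_induct)
    case (gen x)
    have z: "uhc_z * v \<in> span ?M" if "v \<in> span ?M" for v
      using that
    proof (induction rule: span_induct_alt)
      case (step c x y)
      then obtain k I where "x = uhc_z ^ k * monomial b I" "I \<subseteq> ?J" by auto
      then have "uhc_z * x \<in> ?M" by (intro CollectI exI[of _ "Suc k"]) (auto simp: mult.assoc)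
      then show ?case using step by (simp add: distrib_left span_add span_base span_scale)
    qed (simp add: span_zero)
    have a: "uhc_vec (b j) * v \<in> span ?M" if v: "v \<in> span ?M" and j: "j \<in> ?J" for v j
      using v
    proof (induction rule: span_induct_alt)
      case (step c x y)
      then obtain k I where x: "x = uhc_z ^ k * monomial b I" "I \<subseteq> ?J" by auto
      obtain s where s: "uhc_vec (b j) * monomial b I =
          s *\<^sub>R (uhc_z ^ (if j \<in> I then 1 else 0) * monomial b (sym_diff I {j}))"
        using vec_mult_monomial[OF b j] by blast
      have "uhc_vec (b j) * x = uhc_z ^ k * (uhc_vec (b j) * monomial b I)"
        by (simp only: x vec_z_power_left_commute)
      then have "uhc_vec (b j) * x =
          s *\<^sub>R (uhc_z ^ (k + (if j \<in> I then 1 else 0)) * monomial b (sym_diff I {j}))"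
        by (simp only: s mult_scaleR_right power_add mult.assoc)
      moreover have "uhc_z ^ (k + (if j \<in> I then 1 else 0)) * monomial b (sym_diff I {j}) \<in> ?M"
        using x j by blast
      ultimately show ?case using step by (simp add: distrib_left span_add span_base span_scale)
    qed (simp add: span_zero)
    have lin: "linear (uhc_vec :: 'v \<Rightarrow> 'v uhc)"
      by (rule linearI) (simp_all add: uhc_vec_def
          flip: linear_scale[OF linear_hc_gen] linear_add[OF linear_hc_gen])
    have "hc_gen x = uhc_vec (fst x) + snd x *\<^sub>R uhc_z"
      by (simp add: uhc_vec_def uhc_z_def flip: linear_scale[OF linear_hc_gen] linear_add[OF
          linear_hc_gen])
    also have "uhc_vec (fst x) = (\<Sum>j\<in>?J. inner (fst x) (b j) *\<^sub>R uhc_vec (b j))"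
      by (subst orthonormal_basis_expand[OF b, of "fst x"])
        (simp add: linear_sum[OF lin] linear_scale[OF lin])
    finally have x: "hc_gen x = (\<Sum>j\<in>?J. inner (fst x) (b j) *\<^sub>R uhc_vec (b j)) + snd
        x *\<^sub>R uhc_z" .
    show ?case
      unfolding x distrib_right sum_distrib_right mult_scaleR_left
      by (intro span_add span_sum span_scale z a gen)
  next
    case (scal c)
    then show ?case by (simp add: of_real_def span_scale)
  qed (simp_all add: distrib_right span_add mult.assoc)
  have "1 \<in> ?M" by (intro CollectI exI[of _ 0] exI[of _ "{}"]) auto
  then show ?thesis using left[of 1 u] by (simp add: span_base)
qed

section \<open>Parity of monomials and the coproduct of \<gamma>\<close>

lemma parity_clifford_word: "parity (clifford_word b I xs) = (-1) ^ length (filter (\<lambda>j. j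
    \<in> I) xs) *\<^sub>R clifford_word b I xs"
  by (induction xs) (simp_all add: parity_one parity_mult parity_uhc_vec)

lemma homogeneous_clifford_word: "homogeneous (clifford_word b I xs)"
  by (cases "even (length (filter (\<lambda>j. j \<in> I) xs))")
    (simp_all add: homogeneous_def is_even_def is_odd_def parity_clifford_word)

text \<open>Multiplying by a \<otimes> 1 + 1 \<otimes> a, with a the new first letter
  \<open>x\<close>, splits each term in two: the first summand gives the subsets containing
  \<open>x\<close>, the second those without it. The set \<open>UNIV\<close> selects every letter,
  so the word on the left is the full product.\<close>

lemma coproduct_clifford_word:
  fixes b :: "nat \<Rightarrow> 'v::euclidean_space"
  shows "distinct xs \<Longrightarrow> \<exists>s. (\<forall>I. s I \<in> {1, -1}) \<and>
    coproduct (clifford_word b UNIV xs) = (\<Sum>I\<in>Pow (set xs). s I *\<^sub>R (clifford_word b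
        I xs \<otimes>\<^sub>s clifford_word b (- I) xs))"
proof (induction xs)
  case Nil
  show ?case by (intro exI[of _ "\<lambda>_. 1"]) (simp add: coproduct_hom flip: one_tensor_def)
next
  case (Cons x xs)
  then obtain s where s: "\<And>I. s I \<in> {1, -1}" "coproduct (clifford_word b UNIV xs) =
      (\<Sum>I\<in>Pow (set xs). s I *\<^sub>R (clifford_word b I xs \<otimes>\<^sub>s clifford_word
          b (- I) xs))" by auto
  let ?a = "uhc_vec (b x)"
  have x: "x \<notin> set xs" using Cons.prems by simp
  have cop: "coproduct ?a = ?a \<otimes>\<^sub>s 1 + 1 \<otimes>\<^sub>s ?a"
      by (simp add: uhc_vec_def coproduct_hom)
  have one: "homogeneous (1 :: 'v uhc)" "is_even (1 :: 'v uhc)"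
    by (simp_all add: homogeneous_def is_even_def parity_one)
  have hom_a: "homogeneous ?a" by (simp add: homogeneous_def is_odd_def parity_uhc_vec)
  have left: "(?a \<otimes>\<^sub>s 1) * (clifford_word b I xs \<otimes>\<^sub>s v) = (?a *
      clifford_word b I xs) \<otimes>\<^sub>s v" for I and v :: "'v uhc"
    by (simp add: tensor_times_homogeneous one homogeneous_clifford_word)
  \<comment> \<open>The Koszul sign of moving the odd generator past the left tensor factor.\<close>
  define t where "t I = (if is_even ?a \<or> is_even (clifford_word b I xs) then 1 else -1 :: real)"
      for I
  have right: "(1 \<otimes>\<^sub>s ?a) * (clifford_word b I xs \<otimes>\<^sub>s v) = t I *\<^sub>R
      (clifford_word b I xs \<otimes>\<^sub>s (?a * v))" for I and v :: "'v uhc"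
    by (simp add: tensor_times_homogeneous hom_a homogeneous_clifford_word t_def)
  define r where "r I = (if x \<in> I then s (I - {x}) else s I * t I)" for I
  have r: "r I \<in> {1, -1}" for I using s(1)[of I] s(1)[of "I - {x}"] by (auto simp: r_def t_def)
  have w: "clifford_word b (insert x I) xs = clifford_word b I xs" "clifford_word b (- insert x I)
      xs = clifford_word b (- I) xs" for I
    using x by (auto intro: clifford_word_cong)
  have inj: "inj_on (insert x) (Pow (set xs))" using x by (auto simp: inj_on_def)
  have "coproduct (clifford_word b UNIV (x # xs)) =
      (\<Sum>I\<in>Pow (set xs). s I *\<^sub>R ((?a * clifford_word b I xs) \<otimes>\<^sub>s
          clifford_word b (- I) xs)) +
      (\<Sum>I\<in>Pow (set xs). (s I * t I) *\<^sub>R (clifford_word b I xs \<otimes>\<^sub>s (?a *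
          clifford_word b (- I) xs)))"
    by (simp add: coproduct_hom cop s(2) distrib_right sum_distrib_left left right scaleR_add_right
        sum.distrib)
  also have "(\<Sum>I\<in>Pow (set xs). s I *\<^sub>R ((?a * clifford_word b I xs) \<otimes>\<^sub>s
      clifford_word b (- I) xs)) =
      (\<Sum>I\<in>insert x ` Pow (set xs). r I *\<^sub>R (clifford_word b I (x # xs)
          \<otimes>\<^sub>s clifford_word b (- I) (x # xs)))"
  proof -
    have "I - {x} = I" if "I \<subseteq> set xs" for I using that x by auto
    then show ?thesis by (subst sum.reindex[OF inj]) (auto intro!: sum.cong simp: w r_def)
  qed
  also have "(\<Sum>I\<in>Pow (set xs). (s I * t I) *\<^sub>R (clifford_word b I xs
      \<otimes>\<^sub>s (?a * clifford_word b (- I) xs))) =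
      (\<Sum>I\<in>Pow (set xs). r I *\<^sub>R (clifford_word b I (x # xs) \<otimes>\<^sub>s
          clifford_word b (- I) (x # xs)))"
    using x by (intro sum.cong) (auto simp: r_def)
  also have "(\<Sum>I\<in>insert x ` Pow (set xs). r I *\<^sub>R (clifford_word b I (x # xs)
      \<otimes>\<^sub>s clifford_word b (- I) (x # xs))) + \<dots> =
      (\<Sum>I\<in>Pow (set (x # xs)). r I *\<^sub>R (clifford_word b I (x # xs) \<otimes>\<^sub>s
          clifford_word b (- I) (x # xs)))"
    using x by (subst sum.union_disjoint[symmetric]) (auto simp: Pow_insert Un_commute)
  finally show ?case using r by blast
qed

lemma coproduct_gamma:
  fixes b :: "nat \<Rightarrow> 'v::euclidean_space"
  shows "\<exists>s. (\<forall>I. s I \<in> {1, -1}) \<and> coproduct (gamma_elt b) =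
    (\<Sum>I\<in>Pow {1..DIM('v)}. s I *\<^sub>R (monomial b I \<otimes>\<^sub>s monomial b
        ({1..DIM('v)} - I)))"
proof -
  let ?xs = "[1..<Suc DIM('v)]"
  have J: "set ?xs = {1..DIM('v)}" by auto
  have "clifford_word b UNIV ?xs = gamma_elt b" by (simp add: clifford_word_def gamma_elt_def del:
      upt_Suc)
  moreover have "clifford_word b (- I) ?xs = monomial b ({1..DIM('v)} - I)" for I
    unfolding monomial_def by (rule clifford_word_cong) auto
  ultimately show ?thesis
    using coproduct_clifford_word[of ?xs b] unfolding J by (auto simp: monomial_def simp del: upt_Suc)
qed

text \<open>
  Move one generator around the trace: \<open>a\<^sub>j\<close> with \<open>j \<notin> K\<close>,
      inserted as \<open>a\<^sub>j\<^sup>2 = z\<close>, if \<open>|K|\<close> and the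
  dimension have the same parity, and a factor of the monomial otherwise.
\<close>

lemma supertrace_monomial_eq_0:
  fixes b :: "nat \<Rightarrow> 'v::euclidean_space" and \<tau> :: "'v uhc \<Rightarrow> complex"
  assumes b: "orthonormal_basis b"
    and scale: "\<And>r u. \<tau> (r *\<^sub>R u) = of_real r * \<tau> u"
    and z: "\<And>u. \<tau> (uhc_z * u) = w * \<tau> u" "w \<noteq> 0"
    and cyc: "\<And>j u. j \<in> {1..DIM('v)} \<Longrightarrow> \<tau> (uhc_vec (b j) * u) = - ((-1)
        ^ DIM('v)) * \<tau> (u * uhc_vec (b j))"
    and one: "odd DIM('v) \<Longrightarrow> \<tau> 1 = 0"
    and K: "K \<subset> {1..DIM('v)}"
  shows "\<tau> (monomial b K) = 0"
proof (cases "even (card K + DIM('v))")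
  case True
  obtain j where j: "j \<in> {1..DIM('v)}" "j \<notin> K" using K by blast
  let ?a = "uhc_vec (b j)"
  have "w * \<tau> (monomial b K) = \<tau> (?a * (?a * monomial b K))"
    using uhc_vec_basis(1)[OF b j(1) j(1)] by (simp add: z flip: mult.assoc)
  also have "\<dots> = (-1) ^ card K * \<tau> (?a * (monomial b K * ?a))"
    using vec_monomial_commute[OF b j] K by (simp add: scale)
  also have "\<dots> = (-1) ^ card K * (- ((-1) ^ DIM('v)) * \<tau> (uhc_z * monomial b K))"
    using uhc_vec_basis(1)[OF b j(1) j(1)] by (simp add: cyc[OF j(1)] mult.assoc uhc_z_central)
  also have "\<dots> = - ((-1) ^ (card K + DIM('v))) * (w * \<tau> (monomial b K))"
    by (simp add: z power_add)
  also have "\<dots> = - (w * \<tau> (monomial b K))" using True by simp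
  finally show ?thesis using z(2) by simp
next
  case odd: False
  show ?thesis
  proof (cases "K = {}")
    case True
    \<comment> \<open>The empty product has no factor to move around. The dimension is odd here, and
      the trace of 1 vanishes by assumption.\<close>
    then show ?thesis using odd one by simp
  next
    case False
    then obtain j where j: "j \<in> K" by blast
    have J: "j \<in> {1..DIM('v)}" "j \<notin> K - {j}" "K - {j} \<subseteq> {1..DIM('v)}"
        using K j by auto
    let ?a = "uhc_vec (b j)" and ?m = "monomial b (K - {j})"
    have "sym_diff (K - {j}) {j} = K" using j by auto
    moreover from vec_mult_monomial[OF b J(1), of "K - {j}"]
    obtain s where "s \<in> {1, -1}" "?a * ?m =
      s *\<^sub>R (uhc_z ^ (if j \<in> K - {j} then 1 else 0) * monomial b (sym_diff (K - {j})
          {j}))" by blast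
    ultimately have s: "s \<in> {1, -1}" "?a * ?m = s *\<^sub>R monomial b K" by simp_all
    have "\<tau> (?a * ?m) = - ((-1) ^ DIM('v)) * ((-1) ^ card (K - {j}) * \<tau> (?a * ?m))"
    proof -
      have "?m * ?a = (-1) ^ card (K - {j}) *\<^sub>R (?a * ?m)"
        unfolding vec_monomial_commute[OF b J] by (simp flip: power_mult_distrib)
      then have "\<tau> (?m * ?a) = (-1) ^ card (K - {j}) * \<tau> (?a * ?m)" by (simp only: scale) simp
      with cyc[OF J(1), of ?m] show ?thesis by (simp only:)
    qed
    moreover have "card K = Suc (card (K - {j}))"
      using j K by (metis card_Suc_Diff1 finite_subset finite_atLeastAtMost psubset_imp_subset)
    ultimately have "\<tau> (?a * ?m) = - \<tau> (?a * ?m)"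
      using odd by (simp flip: mult.assoc power_add)
    then have "\<tau> (?a * ?m) = 0" by simp
    then show ?thesis using s by (auto simp: scale)
  qed
qed

section \<open>The functional \<open>T\<close>\<close>

lemma mat_trace_add: "A \<in> carrier_mat d d \<Longrightarrow> B \<in> carrier_mat d d
    \<Longrightarrow> mat_trace (A + B) = mat_trace A + mat_trace B"
  by (auto simp: mat_trace_def sum.distrib)

lemma mat_trace_smult: "A \<in> carrier_mat d d \<Longrightarrow> mat_trace (c \<cdot>\<^sub>m A) =
    c * mat_trace A"
  by (auto simp: mat_trace_def sum_distrib_left)

lemma mat_trace_commute:
  assumes "A \<in> carrier_mat d d" "B \<in> carrier_mat d d"
  shows "mat_trace (A * B) = mat_trace (B * A)"
proof -
  have *: "mat_trace (A * B) = (\<Sum>i<d. \<Sum>j<d. A $$ (i, j) * B $$ (j, i))"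
    if "A \<in> carrier_mat d d" "B \<in> carrier_mat d d" for A B :: "complex mat"
    using that by (auto simp: mat_trace_def scalar_prod_def lessThan_atLeast0 intro!: sum.cong)
  show ?thesis
    unfolding *[OF assms] *[OF assms(2,1)] by (subst sum.swap) (simp add: mult.commute)
qed

lemma mat_trace_one: "mat_trace (1\<^sub>m d) = of_nat d"
  by (simp add: mat_trace_def)

lemma H_functional_even:
  "even n \<Longrightarrow> H_functional n \<zeta> A = mat_trace (Gamma_mat (n div 2) * fst A)"
  by (simp add: H_functional_def)

text \<open>\<epsilon>(M + \<epsilon>N) = \<zeta>N + \<epsilon>M, and the block matrix of an element
  has its \<epsilon>-free part twice on the diagonal. This explains the factor 2 and the extra
  \<zeta> that odd dimensions contribute to [n].\<close>

lemma H_functional_odd: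
  assumes "odd n" "A \<in> H_carrier n"
  shows "H_functional n \<zeta> A = 2 * exp (\<i> * of_real (pi / 4)) * \<zeta> * mat_trace (snd A)"
proof -
  let ?d = "H_dim n" and ?e = "exp (\<i> * of_real (pi / 4))"
  let ?B = "H_mult \<zeta> (H_smult ?e (0\<^sub>m ?d ?d, 1\<^sub>m ?d)) A"
  note A = H_carrierD(1,2)[OF assms(2)]
  have B: "fst ?B = (?e * \<zeta>) \<cdot>\<^sub>m snd A" "snd ?B \<in> carrier_mat ?d ?d"
    using A by (auto simp: H_mult_def H_smult_def mult_smult_assoc_mat smult_smult_times mult.commute)
  have "mat_trace (D_endomorphism \<zeta> C) = 2 * mat_trace (fst C)"
    if "fst C \<in> carrier_mat ?d ?d" "snd C \<in> carrier_mat ?d ?d" for C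
  proof -
    have "mat_trace (D_endomorphism \<zeta> C) = (\<Sum>i<?d + ?d.
        if i < ?d then fst C $$ (i, i) else fst C $$ (i - ?d, i - ?d))"
      using that by (auto simp: mat_trace_def D_endomorphism_def intro!: sum.cong)
    also have "\<dots> = (\<Sum>i<?d. fst C $$ (i, i)) + (\<Sum>i=?d..<?d + ?d. fst C $$ (i - ?d, i
        - ?d))"
      by (subst lessThan_atLeast0, subst sum.atLeastLessThan_concat[symmetric, of 0 ?d])
        (auto simp: lessThan_atLeast0 intro!: arg_cong2[where f = plus] sum.cong)
    also have "(\<Sum>i=?d..<?d + ?d. fst C $$ (i - ?d, i - ?d)) = (\<Sum>i<?d. fst C $$ (i, i))"
      using sum.shift_bounds_nat_ivl[of "\<lambda>i. fst C $$ (i - ?d, i - ?d)" 0 ?d ?d]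
          by (simp add: lessThan_atLeast0)
    finally show ?thesis using that by (simp add: mat_trace_def)
  qed
  then have "H_functional n \<zeta> A = 2 * mat_trace (fst ?B)"
    using assms A B by (simp add: H_functional_def)
  also have "\<dots> = 2 * ?e * \<zeta> * mat_trace (snd A)"
    unfolding B using A by (simp add: mat_trace_smult)
  finally show ?thesis .
qed

lemma H_functional_linear:
  assumes "A \<in> H_carrier n"
  shows "B \<in> H_carrier n \<Longrightarrow> H_functional n \<zeta> (H_add A B) = H_functional n
      \<zeta> A + H_functional n \<zeta> B"
    and "H_functional n \<zeta> (H_smult c A) = c * H_functional n \<zeta> A"
proof -
  let ?d = "H_dim n"
  note A = H_carrierD(1,2)[OF assms]
  have G: "Gamma_mat (n div 2) \<in> carrier_mat ?d ?d" using Gamma_mat(1) by (simp add: H_dim_def)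
  show "H_functional n \<zeta> (H_add A B) = H_functional n \<zeta> A + H_functional n \<zeta> B"
    if car: "B \<in> H_carrier n"
  proof (cases "even n")
    case True
    note B = H_carrierD(1,2)[OF car]
    have "Gamma_mat (n div 2) * (fst A + fst B) = Gamma_mat (n div 2) * fst A + Gamma_mat (n div 2)
        * fst B"
      using G A B by (intro mult_add_distrib_mat) auto
    then show ?thesis
      using True G A B by (simp add: H_functional_even H_add_def mat_trace_add[of _ ?d])
  next
    case False
    note B = H_carrierD(1,2)[OF car]
    have "H_add A B \<in> H_carrier n" by (intro H_closed assms car)
    then show ?thesis
      using False A B by (simp add: H_functional_odd assms car) (simp add: H_add_def
          mat_trace_add[of _ ?d] distrib_left)
  qed
  show "H_functional n \<zeta> (H_smult c A) = c * H_functional n \<zeta> A"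
  proof (cases "even n")
    case True
    have "Gamma_mat (n div 2) * (c \<cdot>\<^sub>m fst A) = c \<cdot>\<^sub>m (Gamma_mat (n div 2) *
        fst A)"
      using G A by (intro mult_smult_distrib) auto
    then show ?thesis
      using True G A by (simp add: H_functional_even H_smult_def mat_trace_smult[of _ ?d])
  next
    case False
    have "H_smult c A \<in> H_carrier n" by (intro H_closed assms)
    then show ?thesis
      using False A by (simp add: H_functional_odd assms) (simp add: H_smult_def mat_trace_smult[of
          _ ?d])
  qed
qed

lemma H_functional_one: "odd n \<Longrightarrow> H_functional n \<zeta> (H_one n) = 0"
  by (simp add: H_functional_odd H_closed) (simp add: H_one_def mat_trace_def)

text \<open>For even \<open>n\<close>, T is a supertrace, and the sign arises because \<Gamma>
  anticommutes with every generator. For odd \<open>n\<close>, generators have only an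
  \<epsilon>-part, and T is a multiple of the ordinary trace of the \<epsilon>-part, so no sign
  appears.\<close>

lemma H_functional_cyclic:
  assumes j: "j \<in> {1..n}" and X: "X \<in> H_carrier n"
  shows "H_functional n \<zeta> (H_mult \<zeta> (H_clifford n \<zeta> j) X) =
    - ((-1) ^ n) * H_functional n \<zeta> (H_mult \<zeta> X (H_clifford n \<zeta> j))"
proof -
  let ?d = "H_dim n" and ?c = "H_clifford n \<zeta> j" and ?G = "Gamma_mat (n div 2)"
  have c: "?c \<in> H_carrier n" by (rule H_clifford(1)[OF j j])
  note C = H_carrierD(1,2)[OF c] and X' = H_carrierD(1,2)[OF X]
  have G: "?G \<in> carrier_mat ?d ?d" using Gamma_mat(1) by (simp add: H_dim_def)
  show ?thesis
  proof (cases "even n")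
    case True
    have m: "fst (H_mult \<zeta> A B) = fst A * fst B"
        if "A \<in> H_carrier n" "B \<in> H_carrier n" for A B
      using H_carrierD[OF that(1)] H_carrierD[OF that(2)] True by (simp add: H_mult_def)
    have fc: "fst ?c = even_clifford (n div 2) \<zeta> j" using True
        by (simp add: H_clifford_def Let_def)
    have "j \<in> {1..2 * (n div 2)}" using True j by simp
    then have anti: "?G * fst ?c = (-1) \<cdot>\<^sub>m (fst ?c * ?G)" unfolding fc
        by (rule Gamma_anticommute)
    have "?G * (fst ?c * fst X) = (?G * fst ?c) * fst X"
      using G C X' by (intro assoc_mult_mat[symmetric])
    also have "\<dots> = (-1) \<cdot>\<^sub>m (fst ?c * ?G * fst X)"
      unfolding anti using G C X' by (intro mult_smult_assoc_mat) auto
    also have "fst ?c * ?G * fst X = fst ?c * (?G * fst X)"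
      using G C X' by (intro assoc_mult_mat)
    finally have "mat_trace (?G * (fst ?c * fst X)) = - mat_trace (fst ?c * (?G * fst X))"
      using G C X' by (simp add: mat_trace_smult[of _ ?d])
    also have "mat_trace (fst ?c * (?G * fst X)) = mat_trace (?G * fst X * fst ?c)"
      using G C X' by (intro mat_trace_commute) auto
    also have "?G * fst X * fst ?c = ?G * (fst X * fst ?c)"
      using G C X' by (intro assoc_mult_mat)
    finally show ?thesis using True by (simp add: H_functional_even m c X)
  next
    case False
    have fc: "fst ?c = 0\<^sub>m ?d ?d" using False by (simp add: H_clifford_odd)
    have "snd (H_mult \<zeta> ?c X) = snd ?c * fst X" "snd (H_mult \<zeta> X ?c) = fst X * snd ?c"
      using fc C X' by (simp_all add: H_mult_def)
    then show ?thesis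
      using False mat_trace_commute[OF C(2) X'(1)]
      by (simp add: H_functional_odd H_closed c X)
  qed
qed

section \<open>The ordered product of all Clifford generators\<close>

definition mat_prod :: "nat \<Rightarrow> ('i \<Rightarrow> complex mat) \<Rightarrow> 'i list
    \<Rightarrow> complex mat" where
  "mat_prod d M xs = foldr (\<lambda>j A. M j * A) xs (1\<^sub>m d)"

lemma mat_prod_simps [simp]:
  "mat_prod d M [] = 1\<^sub>m d" "mat_prod d M (x # xs) = M x * mat_prod d M xs"
  by (simp_all add: mat_prod_def)

lemma mat_prod_map: "mat_prod d M (map f xs) = mat_prod d (\<lambda>x. M (f x)) xs"
  by (induction xs) auto

lemma mat_prod_cong: "(\<And>x. x \<in> set xs \<Longrightarrow> M x = N x) \<Longrightarrow>
    mat_prod d M xs = mat_prod d N xs"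
  by (induction xs) auto

lemma mat_prod_carrier:
  "(\<And>x. x \<in> set xs \<Longrightarrow> M x \<in> carrier_mat d d) \<Longrightarrow> mat_prod
      d M xs \<in> carrier_mat d d"
  by (induction xs) (auto intro: mult_carrier_mat)

text \<open>Splits off the first tensor factor: every generator after the first two begins with
  \<sigma>, and \<sigma>^2 = 1.\<close>

lemma mat_prod_kron_sigma:
  assumes "\<And>x. x \<in> set xs \<Longrightarrow> M x \<in> carrier_mat d d"
  shows "mat_prod (2 * d) (\<lambda>x. kron sigma_mat (M x)) xs =
    kron (if even (length xs) then 1\<^sub>m 2 else sigma_mat) (mat_prod d M xs)"
  using assms
proof (induction xs)
  case (Cons x xs)
  then have M: "M x \<in> carrier_mat d d" "mat_prod d M xs \<in> carrier_mat d d"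
    by (auto intro: mat_prod_carrier)
  show ?case
    using Cons kron_mult[OF basic_carrier(1) _ M, of "1\<^sub>m 2" 2] kron_mult[OF basic_carrier(1)
        basic_carrier(1) M] basic_carrier(1)
    by (auto simp: basic_mult)
qed (simp add: kron_one)

lemma even_clifford_Suc:
  "even_clifford (Suc k) \<zeta> 1 = kron (X_mat \<zeta>) (1\<^sub>m (2 ^ k))"
  "even_clifford (Suc k) \<zeta> 2 = kron (Y_mat \<zeta>) (1\<^sub>m (2 ^ k))"
  "m \<ge> 1 \<Longrightarrow> even_clifford (Suc k) \<zeta> (Suc (Suc m)) = kron sigma_mat
      (even_clifford k \<zeta> m)"
proof -
  show "even_clifford (Suc k) \<zeta> 1 = kron (X_mat \<zeta>) (1\<^sub>m (2 ^ k))"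
    "even_clifford (Suc k) \<zeta> 2 = kron (Y_mat \<zeta>) (1\<^sub>m (2 ^ k))"
    by (simp_all add: even_clifford_def krons_Cons krons_one)
  assume "m \<ge> 1"
  then obtain l where l: "(m + 1) div 2 = Suc l" by (cases "(m + 1) div 2") auto
  then have "(Suc (Suc m) + 1) div 2 = Suc (Suc l)" by simp
  then show "even_clifford (Suc k) \<zeta> (Suc (Suc m)) = kron sigma_mat (even_clifford k \<zeta> m)"
    using l by (simp add: even_clifford_def krons_Cons Let_def)
qed

lemma X_mult_Y: "X_mat \<zeta> * Y_mat \<zeta> = (- \<i> * \<zeta>) \<cdot>\<^sub>m sigma_mat"
  by (rule eq_matI) (auto simp: sigma_mat_def X_mat_def Y_mat_def mat_of_rows_list_def
      scalar_prod_def numeral_2_eq_2 less_Suc_eq)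

text \<open>Induction on the number of tensor factors. In the first one the leading two generators
  give XY = -i\<zeta>\<sigma>, while the other 2k contribute an even power of \<sigma>.\<close>

lemma mat_prod_even_clifford:
  "mat_prod (2 ^ k) (even_clifford k \<zeta>) [1..<Suc (2 * k)] = (- \<i> * \<zeta>) ^ k
      \<cdot>\<^sub>m Gamma_mat k"
proof (induction k)
  case 0
  show ?case by (simp add: Gamma_mat_def krons_def one_smult_mat)
next
  case (Suc k)
  let ?xs = "[1..<Suc (2 * k)]" and ?d = "2 ^ k :: nat"
  have c: "even_clifford k \<zeta> m \<in> carrier_mat ?d ?d" if "m \<in> set ?xs" for m
    using that by (intro even_clifford_carrier) auto
  have "[1..<Suc (2 * Suc k)] = 1 # 2 # map (\<lambda>m. Suc (Suc m)) ?xs"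
    by (simp add: upt_conv_Cons map_Suc_upt[symmetric] del: upt_Suc)
  then have "mat_prod (2 ^ Suc k) (even_clifford (Suc k) \<zeta>) [1..<Suc (2 * Suc k)] =
      kron (X_mat \<zeta>) (1\<^sub>m ?d) * (kron (Y_mat \<zeta>) (1\<^sub>m ?d) *
        mat_prod (2 * ?d) (\<lambda>m. even_clifford (Suc k) \<zeta> (Suc (Suc m))) ?xs)"
    by (simp add: mat_prod_map even_clifford_Suc(2) even_clifford_Suc(1)[simplified] del: upt_Suc)
  also have "mat_prod (2 * ?d) (\<lambda>m. even_clifford (Suc k) \<zeta> (Suc (Suc m))) ?xs =
      mat_prod (2 * ?d) (\<lambda>m. kron sigma_mat (even_clifford k \<zeta> m)) ?xs"
    by (intro mat_prod_cong even_clifford_Suc(3)) auto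
  also have "\<dots> = kron (1\<^sub>m 2) ((- \<i> * \<zeta>) ^ k \<cdot>\<^sub>m Gamma_mat k)"
    using mat_prod_kron_sigma[of ?xs "even_clifford k \<zeta>" ?d, OF c] unfolding Suc.IH
        by (simp del: upt_Suc)
  also have "kron (Y_mat \<zeta>) (1\<^sub>m ?d) * \<dots> = kron (Y_mat \<zeta>) ((- \<i> *
      \<zeta>) ^ k \<cdot>\<^sub>m Gamma_mat k)"
    using kron_mult[OF basic_carrier(3) one_carrier_mat one_carrier_mat, of "(- \<i> * \<zeta>) ^ k
        \<cdot>\<^sub>m Gamma_mat k" ?d ?d \<zeta>]
      Gamma_mat(1)[of k] basic_carrier(3)[of \<zeta>] by simp
  also have "kron (X_mat \<zeta>) (1\<^sub>m ?d) * \<dots> = kron (X_mat \<zeta> * Y_mat \<zeta>)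
      ((- \<i> * \<zeta>) ^ k \<cdot>\<^sub>m Gamma_mat k)"
    using kron_mult[OF basic_carrier(2,3) one_carrier_mat, of "(- \<i> * \<zeta>) ^ k
        \<cdot>\<^sub>m Gamma_mat k" ?d ?d \<zeta> \<zeta>]
      Gamma_mat(1)[of k] by simp
  also have "\<dots> = (- \<i> * \<zeta>) ^ Suc k \<cdot>\<^sub>m Gamma_mat (Suc k)"
    unfolding X_mult_Y by (simp add: kron_smult smult_smult_times Gamma_mat_def krons_Cons mult_ac)
  finally show ?case .
qed

text \<open>The generators after the first are taken in pairs: (-i\<Gamma>C)(-i\<Gamma>C') = CC',
  since \<Gamma> anticommutes with C and \<Gamma>^2 = 1. They multiply to the even product at
  parameter 1, a multiple of \<Gamma>, which the leading \<Gamma> turns into a scalar.\<close>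

lemma mat_prod_odd_clifford:
  "mat_prod (2 ^ k) (odd_clifford k) [1..<Suc (2 * k + 1)] = (- \<i>) ^ k \<cdot>\<^sub>m 1\<^sub>m
      (2 ^ k)"
proof -
  let ?d = "2 ^ k :: nat" and ?G = "Gamma_mat k" and ?C = "even_clifford k 1"
  note G = Gamma_mat[of k]
  have two: "odd_clifford k (Suc l) * (odd_clifford k (Suc m) * P) = ?C l * (?C m * P)"
    if l: "l \<in> {1..2 * k}" and m: "m \<in> {1..2 * k}" and P: "P \<in> carrier_mat ?d ?d" for l m P
  proof -
    have c: "?C l \<in> carrier_mat ?d ?d" "?C m \<in> carrier_mat ?d ?d"
        using even_clifford_carrier l m by auto
    let ?R = "?C m * P"
    have R: "?R \<in> carrier_mat ?d ?d" using c P by auto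
    have o: "odd_clifford k (Suc l) = (- \<i>) \<cdot>\<^sub>m (?G * ?C l)" "odd_clifford k (Suc m)
        = (- \<i>) \<cdot>\<^sub>m (?G * ?C m)"
      using l m by (auto simp: odd_clifford_def)
    have "odd_clifford k (Suc m) * P = (- \<i>) \<cdot>\<^sub>m (?G * ?R)"
      unfolding o using c G P by (simp add: mult_smult_assoc_mat[of _ ?d ?d] assoc_mult_mat[of _ ?d
          ?d _ ?d _ ?d])
    then have "odd_clifford k (Suc l) * (odd_clifford k (Suc m) * P) =
        ((- \<i>) * (- \<i>)) \<cdot>\<^sub>m (?G * ?C l * (?G * ?R))"
    proof -
      have A: "?G * ?C l \<in> carrier_mat ?d ?d" and B: "?G * ?R \<in> carrier_mat ?d ?d"
          using c G R by auto
      assume m: "odd_clifford k (Suc m) * P = (- \<i>) \<cdot>\<^sub>m (?G * ?R)"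
      show ?thesis
        unfolding m o(1) mult_smult_assoc_mat[OF A smult_carrier_mat[OF B]] mult_smult_distrib[OF A B]
          smult_smult_times ..
    qed
    also have "?G * ?C l * (?G * ?R) = (-1) \<cdot>\<^sub>m (?C l * ?R)"
    proof -
      have "?G * ?C l * (?G * ?R) = (-1) \<cdot>\<^sub>m (?C l * ?G * (?G * ?R))"
        unfolding Gamma_anticommute[OF l] using c G R by (intro mult_smult_assoc_mat) auto
      also have "?C l * ?G * (?G * ?R) = ?C l * (?G * (?G * ?R))"
        using c G R by (intro assoc_mult_mat) auto
      also have "?G * (?G * ?R) = ?G * ?G * ?R"
        using G R by (intro assoc_mult_mat[symmetric]) auto
      finally show ?thesis unfolding G(2) left_mult_one_mat[OF R] .
    qed
    finally show ?thesis by (simp add: smult_smult_times one_smult_mat)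
  qed
  have "mat_prod ?d (\<lambda>m. odd_clifford k (Suc m)) xs = mat_prod ?d ?C xs"
    if "even (length xs)" "set xs \<subseteq> {1..2 * k}" for xs
    using that
  proof (induction xs rule: induct_list012)
    case (3 x y zs)
    then have "mat_prod ?d ?C zs \<in> carrier_mat ?d ?d"
      by (intro mat_prod_carrier even_clifford_carrier) auto
    then show ?case using 3 two[of x y] by simp
  qed auto
  moreover have "[1..<Suc (2 * k + 1)] = 1 # map Suc [1..<Suc (2 * k)]"
    by (simp add: upt_conv_Cons map_Suc_upt del: upt_Suc)
  ultimately have "mat_prod ?d (odd_clifford k) [1..<Suc (2 * k + 1)] =
      ?G * mat_prod ?d ?C [1..<Suc (2 * k)]"
    by (simp add: mat_prod_map odd_clifford_def[of k "Suc 0"] atLeastLessThanSuc_atLeastAtMost del: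
        upt_Suc)
  also have "\<dots> = (- \<i>) ^ k \<cdot>\<^sub>m (?G * ?G)"
    unfolding mat_prod_even_clifford using G by (simp add: mult_smult_distrib[of _ ?d ?d])
  finally show ?thesis using G by simp
qed

section \<open>The representations on monomials\<close>

lemma dpi_simps:
  fixes b :: "nat \<Rightarrow> 'v::euclidean_space"
  assumes "orthonormal_basis b"
  shows "dpi b \<zeta> u \<in> H_carrier DIM('v)" "dpi b \<zeta> 1 = H_one DIM('v)"
    "dpi b \<zeta> (u + v) = H_add (dpi b \<zeta> u) (dpi b \<zeta> v)"
    "dpi b \<zeta> (r *\<^sub>R u) = H_smult (of_real r) (dpi b \<zeta> u)"
    "dpi b \<zeta> (u * v) = H_mult \<zeta> (dpi b \<zeta> u) (dpi b \<zeta> v)"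
    "j \<in> {1..DIM('v)} \<Longrightarrow> dpi b \<zeta> (uhc_vec (b j)) = H_smult (exp (\<i> *
        of_real (pi / 4))) (H_clifford DIM('v) \<zeta> j)"
    "dpi b \<zeta> uhc_z = H_smult (\<i> * \<zeta>) (H_one DIM('v))"
  using is_dpi_dpi[OF assms, of \<zeta>] unfolding is_dpi_def by auto

lemma dpi_z_mult:
  fixes b :: "nat \<Rightarrow> 'v::euclidean_space"
  assumes "orthonormal_basis b"
  shows "dpi b \<zeta> (uhc_z * u) = H_smult (\<i> * \<zeta>) (dpi b \<zeta> u)"
  using dpi_simps(1)[OF assms]
  by (simp add: dpi_simps[OF assms] H_bilinear(3)[where n = "DIM('v)"] H_one[where n = "DIM('v)"]
      H_closed)

lemma dpi_z_power_mult:
  fixes b :: "nat \<Rightarrow> 'v::euclidean_space"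
  assumes "orthonormal_basis b"
  shows "dpi b \<zeta> (uhc_z ^ k * u) = H_smult ((\<i> * \<zeta>) ^ k) (dpi b \<zeta> u)"
proof (induction k)
  case 0
  show ?case using H_linear(7)[OF dpi_simps(1)[OF assms]] by simp
next
  case (Suc k)
  then show ?case
    using dpi_simps(1)[OF assms]
    by (simp add: mult.assoc dpi_z_mult[OF assms] H_linear(6)[where n = "DIM('v)"])
qed

definition hc_trace :: "(nat \<Rightarrow> 'v::euclidean_space) \<Rightarrow> complex \<Rightarrow>
    'v uhc \<Rightarrow> complex" where
  "hc_trace b \<zeta> u = H_functional DIM('v) \<zeta> (dpi b \<zeta> u)"

lemma hc_trace_linear:
  assumes "orthonormal_basis b"
  shows "hc_trace b \<zeta> (u + v) = hc_trace b \<zeta> u + hc_trace b \<zeta> v"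
    "hc_trace b \<zeta> (r *\<^sub>R u) = of_real r * hc_trace b \<zeta> u"
    "hc_trace b \<zeta> (uhc_z * u) = \<i> * \<zeta> * hc_trace b \<zeta> u"
    "hc_trace b \<zeta> (uhc_z ^ k * u) = (\<i> * \<zeta>) ^ k * hc_trace b \<zeta> u"
  by (simp_all add: hc_trace_def dpi_simps(1-4)[OF assms] dpi_z_mult[OF assms] dpi_z_power_mult[OF assms]
      H_functional_linear)

lemma hc_trace_cyclic:
  fixes b :: "nat \<Rightarrow> 'v::euclidean_space"
  assumes b: "orthonormal_basis b" and j: "j \<in> {1..DIM('v)}"
  shows "hc_trace b \<zeta> (uhc_vec (b j) * u) = - ((-1) ^ DIM('v)) * hc_trace b \<zeta> (u *
      uhc_vec (b j))"
proof -
  let ?n = "DIM('v)"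
  note D = dpi_simps[OF b]
  have c: "H_clifford ?n \<zeta> j \<in> H_carrier ?n" by (rule H_clifford(1)[OF j j])
  have m: "H_mult \<zeta> (H_clifford ?n \<zeta> j) (dpi b \<zeta> u) \<in> H_carrier ?n"
    "H_mult \<zeta> (dpi b \<zeta> u) (H_clifford ?n \<zeta> j) \<in> H_carrier ?n"
    by (intro H_closed c D(1))+
  show ?thesis
    unfolding hc_trace_def D(5) D(6)[OF j] H_bilinear(3)[OF c D(1)] H_bilinear(4)[OF D(1) c]
      H_functional_linear(2)[OF m(1)] H_functional_linear(2)[OF m(2)]
      H_functional_cyclic[OF j D(1)] by simp
qed

lemma hc_trace_monomial_eq_0:
  fixes b :: "nat \<Rightarrow> 'v::euclidean_space"
  assumes b: "orthonormal_basis b" and "\<zeta> \<noteq> 0" "K \<subset> {1..DIM('v)}"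
  shows "hc_trace b \<zeta> (monomial b K) = 0"
proof (rule supertrace_monomial_eq_0[OF b, where \<tau> = "hc_trace b \<zeta>" and w = "\<i> * \<zeta>"])
  show "hc_trace b \<zeta> 1 = 0" if "odd DIM('v)"
    using that by (simp add: hc_trace_def dpi_simps[OF b] H_functional_one)
  show "hc_trace b \<zeta> (uhc_vec (b j) * u) = - ((-1) ^ DIM('v)) * hc_trace b \<zeta> (u *
      uhc_vec (b j))"
    if "j \<in> {1..DIM('v)}" for j u
    using that by (rule hc_trace_cyclic[OF b])
qed (use assms in \<open>simp_all add: hc_trace_linear[OF b]\<close>)

text \<open>For odd dimension each factor carries one \<epsilon>, so a product of length l lies in
  the component of \<epsilon>^l and carries \<zeta>^(l div 2). For even dimension the dependence on
  \<zeta> stays inside the matrices.\<close>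

lemma dpi_prod_list:
  fixes b :: "nat \<Rightarrow> 'v::euclidean_space"
  assumes b: "orthonormal_basis b" and "set xs \<subseteq> {1..DIM('v)}"
  defines "k \<equiv> DIM('v) div 2" and "d \<equiv> H_dim DIM('v)" and "e \<equiv> exp (\<i> *
      of_real (pi / 4))"
  shows "even DIM('v) \<Longrightarrow> dpi b \<zeta> (prod_list (map (\<lambda>j. uhc_vec (b j)) xs)) =
      (e ^ length xs \<cdot>\<^sub>m mat_prod d (even_clifford k \<zeta>) xs, 0\<^sub>m d d)" (is "_
          \<Longrightarrow> ?even xs")
    and "odd DIM('v) \<Longrightarrow> dpi b \<zeta> (prod_list (map (\<lambda>j. uhc_vec (b j)) xs)) =
      (if even (length xs)
       then ((e ^ length xs * \<zeta> ^ (length xs div 2)) \<cdot>\<^sub>m mat_prod d (odd_clifford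
           k) xs, 0\<^sub>m d d)
       else (0\<^sub>m d d, (e ^ length xs * \<zeta> ^ (length xs div 2)) \<cdot>\<^sub>m mat_prod d
           (odd_clifford k) xs))"
      (is "_ \<Longrightarrow> ?odd xs")
proof -
  note D = dpi_simps[OF b]
  have d: "d = 2 ^ k" by (simp add: d_def k_def H_dim_def)
  have De: "dpi b \<zeta> (uhc_vec (b x)) = H_smult e (H_clifford DIM('v) \<zeta> x)"
      if "x \<in> {1..DIM('v)}" for x
    using D(6)[OF that] by (simp only: e_def)
  have one: "H_one DIM('v) = (1 \<cdot>\<^sub>m 1\<^sub>m d, 0\<^sub>m d d)"
      by (simp add: H_one_def d_def one_smult_mat)
  show "?even xs" if "even DIM('v)"
    using assms(2)
  proof (induction xs)
    case Nil
    then show ?case by (simp add: D one)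
  next
    case (Cons x xs)
    then have x: "x \<in> {1..DIM('v)}" "\<And>y. y \<in> set (x # xs) \<Longrightarrow>
        even_clifford k \<zeta> y \<in> carrier_mat d d"
      using that unfolding d by (auto simp: k_def intro!: even_clifford_carrier)
    then have c: "even_clifford k \<zeta> x \<in> carrier_mat d d" "mat_prod d (even_clifford k
        \<zeta>) xs \<in> carrier_mat d d"
      by (auto intro!: mat_prod_carrier)
    then have "e \<cdot>\<^sub>m even_clifford k \<zeta> x * (e ^ length xs \<cdot>\<^sub>m mat_prod
        d (even_clifford k \<zeta>) xs) =
        e ^ Suc (length xs) \<cdot>\<^sub>m (even_clifford k \<zeta> x * mat_prod d (even_clifford k
            \<zeta>) xs)"
      by (simp add: mult_smult_assoc_mat[of _ d d] mult_smult_distrib[of _ d d] smult_smult_times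
          power_commutes mult.commute)
    moreover have "H_clifford DIM('v) \<zeta> x = (even_clifford k \<zeta> x, 0\<^sub>m d d)"
      using that by (simp add: H_clifford_def k_def d_def H_dim_def Let_def)
    ultimately show ?case
      using Cons c De[OF x(1)] by (simp add: D(5) H_mult_def H_smult_def)
  qed
  show "?odd xs" if "odd DIM('v)"
    using assms(2)
  proof (induction xs)
    case Nil
    then show ?case by (simp add: D one)
  next
    case (Cons x xs)
    then have x: "x \<in> {1..DIM('v)}" "\<And>y. y \<in> set (x # xs) \<Longrightarrow>
        odd_clifford k y \<in> carrier_mat d d"
      using that unfolding d by (auto simp: k_def intro!: odd_clifford(1))
    then have c: "odd_clifford k x \<in> carrier_mat d d" "mat_prod d (odd_clifford k) xs \<in>
        carrier_mat d d"
      by (auto intro!: mat_prod_carrier)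
    then have m: "e \<cdot>\<^sub>m odd_clifford k x * (w \<cdot>\<^sub>m mat_prod d (odd_clifford
        k) xs) =
        (e * w) \<cdot>\<^sub>m (odd_clifford k x * mat_prod d (odd_clifford k) xs)" for w
      by (simp add: mult_smult_assoc_mat[of _ d d] mult_smult_distrib[of _ d d] smult_smult_times
          power_commutes mult.commute)
    have h: "H_clifford DIM('v) \<zeta> x = (0\<^sub>m d d, odd_clifford k x)"
      using that by (simp add: H_clifford_odd k_def d_def)
    have xs: "?odd xs" using Cons by simp
    have "dpi b \<zeta> (prod_list (map (\<lambda>j. uhc_vec (b j)) (x # xs))) =
        H_mult \<zeta> (0\<^sub>m d d, e \<cdot>\<^sub>m odd_clifford k x) (dpi b \<zeta> (prod_list
            (map (\<lambda>j. uhc_vec (b j)) xs)))"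
      using De[OF x(1)] by (simp add: D(5) h H_smult_def)
    then show ?case
      unfolding xs using c by (auto simp: H_mult_def m smult_smult_times elim!: oddE simp: mult_ac)
  qed
qed

text \<open>For even dimension the product of the generators is a multiple of \<zeta>^k \<Gamma>,
  and the \<Gamma> in the supertrace makes it a scalar of trace 2^k up to constants. For odd
  dimension it is a multiple of \<zeta>^k \<epsilon>, and T adds one factor \<zeta>.\<close>

lemma hc_trace_gamma:
  fixes b :: "nat \<Rightarrow> 'v::euclidean_space"
  assumes b: "orthonormal_basis b"
  shows "\<exists>c. c \<noteq> 0 \<and> (\<forall>\<zeta>. hc_trace b \<zeta> (gamma_elt b) = c *
      \<zeta> ^ ((DIM('v) + 1) div 2))"
proof -
  let ?n = "DIM('v)" and ?e = "exp (\<i> * of_real (pi / 4))" and ?xs = "[1..<Suc DIM('v)]"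
  define k where "k = ?n div 2"
  have sub: "set ?xs \<subseteq> {1..?n}" by auto
  have d: "H_dim ?n = 2 ^ k" by (simp add: k_def H_dim_def)
  note P = dpi_prod_list[OF b sub]
  note G = Gamma_mat[of k]
  show ?thesis
  proof (cases "even ?n")
    case True
    then have n: "?n = 2 * k" by (simp add: k_def)
    have "hc_trace b \<zeta> (gamma_elt b) = ?e ^ ?n * (- \<i>) ^ k * 2 ^ k * \<zeta> ^ k" for \<zeta>
    proof -
      have "dpi b \<zeta> (gamma_elt b) = (?e ^ ?n \<cdot>\<^sub>m ((- \<i> * \<zeta>) ^ k
          \<cdot>\<^sub>m Gamma_mat k), 0\<^sub>m (2 ^ k) (2 ^ k))"
        using P(1)[OF True, of \<zeta>] mat_prod_even_clifford[of k \<zeta>]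
            unfolding gamma_elt_def d k_def[symmetric]
        by (simp add: n del: upt_Suc)
      moreover have "Gamma_mat k * ((?e ^ ?n * (- \<i> * \<zeta>) ^ k) \<cdot>\<^sub>m Gamma_mat k)
          = (?e ^ ?n * (- \<i> * \<zeta>) ^ k) \<cdot>\<^sub>m 1\<^sub>m (2 ^ k)"
        using mult_smult_distrib[OF G(1) G(1)] G(2) by simp
      ultimately show ?thesis
        using True mat_trace_smult[OF one_carrier_mat]
        by (simp add: hc_trace_def H_functional_even smult_smult_times mat_trace_one
            power_mult_distrib flip: k_def)
          (simp add: power_minus[of "\<i> * \<zeta>"] power_minus[of \<i>] power_mult_distrib)
    qed
    then show ?thesis
      using n by (intro exI[of _ "?e ^ ?n * (- \<i>) ^ k * 2 ^ k"]) simp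
  next
    case False
    then have n: "?n = 2 * k + 1" by (simp add: k_def)
    have "hc_trace b \<zeta> (gamma_elt b) = 2 * ?e * ?e ^ ?n * (- \<i>) ^ k * 2 ^ k * \<zeta> ^ Suc
        k" for \<zeta>
    proof -
      have "dpi b \<zeta> (gamma_elt b) = (0\<^sub>m (2 ^ k) (2 ^ k), (?e ^ ?n * \<zeta> ^ k)
          \<cdot>\<^sub>m ((- \<i>) ^ k \<cdot>\<^sub>m 1\<^sub>m (2 ^ k)))"
        using P(2)[OF False, of \<zeta>] mat_prod_odd_clifford[of k]
            unfolding gamma_elt_def d k_def[symmetric]
        by (simp add: n del: upt_Suc)
      then show ?thesis
        using False mat_trace_smult[OF one_carrier_mat] dpi_simps(1)[OF b, of \<zeta> "gamma_elt b"]
        by (simp add: hc_trace_def H_functional_odd smult_smult_times mat_trace_one)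
    qed
    then show ?thesis
      using n by (intro exI[of _ "2 * ?e * ?e ^ ?n * (- \<i>) ^ k * 2 ^ k"]) simp
  qed
qed

text \<open>Up to sign and powers of z the product of two monomials belongs to the symmetric
  difference, which is full only for complementary sets, and then no z occurs. That \<open>c\<close>
  is chosen before \<open>\<zeta>\<close> is what later permits arguments with polynomials in
  \<zeta>.\<close>

lemma hc_trace_pairing:
  fixes b :: "nat \<Rightarrow> 'v::euclidean_space"
  assumes b: "orthonormal_basis b"
  shows "\<exists>c. (\<forall>I. c I \<noteq> 0) \<and> (\<forall>\<zeta> I J. \<zeta> \<noteq> 0
      \<longrightarrow> I \<subseteq> {1..DIM('v)} \<longrightarrow> J \<subseteq> {1..DIM('v)}
          \<longrightarrow>
    hc_trace b \<zeta> (monomial b J * monomial b I) =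
      (if J = {1..DIM('v)} - I then c I * \<zeta> ^ ((DIM('v) + 1) div 2) else 0))"
proof -
  let ?N = "{1..DIM('v)}"
  obtain c where c: "c \<noteq> 0" "\<And>\<zeta>. hc_trace b \<zeta> (gamma_elt b) = c * \<zeta> ^
      ((DIM('v) + 1) div 2)"
    using hc_trace_gamma[OF b] by blast
  have "\<exists>s. s \<in> {1, -1} \<and> (I \<subseteq> ?N \<longrightarrow> monomial b (?N - I) *
      monomial b I = s *\<^sub>R gamma_elt b)" for I
  proof (cases "I \<subseteq> ?N")
    case True
    then have "sym_diff (?N - I) I = ?N" "(?N - I) \<inter> I = {}" by auto
    then show ?thesis
      using monomial_mult[OF b, of "?N - I" I] monomial_full[of b] by auto
  qed auto
  then obtain s where s: "\<And>I. s I \<in> {1, -1 :: real}"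
    "\<And>I. I \<subseteq> ?N \<Longrightarrow> monomial b (?N - I) * monomial b I = s I *\<^sub>R
        gamma_elt b" by metis
  have "hc_trace b \<zeta> (monomial b J * monomial b I) =
      (if J = ?N - I then of_real (s I) * c * \<zeta> ^ ((DIM('v) + 1) div 2) else 0)"
    if z: "\<zeta> \<noteq> 0" and I: "I \<subseteq> ?N" and J: "J \<subseteq> ?N" for \<zeta> I J
  proof (cases "J = ?N - I")
    case True
    then show ?thesis using s(2)[OF I] c(2) by (simp add: hc_trace_linear[OF b])
  next
    case False
    then have "sym_diff J I \<subset> ?N" using I J by auto
    then have "hc_trace b \<zeta> (monomial b (sym_diff J I)) = 0"
      by (rule hc_trace_monomial_eq_0[OF b z])
    moreover obtain t where "monomial b J * monomial b I =
        t *\<^sub>R (uhc_z ^ card (J \<inter> I) * monomial b (sym_diff J I))"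
      using monomial_mult[OF b J, of I] by blast
    ultimately show ?thesis using False by (simp add: hc_trace_linear[OF b])
  qed
  moreover have "of_real (s I) * c \<noteq> 0" for I using s(1)[of I] c(1) by auto
  ultimately show ?thesis by (intro exI[of _ "\<lambda>I. of_real (s I) * c"]) auto
qed

section \<open>Coordinates on the matrix algebra and dual bases\<close>

text \<open>A one-sided inverse of a square matrix is two-sided. Enumerations carry this over to
  families indexed by two different sets of equal size, here subsets and matrix coordinates.\<close>

lemma finite_square_inverse:
  fixes f :: "'y \<Rightarrow> 'x \<Rightarrow> complex"
  assumes fin: "finite X" "finite Y" and card: "card X = card Y"
    and left: "\<And>y y'. y \<in> Y \<Longrightarrow> y' \<in> Y \<Longrightarrow> (\<Sum>x\<in>X.
        f y x * h x y') = (if y = y' then 1 else 0)"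
    and x: "x \<in> X" "x' \<in> X"
  shows "(\<Sum>y\<in>Y. h x y * f y x') = (if x = x' then 1 else 0)"
proof -
  define N where "N = card X"
  obtain p where p: "bij_betw p {0..<N} X" using ex_bij_betw_nat_finite[OF fin(1)] by (auto simp: N_def)
  obtain q where q: "bij_betw q {0..<N} Y" using ex_bij_betw_nat_finite[OF fin(2)] card
      by (auto simp: N_def)
  define A where "A = Matrix.mat N N (\<lambda>(i, j). f (q i) (p j))"
  define B where "B = Matrix.mat N N (\<lambda>(i, j). h (p i) (q j))"
  have AB: "A \<in> carrier_mat N N" "B \<in> carrier_mat N N" by (auto simp: A_def B_def)
  have "A * B = 1\<^sub>m N"
  proof (rule eq_matI)
    fix i j assume "i < dim_row (1\<^sub>m N :: complex mat)" "j < dim_col (1\<^sub>m N :: complex mat)"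
    then have ij: "i < N" "j < N" by auto
    have "(A * B) $$ (i, j) = (\<Sum>l\<in>{0..<N}. f (q i) (p l) * h (p l) (q j))"
      using ij by (simp add: A_def B_def scalar_prod_def)
    also have "\<dots> = (\<Sum>x\<in>X. f (q i) x * h x (q j))"
      by (rule sum.reindex_bij_betw[OF p])
    also have "\<dots> = (if q i = q j then 1 else 0)"
      using ij q by (intro left) (auto simp: bij_betw_def)
    also have "q i = q j \<longleftrightarrow> i = j" using ij q by (auto simp: bij_betw_def inj_on_def)
    finally show "(A * B) $$ (i, j) = 1\<^sub>m N $$ (i, j)" using ij by simp
  qed (use AB in auto)
  then have BA: "B * A = 1\<^sub>m N" by (rule mat_mult_left_right_inverse[OF AB])
  have "x \<in> p ` {0..<N}" "x' \<in> p ` {0..<N}" using x p by (simp_all add: bij_betw_def)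
  then obtain i j where ij: "i < N" "p i = x" "j < N" "p j = x'" by auto
  have "(\<Sum>y\<in>Y. h x y * f y x') = (\<Sum>l\<in>{0..<N}. h x (q l) * f (q l) x')"
    by (rule sum.reindex_bij_betw[OF q, symmetric])
  also have "\<dots> = (B * A) $$ (i, j)"
    using ij by (simp add: A_def B_def scalar_prod_def)
  also have "\<dots> = (if i = j then 1 else 0)" unfolding BA using ij by simp
  also have "i = j \<longleftrightarrow> x = x'" using ij p by (auto simp: bij_betw_def inj_on_def)
  finally show ?thesis .
qed

text \<open>The Boolean marks the \<epsilon>-component. It is fixed for even \<open>n\<close>, where
  that component is zero, so that the coordinates number 2^n in both parities.\<close>

definition H_index :: "nat \<Rightarrow> (bool \<times> nat \<times> nat) set" where
  "H_index n = (if even n then {False} else UNIV) \<times> {..<H_dim n} \<times> {..<H_dim n}"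

definition H_entry :: "hmat \<Rightarrow> bool \<times> nat \<times> nat \<Rightarrow> complex" where
  "H_entry A i = (if fst i then snd A else fst A) $$ snd i"

lemma finite_H_index: "finite (H_index n)" and card_H_index: "card (H_index n) = 2 ^ n"
proof -
  show "finite (H_index n)" by (simp add: H_index_def)
  show "card (H_index n) = 2 ^ n"
  proof (cases "even n")
    case True
    then show ?thesis by (auto simp: H_index_def H_dim_def card_cartesian_product simp flip:
        power_add elim!: evenE)
  next
    case False
    then show ?thesis by (auto simp: H_index_def H_dim_def card_cartesian_product card_UNIV_bool
        simp flip: power_add elim!: oddE)
  qed
qed

lemma H_entry_eqI:
  assumes "A \<in> H_carrier n" "B \<in> H_carrier n" "\<And>i. i \<in> H_index n \<Longrightarrow>
      H_entry A i = H_entry B i"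
  shows "A = B"
proof (rule H_eqI[OF assms(1,2)])
  fix p q assume pq: "p < H_dim n" "q < H_dim n"
  show "fst A $$ (p, q) = fst B $$ (p, q)"
    using assms(3)[of "(False, p, q)"] pq by (simp add: H_index_def H_entry_def)
  show "snd A $$ (p, q) = snd B $$ (p, q)"
    using assms(3)[of "(True, p, q)"] pq H_carrierD(3)[OF assms(1)] H_carrierD(3)[OF assms(2)]
    by (cases "even n") (simp_all add: H_index_def H_entry_def)
qed

lemma H_entry_simps:
  assumes "i \<in> H_index n"
  shows "H_entry (H_zero n) i = 0"
    "A \<in> H_carrier n \<Longrightarrow> H_entry (H_smult c A) i = c * H_entry A i"
    "A \<in> H_carrier n \<Longrightarrow> B \<in> H_carrier n \<Longrightarrow> H_entry (H_add A B)
        i = H_entry A i + H_entry B i"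
  using assms by (auto simp: H_index_def H_entry_def H_entries)

lemma H_entire_iff:
  "H_entire n A \<longleftrightarrow> (\<forall>\<zeta>. A \<zeta> \<in> H_carrier n) \<and>
      (\<forall>i\<in>H_index n. (\<lambda>\<zeta>. H_entry (A \<zeta>) i) holomorphic_on UNIV)"
proof
  assume "H_entire n A"
  moreover from this have "(\<lambda>\<zeta>. (if e then snd (A \<zeta>) else fst (A \<zeta>)) $$
      (p, q)) holomorphic_on UNIV"
    if "p < H_dim n" "q < H_dim n" for e p q
    using that by (cases e) (simp_all add: H_entire_def)
  ultimately show "(\<forall>\<zeta>. A \<zeta> \<in> H_carrier n) \<and> (\<forall>i\<in>H_index n.
      (\<lambda>\<zeta>. H_entry (A \<zeta>) i) holomorphic_on UNIV)"
    by (auto simp: H_entire_def H_index_def H_entry_def)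
next
  assume A: "(\<forall>\<zeta>. A \<zeta> \<in> H_carrier n) \<and> (\<forall>i\<in>H_index n.
      (\<lambda>\<zeta>. H_entry (A \<zeta>) i) holomorphic_on UNIV)"
  have "(\<lambda>\<zeta>. fst (A \<zeta>) $$ (p, q)) holomorphic_on UNIV" "(\<lambda>\<zeta>. snd
      (A \<zeta>) $$ (p, q)) holomorphic_on UNIV"
    if "p < H_dim n" "q < H_dim n" for p q
  proof -
    show "(\<lambda>\<zeta>. fst (A \<zeta>) $$ (p, q)) holomorphic_on UNIV"
      using conjunct2[OF A, rule_format, of "(False, p, q)"] that by (simp add: H_index_def H_entry_def)
    show "(\<lambda>\<zeta>. snd (A \<zeta>) $$ (p, q)) holomorphic_on UNIV"
    proof (cases "even n")
      case True
      then have "snd (A \<zeta>) = 0\<^sub>m (H_dim n) (H_dim n)" for \<zeta>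
        using A H_carrierD(3) by blast
      then show ?thesis using that by simp
    next
      case False
      then show ?thesis
        using conjunct2[OF A, rule_format, of "(True, p, q)"] that by (simp add: H_index_def H_entry_def)
    qed
  qed
  with A show "H_entire n A" by (simp add: H_entire_def)
qed

text \<open>The coefficients of the linear functional \<open>A \<mapsto> T(A X)\<close>.\<close>

definition H_dual :: "nat \<Rightarrow> complex \<Rightarrow> hmat \<Rightarrow> bool \<times> nat
    \<times> nat \<Rightarrow> complex" where
  "H_dual n \<zeta> X = (\<lambda>(e, p, q).
    if even n then (fst X * Gamma_mat (n div 2)) $$ (q, p)
    else 2 * exp (\<i> * of_real (pi / 4)) * \<zeta> * (if e then fst X else snd X) $$ (q, p))"

lemma mat_trace_mult:
  "A \<in> carrier_mat d d \<Longrightarrow> B \<in> carrier_mat d d \<Longrightarrow>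
    mat_trace (A * B) = (\<Sum>(p, q)\<in>{..<d} \<times> {..<d}. A $$ (p, q) * B $$ (q, p))"
  unfolding sum.cartesian_product[symmetric]
  by (auto simp: mat_trace_def scalar_prod_def lessThan_atLeast0 intro!: sum.cong)

text \<open>For even \<open>n\<close>, cyclicity of the trace moves \<Gamma> behind X and leaves A
  in front. For odd \<open>n\<close> the \<epsilon>-part of a product mixes components, so each
  component of A is paired with the opposite one of X.\<close>

lemma H_functional_mult:
  assumes A: "A \<in> H_carrier n" and X: "X \<in> H_carrier n"
  shows "H_functional n \<zeta> (H_mult \<zeta> A X) = (\<Sum>i\<in>H_index n. H_entry A i * H_dual
      n \<zeta> X i)"
proof -
  let ?d = "H_dim n" and ?G = "Gamma_mat (n div 2)"
  note a = H_carrierD(1,2)[OF A] and x = H_carrierD(1,2)[OF X]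
  have G: "?G \<in> carrier_mat ?d ?d" using Gamma_mat(1) by (simp add: H_dim_def)
  show ?thesis
  proof (cases "even n")
    case True
    have "fst (H_mult \<zeta> A X) = fst A * fst X"
      using a x H_carrierD(3)[OF A True] by (simp add: H_mult_def)
    moreover have "mat_trace (?G * (fst A * fst X)) = mat_trace (fst A * fst X * ?G)"
      using a x G by (intro mat_trace_commute) auto
    moreover have "fst A * fst X * ?G = fst A * (fst X * ?G)" using a x G by (intro assoc_mult_mat) auto
    ultimately have "H_functional n \<zeta> (H_mult \<zeta> A X) =
        (\<Sum>(p, q)\<in>{..<?d} \<times> {..<?d}. fst A $$ (p, q) * (fst X * ?G) $$ (q, p))"
      using True a x G by (simp add: H_functional_even mat_trace_mult[of _ ?d])
    also have "\<dots> = (\<Sum>i\<in>H_index n. H_entry A i * H_dual n \<zeta> X i)"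
      using True by (intro sum.reindex_bij_witness[of _ snd "\<lambda>x. (False, x)"])
        (auto simp: H_index_def H_entry_def H_dual_def)
    finally show ?thesis .
  next
    case False
    let ?c = "2 * exp (\<i> * of_real (pi / 4)) * \<zeta>" and ?D = "{..<?d} \<times> {..<?d}"
    have "H_functional n \<zeta> (H_mult \<zeta> A X) = ?c * (mat_trace (fst A * snd X) + mat_trace
        (snd A * fst X))"
      using False a x by (simp add: H_functional_odd H_closed A X) (simp add: H_mult_def
          mat_trace_add[of _ ?d])
    also have "\<dots> = (\<Sum>x\<in>?D. H_entry A (False, x) * H_dual n \<zeta> X (False, x)) +
        (\<Sum>x\<in>?D. H_entry A (True, x) * H_dual n \<zeta> X (True, x))"
      using False a x by (simp add: mat_trace_mult[of _ ?d] H_entry_def H_dual_def distrib_left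
          sum_distrib_left case_prod_beta mult_ac)
    also have "\<dots> = (\<Sum>e\<in>UNIV. \<Sum>x\<in>?D. H_entry A (e, x) * H_dual n \<zeta> X
        (e, x))"
      by (simp add: UNIV_bool)
    also have "\<dots> = (\<Sum>i\<in>H_index n. H_entry A i * H_dual n \<zeta> X i)"
      using False by (simp add: H_index_def sum.cartesian_product)
    finally show ?thesis .
  qed
qed

text \<open>
  There are as many monomials as entries, so the monomials and their duals form a basis and its
  dual basis.
\<close>

lemma H_eq_by_traces:
  fixes b :: "nat \<Rightarrow> 'v::euclidean_space"
  assumes b: "orthonormal_basis b" and z: "\<zeta> \<noteq> 0"
    and A: "A \<in> H_carrier DIM('v)" and B: "B \<in> H_carrier DIM('v)"
    and eq: "\<And>I. I \<subseteq> {1..DIM('v)} \<Longrightarrow> H_functional DIM('v) \<zeta>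
        (H_mult \<zeta> A (dpi b \<zeta> (monomial b I))) =
      H_functional DIM('v) \<zeta> (H_mult \<zeta> B (dpi b \<zeta> (monomial b I)))"
  shows "A = B"
proof -
  let ?n = "DIM('v)" and ?N = "{1..DIM('v)}"
  let ?X = "H_index ?n" and ?Y = "Pow ?N"
  note D = dpi_simps[OF b]
  obtain c where c: "\<And>I. c I \<noteq> 0" "\<And>I J. I \<subseteq> ?N \<Longrightarrow> J
      \<subseteq> ?N \<Longrightarrow>
    hc_trace b \<zeta> (monomial b J * monomial b I) = (if J = ?N - I then c I * \<zeta> ^ ((?n + 1)
        div 2) else 0)"
    using hc_trace_pairing[OF b] z by metis
  define w where "w I = c I * \<zeta> ^ ((?n + 1) div 2)" for I
  have w: "w I \<noteq> 0" for I using c(1) z by (simp add: w_def)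
  define f where "f I = (\<lambda>i. H_dual ?n \<zeta> (dpi b \<zeta> (monomial b I)) i / w I)" for I
  \<comment> \<open>Under the pairing the monomial of the complement is dual to that of
    \<open>I\<close>; dividing by \<open>w I\<close> normalises the dual functionals
    \<open>f\<close>.\<close>
  define h where "h i I = H_entry (dpi b \<zeta> (monomial b (?N - I))) i" for i I
  have coeff: "(\<Sum>i\<in>?X. f I i * H_entry C i) = H_functional ?n \<zeta> (H_mult \<zeta> C
      (dpi b \<zeta> (monomial b I))) / w I"
    if "C \<in> H_carrier ?n" for C I
    using that by (simp add: f_def H_functional_mult D(1) sum_divide_distrib mult.commute)
  have left: "(\<Sum>i\<in>?X. f I i * h i J) = (if I = J then 1 else 0)"
      if "I \<in> ?Y" "J \<in> ?Y" for I J
  proof -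
    have "(\<Sum>i\<in>?X. f I i * h i J) = hc_trace b \<zeta> (monomial b (?N - J) * monomial b I)
        / w I"
      unfolding h_def coeff[OF D(1)] by (simp add: hc_trace_def D(5))
    also have "\<dots> = (if ?N - J = ?N - I then 1 else 0)"
      using that w[of I] by (subst c(2)) (auto simp: w_def)
    also have "?N - J = ?N - I \<longleftrightarrow> I = J" using that by blast
    finally show ?thesis .
  qed
  have "card ?X = card ?Y" by (simp add: card_H_index card_Pow)
  then have right: "(\<Sum>I\<in>?Y. h i I * f I j) = (if i = j then 1 else 0)"
      if "i \<in> ?X" "j \<in> ?X" for i j
    using left that by (intro finite_square_inverse[where X = ?X]) (auto simp: finite_H_index)
  \<comment> \<open>The reversed inverse relation recovers every entry from the pairings with the
    monomials.\<close>
  have expand: "H_entry C j = (\<Sum>I\<in>?Y. h j I * (\<Sum>i\<in>?X. f I i * H_entry C i))"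
      if "j \<in> ?X" for C j
  proof -
    have "H_entry C j = (\<Sum>i\<in>?X. (if j = i then 1 else 0) * H_entry C i)"
      using that finite_H_index by (simp add: if_distrib[of "\<lambda>x. x * _"] cong: if_cong)
    also have "\<dots> = (\<Sum>i\<in>?X. (\<Sum>I\<in>?Y. h j I * f I i) * H_entry C i)"
      by (intro sum.cong) (simp_all only: right that)
    also have "\<dots> = (\<Sum>I\<in>?Y. h j I * (\<Sum>i\<in>?X. f I i * H_entry C i))"
      by (simp only: sum_distrib_left sum_distrib_right mult.assoc) (rule sum.swap)
    finally show ?thesis .
  qed
  show ?thesis
  proof (rule H_entry_eqI[OF A B])
    fix j assume "j \<in> ?X"
    then show "H_entry A j = H_entry B j"
      unfolding expand[OF \<open>j \<in> ?X\<close>, of A] expand[OF \<open>j \<in> ?X\<close>, of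
          B] coeff[OF A] coeff[OF B]
      using eq by (intro sum.cong) auto
  qed
qed

section \<open>A basis of the enveloping algebra\<close>

text \<open>Multiplying by the complement of \<open>K\<close> and taking the trace annihilates every
  term with \<open>I\<close> different from \<open>K\<close>. What remains is the polynomial with
  coefficients \<open>r (k, K)\<close> at w = i\<zeta>, times a nonzero number.\<close>

lemma monomials_linearly_independent:
  fixes b :: "nat \<Rightarrow> 'v::euclidean_space"
  assumes b: "orthonormal_basis b" and S: "finite S" "S \<subseteq> UNIV \<times> Pow {1..DIM('v)}"
    and zero: "(\<Sum>(k, I)\<in>S. r (k, I) *\<^sub>R (uhc_z ^ k * monomial b I)) = 0" and kI: "(l,
        K) \<in> S"
  shows "r (l, K) = 0"
proof -
  let ?n = "DIM('v)" and ?N = "{1..DIM('v)}"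
  obtain c where c: "\<And>I. c I \<noteq> 0" "\<And>\<zeta> I J. \<zeta> \<noteq> 0
      \<Longrightarrow> I \<subseteq> ?N \<Longrightarrow> J \<subseteq> ?N \<Longrightarrow>
    hc_trace b \<zeta> (monomial b J * monomial b I) = (if J = ?N - I then c I * \<zeta> ^ ((?n + 1)
        div 2) else 0)"
    using hc_trace_pairing[OF b] by metis
  have K: "K \<subseteq> ?N" using kI S by auto
  define L where "L \<zeta> u = hc_trace b \<zeta> (u * monomial b (?N - K))" for \<zeta> u
  have lin: "linear (L \<zeta>)" for \<zeta>
    by (rule linearI) (simp_all add: L_def distrib_right hc_trace_linear[OF b]
        scaleR_conv_of_real[where 'a = complex])
  have L: "L \<zeta> (uhc_z ^ k * monomial b I) = (if I = K then (\<i> * \<zeta>) ^ k * (c (?N - K)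
      * \<zeta> ^ ((?n + 1) div 2)) else 0)"
    if "\<zeta> \<noteq> 0" "I \<subseteq> ?N" for \<zeta> k I
  proof -
    have "?N - (?N - K) = K" using K by auto
    then show ?thesis
      using c(2)[OF that(1) _ that(2), of "?N - K"]
          by (auto simp: L_def mult.assoc hc_trace_linear[OF b])
  qed
  define T where "T = {k. (k, K) \<in> S}"
  have "T \<subseteq> fst ` S" by (force simp: T_def)
  then have T: "finite T" "l \<in> T"
    using S(1) kI by (auto simp: T_def intro: finite_subset)
  define p where "p = (\<Sum>k\<in>T. monom (complex_of_real (r (k, K))) k)"
  \<comment> \<open>The trace argument says nothing at w = 0; the extra linear factor vanishes
    there.\<close>
  have "poly (p * [:0, 1:]) w = 0" for w
  proof (cases "w = 0")
    case False
    define \<zeta> where "\<zeta> = - \<i> * w"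
    have \<zeta>: "\<zeta> \<noteq> 0" "\<i> * \<zeta> = w" using False by (auto simp: \<zeta>_def)
    have "0 = L \<zeta> (\<Sum>(k, I)\<in>S. r (k, I) *\<^sub>R (uhc_z ^ k * monomial b I))"
      unfolding zero by (rule linear_0[OF lin, symmetric])
    also have "\<dots> = (\<Sum>(k, I)\<in>S. r (k, I) *\<^sub>R L \<zeta> (uhc_z ^ k * monomial b I))"
      by (simp add: linear_sum[OF lin] linear_scale[OF lin] case_prod_beta)
    also have "\<dots> = (\<Sum>(k, I)\<in>S. if I = K then of_real (r (k, K)) * w ^ k * (c (?N - K)
        * \<zeta> ^ ((?n + 1) div 2)) else 0)"
      using S(2) by (intro sum.cong) (auto simp: L \<zeta> scaleR_conv_of_real)
    also have "\<dots> = (\<Sum>(k, I)\<in>(\<lambda>k. (k, K)) ` T. of_real (r (k, K)) * w ^ k * (c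
        (?N - K) * \<zeta> ^ ((?n + 1) div 2)))"
      by (rule sum.mono_neutral_cong_right[OF S(1)]) (auto simp: T_def)
    also have "\<dots> = (\<Sum>k\<in>T. of_real (r (k, K)) * w ^ k * (c (?N - K) * \<zeta> ^ ((?n +
        1) div 2)))"
      by (subst sum.reindex) (auto simp: inj_on_def)
    also have "\<dots> = poly p w * (c (?N - K) * \<zeta> ^ ((?n + 1) div 2))"
      by (simp add: p_def poly_sum poly_monom sum_distrib_right)
    finally show ?thesis using c(1) \<zeta>(1) by simp
  qed simp
  then have "p * [:0, 1:] = 0" using poly_all_0_iff_0 by blast
  then have "p = 0" by simp
  then have "coeff p l = 0" by simp
  then show ?thesis using T by (simp add: p_def coeff_sum sum.delta)
qed

text \<open>Independence of the set of products does not exclude that two indices give the same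
  product. Injectivity is therefore proved separately, so that \<open>\<phi>\<close> becomes a
  well-defined function on the set and extends linearly.\<close>

lemma linear_on_monomials_exists:
  fixes b :: "nat \<Rightarrow> 'v::euclidean_space" and \<phi> :: "nat \<Rightarrow> nat set
      \<Rightarrow> 'c::real_vector"
  assumes b: "orthonormal_basis b"
  shows "\<exists>L. linear L \<and> (\<forall>k I. I \<subseteq> {1..DIM('v)} \<longrightarrow> L
      (uhc_z ^ k * monomial b I) = \<phi> k I)"
proof -
  let ?P = "UNIV \<times> Pow {1..DIM('v)}" and ?v = "\<lambda>(k, I). uhc_z ^ k * monomial b I"
  note ind = monomials_linearly_independent[OF b]
  have inj: "inj_on ?v ?P"
  proof (rule inj_onI, rule ccontr)
    fix p q assume pq: "p \<in> ?P" "q \<in> ?P" "?v p = ?v q" "p \<noteq> q"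
    then have "(\<Sum>x\<in>{p, q}. (if x = p then 1 else - 1 :: real) *\<^sub>R ?v x) = 0" by simp
    then have "(if p = p then 1 else - 1 :: real) = 0"
      using pq ind[of "{p, q}" "\<lambda>x. if x = p then 1 else - 1" "fst p" "snd p"]
          by (auto simp: case_prod_beta)
    then show False by simp
  qed
  have "independent (?v ` ?P)"
  proof
    assume "dependent (?v ` ?P)"
    then obtain S u x where S: "finite S" "S \<subseteq> ?v ` ?P" "x \<in> S" "u x \<noteq> 0"
        "(\<Sum>v\<in>S. u v *\<^sub>R v) = 0"
      unfolding dependent_explicit by blast
    then obtain R where R: "finite R" "R \<subseteq> ?P" "S = ?v ` R" by (meson finite_subset_image)
    have "(\<Sum>p\<in>R. u (?v p) *\<^sub>R ?v p) = 0"
      using S(5) inj_on_subset[OF inj R(2)] unfolding R(3) by (simp add: sum.reindex)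
    moreover obtain k I where "(k, I) \<in> R" "x = ?v (k, I)" using S(3) R(3) by auto
    ultimately have "u (?v (k, I)) = 0"
      using ind[OF R(1,2), of "\<lambda>p. u (?v p)" k I] by (simp add: case_prod_beta)
    then show False using S(4) \<open>x = ?v (k, I)\<close> by simp
  qed
  then obtain L where L: "linear L" "\<forall>x\<in>?v ` ?P. L x = (\<lambda>(k, I). \<phi> k I)
      (inv_into ?P ?v x)"
    using linear_independent_extend[of "?v ` ?P" "\<lambda>x. (\<lambda>(k, I). \<phi> k I)
        (inv_into ?P ?v x)"] by blast
  have "L (uhc_z ^ k * monomial b I) = \<phi> k I" if "I \<subseteq> {1..DIM('v)}" for k I
  proof -
    have kI: "(k, I) \<in> ?P" using that by auto
    have "L (?v (k, I)) = (\<lambda>(k, I). \<phi> k I) (inv_into ?P ?v (?v (k, I)))"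
        using L(2) kI by blast
    then show ?thesis unfolding inv_into_f_f[OF inj kI] by simp
  qed
  with L(1) show ?thesis by blast
qed

section \<open>Holomorphic dependence on \<zeta>\<close>

lemma even_clifford_holomorphic:
  assumes "m \<in> {1..2 * k}" "p < 2 ^ k" "q < 2 ^ k"
  shows "(\<lambda>\<zeta>. even_clifford k \<zeta> m $$ (p, q)) holomorphic_on UNIV"
  using assms
proof (induction k arbitrary: m p q)
  case (Suc k)
  let ?d = "2 ^ k :: nat"
  have pq: "p div ?d < 2" "q div ?d < 2" "p mod ?d < ?d" "q mod ?d < ?d"
    using Suc.prems by (simp_all add: less_mult_imp_div_less)
  have K: "kron A B $$ (p, q) = A $$ (p div ?d, q div ?d) * B $$ (p mod ?d, q mod ?d)"
    if "A \<in> carrier_mat 2 2" "B \<in> carrier_mat ?d ?d" for A B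
    using that Suc.prems by (simp add: kron_def)
  have XY: "(\<lambda>\<zeta>. X_mat \<zeta> $$ (i, j)) holomorphic_on UNIV" "(\<lambda>\<zeta>.
      Y_mat \<zeta> $$ (i, j)) holomorphic_on UNIV"
    if "i < 2" "j < 2" for i j
    using that by (auto simp: X_mat_def Y_mat_def mat_of_rows_list_def numeral_2_eq_2 less_Suc_eq
        intro!: holomorphic_intros)
  consider "m = 1" | "m = 2" | l where "m = Suc (Suc l)" "l \<in> {1..2 * k}"
    using Suc.prems(1) by (cases m rule: nat.exhaust; cases "m - 1" rule: nat.exhaust; cases "m - 2"
        rule: nat.exhaust) auto
  then show ?case
  proof cases
    case 1
    then show ?thesis
      unfolding 1 even_clifford_Suc(1) K[OF basic_carrier(2) one_carrier_mat]
      by (intro holomorphic_intros XY pq)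
  next
    case 2
    then show ?thesis
      unfolding 2 even_clifford_Suc(2) K[OF basic_carrier(3) one_carrier_mat]
      by (intro holomorphic_intros XY pq)
  next
    case 3
    then have "even_clifford (Suc k) \<zeta> m = kron sigma_mat (even_clifford k \<zeta> l)" for \<zeta>
      using even_clifford_Suc(3)[of l k \<zeta>] by simp
    then have "even_clifford (Suc k) \<zeta> m $$ (p, q) =
        sigma_mat $$ (p div ?d, q div ?d) * even_clifford k \<zeta> l $$ (p mod ?d, q mod ?d)"
            for \<zeta>
      using K[OF basic_carrier(1) even_clifford_carrier[OF 3(2)]] by simp
    then show ?thesis
      by (simp only:) (intro holomorphic_intros Suc.IH 3(2) pq)
  qed
qed simp

text \<open>The multiplication itself varies with \<zeta>, but the entries of a product are
  polynomials in \<zeta> and the entries of the factors.\<close>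

lemma H_entire_H_mult:
  assumes A: "H_entire n A" and B: "H_entire n B"
  shows "H_entire n (\<lambda>\<zeta>. H_mult \<zeta> (A \<zeta>) (B \<zeta>))"
  using assms unfolding H_entire_def
  by (auto simp: H_entries H_closed intro!: holomorphic_intros)

lemma dpi_monomial_entire:
  fixes b :: "nat \<Rightarrow> 'v::euclidean_space"
  assumes b: "orthonormal_basis b"
  shows "H_entire DIM('v) (\<lambda>\<zeta>. dpi b \<zeta> (monomial b I))"
proof -
  let ?n = "DIM('v)"
  note D = dpi_simps[OF b]
  have one: "H_entire ?n (\<lambda>\<zeta>. dpi b \<zeta> 1)"
    unfolding H_entire_def D(2) using H_closed(2)[of ?n] by simp
  have vec: "H_entire ?n (\<lambda>\<zeta>. dpi b \<zeta> (uhc_vec (b j)))" if j: "j \<in> {1..?n}" for j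
  proof -
    have "(\<lambda>\<zeta>. fst (H_clifford ?n \<zeta> j) $$ (p, q)) holomorphic_on UNIV \<and>
        (\<lambda>\<zeta>. snd (H_clifford ?n \<zeta> j) $$ (p, q)) holomorphic_on UNIV"
            if pq: "p < H_dim ?n" "q < H_dim ?n" for p q
    proof (cases "even ?n")
      case True
      then have "j \<in> {1..2 * (?n div 2)}" using j by simp
      then show ?thesis
        using True pq even_clifford_holomorphic[of j "?n div 2" p q]
        by (simp add: H_clifford_def Let_def H_dim_def)
    qed (simp add: H_clifford_odd)
    then show ?thesis
      unfolding H_entire_def D(6)[OF j]
      using H_clifford(1)[OF j j] by (auto simp: H_closed H_entries intro!: holomorphic_intros)
  qed
  have "H_entire ?n (\<lambda>\<zeta>. dpi b \<zeta> (clifford_word b I xs))"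
      if "set xs \<subseteq> {1..?n}" for xs
    using that
  proof (induction xs)
    case (Cons x xs)
    then show ?case using H_entire_H_mult[OF vec[of x]] by (simp add: D(5))
  qed (simp add: one)
  then show ?thesis by (simp add: monomial_def atLeastLessThanSuc_atLeastAtMost del: upt_Suc)
qed

lemma H_entire_reflect:
  assumes "H_entire n A"
  shows "H_entire n (\<lambda>\<zeta>. A (- \<zeta>))"
proof -
  have "(\<lambda>\<zeta>. f (- \<zeta>)) holomorphic_on UNIV" if "f holomorphic_on UNIV"
      for f :: "complex \<Rightarrow> complex"
    using holomorphic_on_compose_gen[OF _ that, of uminus UNIV] by (simp add: o_def holomorphic_on_minus)
  then show ?thesis using assms unfolding H_entire_def by auto
qed

text \<open>In coordinates the pairing is a finite sum of entries of \<open>A\<close> times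
  coefficients that depend on \<open>X (- \<zeta>)\<close> and, for odd \<open>n\<close>, on one
  linear factor \<zeta>.\<close>

lemma H_functional_holomorphic:
  assumes A: "H_entire n A" and X: "H_entire n X"
  shows "(\<lambda>\<zeta>. H_functional n (- \<zeta>) (H_mult (- \<zeta>) (A \<zeta>) (X (-
      \<zeta>)))) holomorphic_on UNIV"
proof -
  have X': "H_entire n (\<lambda>\<zeta>. X (- \<zeta>))" by (rule H_entire_reflect[OF X])
  have G: "Gamma_mat (n div 2) \<in> carrier_mat (H_dim n) (H_dim n)" using Gamma_mat(1)
      by (simp add: H_dim_def)
  have car: "A \<zeta> \<in> H_carrier n" "X \<zeta> \<in> H_carrier n" for \<zeta> using A X
      by (simp_all add: H_entire_def)
  have "(\<lambda>\<zeta>. H_dual n (- \<zeta>) (X (- \<zeta>)) i) holomorphic_on UNIV"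
      if i: "i \<in> H_index n" for i
  proof -
    obtain e p q where epq: "i = (e, p, q)" "p < H_dim n" "q < H_dim n" using i
        by (auto simp: H_index_def)
    show ?thesis
    proof (cases "even n")
      case True
      have "(\<lambda>\<zeta>. (fst (X (- \<zeta>)) * Gamma_mat (n div 2)) $$ (q, p)) =
          (\<lambda>\<zeta>. \<Sum>r<H_dim n. fst (X (- \<zeta>)) $$ (q, r) * Gamma_mat (n div 2) $$
            (r, p))"
        using epq H_dims[OF car(2)] G by (auto simp: scalar_prod_def lessThan_atLeast0)
      then show ?thesis
        using True X' epq by (auto simp: H_dual_def H_entire_def intro!: holomorphic_intros)
    next
      case False
      then show ?thesis
        using X' epq by (cases e) (auto simp: H_dual_def H_entire_def intro!: holomorphic_intros)
    qed
  qed
  then show ?thesis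
    using A unfolding H_functional_mult[OF car] H_entire_iff by (intro holomorphic_intros) auto
qed

section \<open>The Fourier transform\<close>

lemma HC_smooth_supportedD:
  assumes "F \<in> HC_smooth_supported a"
  shows "linear (\<lambda>u. F u x)" "(F u has_vector_derivative F (uhc_z * u) x) (at x)"
    "continuous_on UNIV (F u)" "\<bar>x\<bar> > a \<Longrightarrow> F u x = 0"
proof -
  show "linear (\<lambda>u. F u x)" and deriv: "\<And>x. (F u has_vector_derivative F (uhc_z * u) x)
      (at x)"
    using assms by (auto simp: HC_smooth_supported_def HC_smooth_def)
  then show "continuous_on UNIV (F u)"
    by (auto simp: continuous_on_eq_continuous_at intro: has_vector_derivative_continuous)
  show "F u x = 0" if "\<bar>x\<bar> > a"
  proof (rule ccontr)
    assume "F u x \<noteq> 0"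
    then have "x \<in> closure {x. F u x \<noteq> 0}" by (intro subsetD[OF closure_subset]) simp
    then show False using assms that by (force simp: HC_smooth_supported_def)
  qed
qed

lemma fourier_HC:
  assumes F: "F \<in> HC_smooth_supported a"
  shows "fourier (F (u + v)) \<zeta> = fourier (F u) \<zeta> + fourier (F v) \<zeta>"
    "fourier (F (r *\<^sub>R u)) \<zeta> = of_real r * fourier (F u) \<zeta>"
    "fourier (F (uhc_z * u)) \<zeta> = \<i> * \<zeta> * fourier (F u) \<zeta>"
    "fourier (F (uhc_z ^ k * u)) \<zeta> = (\<i> * \<zeta>) ^ k * fourier (F u) \<zeta>"
proof -
  note D = HC_smooth_supportedD[OF F]
  have int: "integrable lborel (\<lambda>t. F u t * exp (- \<i> * \<zeta> * of_real t))" for u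
    by (rule compact_support_integrable_exp(1)[OF D(3,4)])
  show "fourier (F (u + v)) \<zeta> = fourier (F u) \<zeta> + fourier (F v) \<zeta>"
    using Bochner_Integration.integral_add[OF int int, of u v]
    by (simp add: fourier_def linear_add[OF D(1)] distrib_right)
  show "fourier (F (r *\<^sub>R u)) \<zeta> = of_real r * fourier (F u) \<zeta>"
    unfolding fourier_def linear_scale[OF D(1)] scaleR_conv_of_real[where 'a = complex] mult.assoc
        integral_mult_right_zero ..
  show *: "fourier (F (uhc_z * u)) \<zeta> = \<i> * \<zeta> * fourier (F u) \<zeta>" for u
    by (rule fourier_derivative[OF D(2,3,4,4)])
  show "fourier (F (uhc_z ^ k * u)) \<zeta> = (\<i> * \<zeta>) ^ k * fourier (F u) \<zeta>"
    by (induction k) (simp_all add: * mult.assoc)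
qed

text \<open>(i\<zeta>)^k times the transform of F(u) is the transform of F(z^k u), which has the
  same support bound. The cases k = 0 and k = N suffice, because (1 + r)^N \<le> 2^N (1 + r^N) for r
  \<ge> 0.\<close>

lemma rapid_exponential_fourier:
  assumes F: "F \<in> HC_smooth_supported a"
  shows "rapid_exponential a (fourier (F u))"
  unfolding rapid_exponential_def
proof
  fix N :: nat
  note D = HC_smooth_supportedD[OF F]
  define B where "B k = (\<integral>t. norm (F (uhc_z ^ k * u) t) \<partial>lborel)" for k
  have B: "norm \<zeta> ^ k * norm (fourier (F u) \<zeta>) \<le> B k * exp (a * \<bar>Im
      \<zeta>\<bar>)" for k \<zeta>
    using fourier_bound[OF D(3)[of "uhc_z ^ k * u"] D(4)[where u = "uhc_z ^ k * u"], where \<zeta> =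
        \<zeta>] unfolding fourier_HC(4)[OF F]
    by (simp add: norm_mult norm_power B_def)
  have "norm (fourier (F u) \<zeta>) \<le> 2 ^ N * (B 0 + B N) * exp (a * \<bar>Im \<zeta>\<bar>) /
      (1 + norm \<zeta>) ^ N" for \<zeta>
  proof -
    have "(1 + norm \<zeta>) ^ N \<le> (2 * max 1 (norm \<zeta>)) ^ N" by (intro power_mono) auto
    also have "\<dots> \<le> 2 ^ N * (1 + norm \<zeta> ^ N)"
      by (simp add: power_mult_distrib max_def)
    finally have "(1 + norm \<zeta>) ^ N * norm (fourier (F u) \<zeta>) \<le>
        2 ^ N * (1 + norm \<zeta> ^ N) * norm (fourier (F u) \<zeta>)" by (rule mult_right_mono) simp
    also have "\<dots> = 2 ^ N * (norm \<zeta> ^ 0 * norm (fourier (F u) \<zeta>) + norm \<zeta> ^ N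
        * norm (fourier (F u) \<zeta>))"
      by (simp add: algebra_simps)
    also have "\<dots> \<le> 2 ^ N * (B 0 * exp (a * \<bar>Im \<zeta>\<bar>) + B N * exp (a *
        \<bar>Im \<zeta>\<bar>))"
      by (intro mult_left_mono add_mono B) simp
    finally have "norm (fourier (F u) \<zeta>) * (1 + norm \<zeta>) ^ N \<le> 2 ^ N * (B 0 + B N) *
        exp (a * \<bar>Im \<zeta>\<bar>)"
      by (simp add: algebra_simps)
    moreover have "(1 + norm \<zeta>) ^ N > 0" by (simp add: add_pos_nonneg)
    ultimately show ?thesis by (simp only: pos_le_divide_eq)
  qed
  then show "\<exists>C. \<forall>\<zeta>. norm (fourier (F u) \<zeta>) \<le> C * exp (a * \<bar>Im
      \<zeta>\<bar>) / (1 + norm \<zeta>) ^ N" by blast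
qed

text \<open>Each entry of a summand is bilinear in the two tensor factors, hence induces a linear
  map on the tensor product. So the sum depends only on the coproduct of \<gamma>, not on the
  expansion chosen by \<open>SOME\<close>, and the expansion into complementary monomials may be
  used.\<close>

lemma HC_fourier_entries:
  fixes b :: "nat \<Rightarrow> 'v::euclidean_space"
  assumes b: "orthonormal_basis b"
  shows "HC_fourier b F \<zeta> \<in> H_carrier DIM('v)"
    and "\<exists>s. (\<forall>I. s I \<in> {1, -1 :: real}) \<and> (\<forall>F a \<zeta>. F \<in>
        HC_smooth_supported a \<longrightarrow> (\<forall>i\<in>H_index DIM('v).
      H_entry (HC_fourier b F \<zeta>) i = (\<Sum>I\<in>Pow {1..DIM('v)}. of_real (s I) *
        (fourier (F (monomial b I)) \<zeta> * H_entry (dpi b (- \<zeta>) (monomial b ({1..DIM('v)} -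
            I))) i))))"
proof -
  let ?n = "DIM('v)" and ?N = "{1..DIM('v)}"
  note D = dpi_simps[OF b]
  define gs where "gs = (SOME gs. coproduct_expansion b gs)"
  have gs: "coproduct_expansion b gs"
    unfolding gs_def by (rule someI_ex[OF coproduct_expansion_exists])
  let ?fold = "\<lambda>F \<zeta> gs. foldr (\<lambda>(x, y). H_add (H_smult (fourier (F x) \<zeta>)
      (dpi b (- \<zeta>) y))) gs (H_zero ?n)"
  have hat: "HC_fourier b F \<zeta> = ?fold F \<zeta> gs" for F \<zeta>
    unfolding HC_fourier_def fourier_def gs_def ..
  have car: "?fold F \<zeta> hs \<in> H_carrier ?n" for F \<zeta> hs
    by (induction hs) (auto intro!: H_closed D(1))
  then show "HC_fourier b F \<zeta> \<in> H_carrier ?n" by (simp add: hat)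
  have entry: "H_entry (?fold F \<zeta> hs) i = sum_list (map (\<lambda>(x, y). fourier (F x)
      \<zeta> * H_entry (dpi b (- \<zeta>) y) i) hs)"
    if "i \<in> H_index ?n" for F \<zeta> hs i
    by (induction hs) (auto simp: H_entry_simps[OF that] H_closed D(1) car)
  obtain s where s: "\<And>I. s I \<in> {1, -1 :: real}" "coproduct (gamma_elt b) =
    (\<Sum>I\<in>Pow ?N. s I *\<^sub>R (monomial b I \<otimes>\<^sub>s monomial b (?N - I)))"
    using coproduct_gamma[of b] by blast
  have "H_entry (HC_fourier b F \<zeta>) i = (\<Sum>I\<in>Pow ?N. of_real (s I) *
      (fourier (F (monomial b I)) \<zeta> * H_entry (dpi b (- \<zeta>) (monomial b (?N - I))) i))"
    if F: "F \<in> HC_smooth_supported a" and i: "i \<in> H_index ?n" for F a \<zeta> i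
  proof -
    let ?B = "\<lambda>x y. fourier (F x) \<zeta> * H_entry (dpi b (- \<zeta>) y) i"
    have bil: "bilinear ?B"
      unfolding bilinear_def
      by (auto intro!: linearI simp: fourier_HC(1,2)[OF F] D H_entry_simps[OF i] H_closed
          scaleR_conv_of_real[where 'a = complex] algebra_simps)
    note lin = linear_tensor_lift[OF bil]
    have sl: "tensor_lift ?B (sum_list (map (\<lambda>(x, y). x \<otimes>\<^sub>s y) hs)) = sum_list
        (map (\<lambda>(x, y). ?B x y) hs)" for hs
      by (induction hs) (auto simp: linear_0[OF lin] linear_add[OF lin] tensor_lift_pure[OF bil])
    have "H_entry (HC_fourier b F \<zeta>) i = tensor_lift ?B (coproduct (gamma_elt b))"
      using gs unfolding coproduct_expansion_def hat entry[OF i] by (simp add: sl)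
    also have "\<dots> = (\<Sum>I\<in>Pow ?N. s I *\<^sub>R ?B (monomial b I) (monomial b (?N - I)))"
      unfolding s(2) by (simp add: linear_sum[OF lin] linear_scale[OF lin] tensor_lift_pure[OF bil])
    finally show ?thesis by (simp add: scaleR_conv_of_real)
  qed
  with s(1) show "\<exists>s. (\<forall>I. s I \<in> {1, -1 :: real}) \<and> (\<forall>F a \<zeta>.
      F \<in> HC_smooth_supported a \<longrightarrow> (\<forall>i\<in>H_index ?n.
      H_entry (HC_fourier b F \<zeta>) i = (\<Sum>I\<in>Pow ?N. of_real (s I) *
        (fourier (F (monomial b I)) \<zeta> * H_entry (dpi b (- \<zeta>) (monomial b (?N - I)))
            i))))" by blast
qed

text \<open>In the expansion over J the trace pairing leaves only J = I. The representation is taken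
  at -\<zeta>, whence a factor (-1)^[n] in \<open>d\<close>, which depends neither on F nor on
  \<zeta>.\<close>

lemma HC_fourier_trace:
  fixes b :: "nat \<Rightarrow> 'v::euclidean_space"
  assumes b: "orthonormal_basis b"
  shows "\<exists>d. (\<forall>I. d I \<noteq> 0) \<and> (\<forall>F a \<zeta> I. F \<in>
      HC_smooth_supported a \<longrightarrow> \<zeta> \<noteq> 0 \<longrightarrow> I \<subseteq>
          {1..DIM('v)} \<longrightarrow>
    H_functional DIM('v) (- \<zeta>) (H_mult (- \<zeta>) (HC_fourier b F \<zeta>) (dpi b (- \<zeta>)
        (monomial b I))) =
      d I * \<zeta> ^ ((DIM('v) + 1) div 2) * fourier (F (monomial b I)) \<zeta>)"
proof -
  let ?n = "DIM('v)" and ?N = "{1..DIM('v)}"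
  note D = dpi_simps[OF b] and car = HC_fourier_entries(1)[OF b]
  define m where "m = (DIM('v) + 1) div 2"
  obtain s where s: "\<And>I. s I \<in> {1, -1 :: real}" "\<And>F a \<zeta> i. F \<in>
      HC_smooth_supported a \<Longrightarrow> i \<in> H_index ?n \<Longrightarrow>
      H_entry (HC_fourier b F \<zeta>) i = (\<Sum>J\<in>Pow ?N. of_real (s J) *
        (fourier (F (monomial b J)) \<zeta> * H_entry (dpi b (- \<zeta>) (monomial b (?N - J))) i))"
    using HC_fourier_entries(2)[OF b] by blast
  obtain c where c: "\<And>I. c I \<noteq> 0" "\<And>\<zeta> I J. \<zeta> \<noteq> 0
      \<Longrightarrow> I \<subseteq> ?N \<Longrightarrow> J \<subseteq> ?N \<Longrightarrow>
    hc_trace b \<zeta> (monomial b J * monomial b I) = (if J = ?N - I then c I * \<zeta> ^ m else 0)"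
    using hc_trace_pairing[OF b] unfolding m_def by metis
  have "H_functional ?n (- \<zeta>) (H_mult (- \<zeta>) (HC_fourier b F \<zeta>) (dpi b (- \<zeta>)
      (monomial b I))) =
      (of_real (s I) * c I * (-1) ^ m) * \<zeta> ^ m * fourier (F (monomial b I)) \<zeta>"
    if F: "F \<in> HC_smooth_supported a" and z: "\<zeta> \<noteq> 0" and I: "I \<subseteq> ?N"
        for F a \<zeta> I
  proof -
    let ?X = "dpi b (- \<zeta>) (monomial b I)" and ?f = "\<lambda>J. of_real (s J) * fourier (F
        (monomial b J)) \<zeta>"
    have "H_functional ?n (- \<zeta>) (H_mult (- \<zeta>) (HC_fourier b F \<zeta>) ?X) =
        (\<Sum>i\<in>H_index ?n. \<Sum>J\<in>Pow ?N. ?f J * (H_entry (dpi b (- \<zeta>) (monomial b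
            (?N - J))) i * H_dual ?n (- \<zeta>) ?X i))"
      by (simp add: H_functional_mult[OF car D(1)] s(2)[OF F] sum_distrib_right mult.assoc)
    also have "\<dots> = (\<Sum>J\<in>Pow ?N. \<Sum>i\<in>H_index ?n. ?f J * (H_entry (dpi b (-
        \<zeta>) (monomial b (?N - J))) i * H_dual ?n (- \<zeta>) ?X i))"
      by (rule sum.swap)
    also have "\<dots> = (\<Sum>J\<in>Pow ?N. ?f J * hc_trace b (- \<zeta>) (monomial b (?N - J) *
        monomial b I))"
      by (simp add: hc_trace_def D(5) H_functional_mult[OF D(1) D(1)] sum_distrib_left)
    also have "\<dots> = (\<Sum>J\<in>Pow ?N. if J = I then ?f I * (c I * (- \<zeta>) ^ m) else 0)"
    proof (rule sum.cong[OF refl])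
      fix J assume J: "J \<in> Pow ?N"
      have "?N - J = ?N - I \<longleftrightarrow> J = I" using J I by blast
      then show "?f J * hc_trace b (- \<zeta>) (monomial b (?N - J) * monomial b I) =
          (if J = I then ?f I * (c I * (- \<zeta>) ^ m) else 0)"
        using c(2)[of "- \<zeta>" I "?N - J"] z I by auto
    qed
    also have "\<dots> = ?f I * (c I * (- \<zeta>) ^ m)" using I by (simp add: finite_Pow_iff)
    also have "(- \<zeta>) ^ m = (-1) ^ m * \<zeta> ^ m" by (rule power_minus)
    finally show ?thesis by (simp add: mult_ac)
  qed
  moreover have "of_real (s I) * c I * (-1) ^ m \<noteq> 0" for I using s(1)[of I] c(1)[of I] by auto
  ultimately show ?thesis
    unfolding m_def by (intro exI[of _ "\<lambda>I. of_real (s I) * c I * (-1) ^ ((DIM('v) + 1) div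
        2)"]) blast
qed

section \<open>The Fourier transform as a bijection\<close>

text \<open>Carries to \<zeta> = 0 the equalities that the trace pairing yields only
  elsewhere.\<close>

lemma continuous_eq_at_0:
  fixes f g :: "complex \<Rightarrow> complex"
  assumes "continuous_on UNIV f" "continuous_on UNIV g" "\<And>z. z \<noteq> 0 \<Longrightarrow> f z
      = g z"
  shows "f = g"
proof
  fix z
  show "f z = g z"
  proof (cases "z = 0")
    case True
    have "f \<midarrow>0\<rightarrow> f 0" "g \<midarrow>0\<rightarrow> g 0" using assms
        by (auto simp: continuous_on_def)
    moreover have "f \<midarrow>0\<rightarrow> g 0"
      by (rule Lim_transform_eventually[OF \<open>g \<midarrow>0\<rightarrow> g 0\<close>]) (auto
          simp: eventually_at_filter assms(3))
    ultimately show ?thesis using True by (auto intro: LIM_unique)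
  qed (rule assms(3))
qed

lemma smooth_from_derivatives:
  assumes "\<And>k x. (f k has_vector_derivative f (Suc k) x) (at x)"
  shows "smooth (f 0)"
proof -
  have "((\<lambda>g x. vector_derivative g (at x)) ^^ k) (f 0) = f k" for k
    by (induction k) (auto simp: vector_derivative_at[OF assms])
  then show ?thesis
    using assms by (auto simp: smooth_def differentiable_on_def intro: differentiableI_vector
        differentiable_at_withinI)
qed

text \<open>Bounds with a fixed N are stable under linear combinations, so it suffices to treat z^k
  \<open>\<gamma>\<^sub>I\<close>. There the quotient is a constant times the transform of F(z^k
  \<open>\<gamma>\<^sub>I\<close>).\<close>

lemma HC_fourier_in_paley_wiener:
  fixes b :: "nat \<Rightarrow> 'v::euclidean_space"
  assumes b: "orthonormal_basis b" and F: "F \<in> HC_smooth_supported a"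
  shows "HC_fourier b F \<in> paley_wiener b a"
proof -
  let ?n = "DIM('v)" and ?N = "{1..DIM('v)}" and ?m = "(DIM('v) + 1) div 2"
  note D = dpi_simps[OF b] and car = HC_fourier_entries(1)[OF b] and Fs = HC_smooth_supportedD[OF F]
  have entire: "H_entire ?n (HC_fourier b F)"
  proof -
    obtain s where "\<And>F a \<zeta> i. F \<in> HC_smooth_supported a \<Longrightarrow> i \<in>
        H_index ?n \<Longrightarrow>
        H_entry (HC_fourier b F \<zeta>) i = (\<Sum>J\<in>Pow ?N. of_real (s J) *
          (fourier (F (monomial b J)) \<zeta> * H_entry (dpi b (- \<zeta>) (monomial b (?N - J))) i))"
      using HC_fourier_entries(2)[OF b] by blast
    note s = this[OF F]
    have "(\<lambda>\<zeta>. H_entry (HC_fourier b F \<zeta>) i) holomorphic_on UNIV"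
        if i: "i \<in> H_index ?n" for i
      unfolding s[OF i]
      using H_entire_reflect[OF dpi_monomial_entire[OF b]] i
      by (intro holomorphic_intros fourier_holomorphic[OF Fs(3,4)]) (auto simp: H_entire_iff)
    then show ?thesis using car by (simp add: H_entire_iff)
  qed
  obtain d where "\<And>F a \<zeta> I. F \<in> HC_smooth_supported a \<Longrightarrow> \<zeta>
      \<noteq> 0 \<Longrightarrow> I \<subseteq> ?N \<Longrightarrow>
      H_functional ?n (- \<zeta>) (H_mult (- \<zeta>) (HC_fourier b F \<zeta>) (dpi b (- \<zeta>)
          (monomial b I))) =
        d I * \<zeta> ^ ?m * fourier (F (monomial b I)) \<zeta>"
    using HC_fourier_trace[OF b] by metis
  note d = this[OF F]
  let ?T = "\<lambda>u \<zeta>. H_functional ?n (- \<zeta>) (H_mult (- \<zeta>) (HC_fourier b F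
      \<zeta>) (dpi b (- \<zeta>) u)) / \<zeta> ^ ?m"
  have mcar: "H_mult (- \<zeta>) (HC_fourier b F \<zeta>) (dpi b (- \<zeta>) u) \<in> H_carrier ?n"
      for \<zeta> u
    by (intro H_closed car D(1))
  have T_add: "?T (u + v) \<zeta> = ?T u \<zeta> + ?T v \<zeta>" for u v \<zeta>
    by (simp add: D(3) H_bilinear(2)[OF car D(1) D(1)] H_functional_linear(1)[OF mcar mcar]
        add_divide_distrib)
  have T_scale: "?T (r *\<^sub>R u) \<zeta> = of_real r * ?T u \<zeta>" for r u \<zeta>
    by (simp add: D(4) H_bilinear(4)[OF car D(1)] H_functional_linear(2)[OF mcar])
  \<comment> \<open>At -\<zeta> the element z acts by -i\<zeta>, whereas a derivative multiplies the
    transform by i\<zeta>; this accounts for (-1)^k.\<close>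
  have T_mono: "?T (uhc_z ^ k * monomial b I) \<zeta> = (-1) ^ k * d I * fourier (F (uhc_z ^ k *
      monomial b I)) \<zeta>"
    if "\<zeta> \<noteq> 0" "I \<subseteq> ?N" for k I \<zeta>
  proof -
    have "(\<i> * - \<zeta>) ^ k = (-1) ^ k * (\<i> * \<zeta>) ^ k" by (simp flip: power_mult_distrib)
    then show ?thesis
      using that by (simp add: dpi_z_power_mult[OF b] H_bilinear(4)[OF car D(1)]
          H_functional_linear(2)[OF mcar]
          d fourier_HC(4)[OF F])
  qed
  have bound: "\<exists>C. \<forall>\<zeta>. \<zeta> \<noteq> 0 \<longrightarrow> cmod (?T u
      \<zeta>) \<le> C * exp (a * \<bar>Im \<zeta>\<bar>) / (1 + cmod \<zeta>) ^ N" for N u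
    using span_monomials[OF b, of u]
  proof (induction rule: span_induct_alt)
    case base
    have zero: "?T 0 \<zeta> = 0" for \<zeta> using T_scale[where r = 0 and u = 0 and \<zeta> =
        \<zeta>] by simp
    show ?case by (intro exI[of _ 0]) (simp only: zero norm_zero mult_zero_left div_0 order_refl
        simp_thms)
  next
    case (step r x y)
    then obtain k I where x: "x = uhc_z ^ k * monomial b I" "I \<subseteq> ?N" by auto
    obtain C1 where C1: "\<And>\<zeta>. cmod (fourier (F x) \<zeta>) \<le> C1 * exp (a * \<bar>Im
        \<zeta>\<bar>) / (1 + cmod \<zeta>) ^ N"
      using rapid_exponential_fourier[OF F, of x] unfolding rapid_exponential_def by blast
    obtain C2 where C2: "\<And>\<zeta>. \<zeta> \<noteq> 0 \<Longrightarrow> cmod (?T y \<zeta>)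
        \<le> C2 * exp (a * \<bar>Im \<zeta>\<bar>) / (1 + cmod \<zeta>) ^ N"
      using step by blast
    have "cmod (?T (r *\<^sub>R x + y) \<zeta>) \<le> (\<bar>r\<bar> * cmod (d I) * C1 + C2) * exp
        (a * \<bar>Im \<zeta>\<bar>) / (1 + cmod \<zeta>) ^ N"
      if z: "\<zeta> \<noteq> 0" for \<zeta>
    proof -
      have "?T (r *\<^sub>R x + y) \<zeta> = of_real r * ((-1) ^ k * d I * fourier (F x) \<zeta>) +
          ?T y \<zeta>"
        unfolding T_add T_scale using T_mono[OF z x(2), of k] by (simp only: x(1))
      also have "cmod \<dots> \<le> \<bar>r\<bar> * cmod (d I) * cmod (fourier (F x) \<zeta>) + cmod
          (?T y \<zeta>)"
        by (rule order_trans[OF norm_triangle_ineq]) (simp add: norm_mult norm_power)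
      also have "\<dots> \<le> \<bar>r\<bar> * cmod (d I) * (C1 * exp (a * \<bar>Im \<zeta>\<bar>) /
          (1 + cmod \<zeta>) ^ N) +
          C2 * exp (a * \<bar>Im \<zeta>\<bar>) / (1 + cmod \<zeta>) ^ N"
        by (intro add_mono mult_left_mono C1 C2[OF z]) simp
      also have "\<dots> = (\<bar>r\<bar> * cmod (d I) * C1 + C2) * exp (a * \<bar>Im \<zeta>\<bar>)
          / (1 + cmod \<zeta>) ^ N"
        by (simp add: add_divide_distrib distrib_right mult.assoc)
      finally show ?thesis .
    qed
    then show ?case by blast
  qed
  show ?thesis unfolding paley_wiener_def using entire bound by simp
qed

lemma inj_on_HC_fourier:
  fixes b :: "nat \<Rightarrow> 'v::euclidean_space"
  assumes b: "orthonormal_basis b"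
  shows "inj_on (HC_fourier b) (HC_smooth_supported a)"
proof (rule inj_onI)
  let ?N = "{1..DIM('v)}"
  fix F G assume F: "F \<in> HC_smooth_supported a" and G: "G \<in> HC_smooth_supported a"
    and eq: "HC_fourier b F = HC_fourier b G"
  note DF = HC_smooth_supportedD[OF F] and DG = HC_smooth_supportedD[OF G]
  obtain d where d: "\<And>I. d I \<noteq> 0" "\<And>F a \<zeta> I. F \<in> HC_smooth_supported a
      \<Longrightarrow> \<zeta> \<noteq> 0 \<Longrightarrow> I \<subseteq> ?N \<Longrightarrow>
      H_functional DIM('v) (- \<zeta>) (H_mult (- \<zeta>) (HC_fourier b F \<zeta>) (dpi b (-
          \<zeta>) (monomial b I))) =
        d I * \<zeta> ^ ((DIM('v) + 1) div 2) * fourier (F (monomial b I)) \<zeta>"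
    using HC_fourier_trace[OF b] by metis
  have base: "F (monomial b I) = G (monomial b I)" if I: "I \<subseteq> ?N" for I
  proof -
    let ?u = "monomial b I"
    have "fourier (F ?u) \<zeta> = fourier (G ?u) \<zeta>" if "\<zeta> \<noteq> 0" for \<zeta>
      using d(1)[of I] d(2)[OF F that I] d(2)[OF G that I] that unfolding eq by simp
    then have hat: "fourier (F ?u) = fourier (G ?u)"
      by (intro continuous_eq_at_0 holomorphic_on_imp_continuous_on fourier_holomorphic DF(3) DG(3))
        (auto intro: DF(4) DG(4))
    have "F ?u x - G ?u x = 0" for x
    proof (rule fourier_eq_0_imp_eq_0[of "\<lambda>x. F ?u x - G ?u x" a])
      show "continuous_on UNIV (\<lambda>x. F ?u x - G ?u x)" by (intro continuous_intros DF(3) DG(3))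
      have "fourier (\<lambda>x. F ?u x - G ?u x) \<zeta> = fourier (F ?u) \<zeta> - fourier (G ?u)
          \<zeta>" for \<zeta>
        unfolding fourier_def left_diff_distrib
        by (intro Bochner_Integration.integral_diff compact_support_integrable_exp(1) DF(3) DG(3))
          (auto intro: DF(4) DG(4))
      then show "fourier (\<lambda>x. F ?u x - G ?u x) (of_real t) = 0" for t by (simp add: hat)
    qed (simp add: DF(4) DG(4))
    then show ?thesis by (intro ext) simp
  qed
  \<comment> \<open>Multiplication by z is differentiation, so agreement on the monomials passes to
    all powers of z.\<close>
  have mono: "F (uhc_z ^ k * monomial b I) = G (uhc_z ^ k * monomial b I)" if I: "I \<subseteq> ?N"
      for k I
  proof (induction k)
    case (Suc k)
    show ?case
      using DF(2)[of "uhc_z ^ k * monomial b I"] DG(2)[of "uhc_z ^ k * monomial b I"] unfolding Suc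
      by (auto simp: mult.assoc intro!: ext vector_derivative_unique_at)
  qed (simp add: base[OF I])
  have "F u x = G u x" for u x
    using span_monomials[OF b, of u]
  proof (induction rule: span_induct_alt)
    case base
    show ?case by (simp add: linear_0[OF DF(1)] linear_0[OF DG(1)])
  next
    case (step c u v)
    then have "F u = G u" using mono by auto
    with step show ?case
      by (simp only: linear_add[OF DF(1)] linear_add[OF DG(1)] linear_scale[OF DF(1)]
          linear_scale[OF DG(1)])
  qed
  then show "F = G" by blast
qed

text \<open>The normalised pairing of \<open>A\<close> with each monomial is the transform of some
  \<open>f I 0\<close>, by the scalar theorem. These functions and their derivatives define F on a
  basis; its transform has the same pairings as \<open>A\<close> for \<zeta> \<noteq> 0, hence
  equals \<open>A\<close> there, and then everywhere.\<close>

lemma paley_wiener_imp_HC_fourier: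
  fixes b :: "nat \<Rightarrow> 'v::euclidean_space"
  assumes b: "orthonormal_basis b" and A: "A \<in> paley_wiener b a"
  shows "\<exists>F\<in>HC_smooth_supported a. HC_fourier b F = A"
proof -
  let ?n = "DIM('v)" and ?N = "{1..DIM('v)}" and ?m = "(DIM('v) + 1) div 2"
  note D = dpi_simps[OF b] and car = HC_fourier_entries(1)[OF b]
  have ent: "H_entire ?n A" using A by (simp add: paley_wiener_def)
  let ?T = "\<lambda>I \<zeta>. H_functional ?n (- \<zeta>) (H_mult (- \<zeta>) (A \<zeta>) (dpi b
      (- \<zeta>) (monomial b I)))"
  have bound: "\<exists>C. \<forall>\<zeta>. \<zeta> \<noteq> 0 \<longrightarrow> cmod (?T I \<zeta>
      / \<zeta> ^ ?m) \<le> C * exp (a * \<bar>Im \<zeta>\<bar>) / (1 + cmod \<zeta>) ^ N" for I N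
    using A by (auto simp: paley_wiener_def)
  obtain d where d: "\<And>I. d I \<noteq> 0" "\<And>F a \<zeta> I. F \<in> HC_smooth_supported a
      \<Longrightarrow> \<zeta> \<noteq> 0 \<Longrightarrow> I \<subseteq> ?N \<Longrightarrow>
      H_functional ?n (- \<zeta>) (H_mult (- \<zeta>) (HC_fourier b F \<zeta>) (dpi b (- \<zeta>)
          (monomial b I))) =
        d I * \<zeta> ^ ?m * fourier (F (monomial b I)) \<zeta>"
    using HC_fourier_trace[OF b] by metis
  have "\<exists>f :: nat \<Rightarrow> real \<Rightarrow> complex. (\<forall>k x. (f k
      has_vector_derivative f (Suc k) x) (at x)) \<and>
      (\<forall>k x. \<bar>x\<bar> > a \<longrightarrow> f k x = 0) \<and> (\<forall>\<zeta>.
          \<zeta> \<noteq> 0 \<longrightarrow> d I * \<zeta> ^ ?m * fourier (f 0) \<zeta> = ?T I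
            \<zeta>)" for I
  proof -
    let ?h = "\<lambda>\<zeta>. ?T I \<zeta> / \<zeta> ^ ?m"
    have hol: "?h holomorphic_on (UNIV - {0})"
      using H_functional_holomorphic[OF ent dpi_monomial_entire[OF b], of I]
      by (intro holomorphic_intros) (auto intro: holomorphic_on_subset)
    \<comment> \<open>The growth condition with N = 0 bounds the quotient near 0, so the singularity
      is removable.\<close>
    have "\<exists>B. \<forall>\<^sub>F \<zeta> in at 0. cmod (?h \<zeta>) \<le> B"
    proof -
      obtain C where C: "\<And>\<zeta>. \<zeta> \<noteq> 0 \<Longrightarrow> cmod (?h \<zeta>) \<le>
          C * exp (a * \<bar>Im \<zeta>\<bar>)"
        using bound[of I 0] by auto
      have "((\<lambda>\<zeta>. C * exp (a * \<bar>Im \<zeta>\<bar>)) \<longlongrightarrow> C * exp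
          (a * \<bar>Im 0\<bar>)) (at 0)"
        by (intro tendsto_intros)
      then have "\<forall>\<^sub>F \<zeta> in at 0. C * exp (a * \<bar>Im \<zeta>\<bar>) < C + 1"
        by (rule order_tendstoD) simp
      then have "\<forall>\<^sub>F \<zeta> in at 0. cmod (?h \<zeta>) \<le> C + 1"
        unfolding eventually_at_filter by eventually_elim (use C in \<open>fastforce intro:
            order_trans\<close>)
      then show ?thesis by blast
    qed
    then obtain g where g: "g holomorphic_on UNIV" "\<And>\<zeta>. \<zeta> \<noteq> 0
        \<Longrightarrow> g \<zeta> = ?h \<zeta>"
      using holomorphic_on_extend_bounded[OF hol] by auto
    have decay: "rapid_exponential a (\<lambda>\<zeta>. g \<zeta> / d I)"
      unfolding rapid_exponential_def
    proof
      fix N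
      obtain C where C: "\<And>\<zeta>. \<zeta> \<noteq> 0 \<Longrightarrow> cmod (?h \<zeta>) \<le>
          C * exp (a * \<bar>Im \<zeta>\<bar>) / (1 + cmod \<zeta>) ^ N"
        using bound[of I N] by auto
      \<comment> \<open>The hypothesis omits \<zeta> = 0; there the exponential and the denominator
        are 1, so a bound for \<open>g 0\<close> has to be built into the constant.\<close>
      define C' where "C' = max C (cmod (g 0))"
      have "cmod (g \<zeta> / d I) \<le> C' / cmod (d I) * exp (a * \<bar>Im \<zeta>\<bar>) / (1 +
          cmod \<zeta>) ^ N" for \<zeta>
      proof -
        have "cmod (g \<zeta>) \<le> C' * exp (a * \<bar>Im \<zeta>\<bar>) / (1 + cmod \<zeta>) ^ N"
        proof (cases "\<zeta> = 0")
          case False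
          then have "cmod (g \<zeta>) \<le> C * exp (a * \<bar>Im \<zeta>\<bar>) / (1 + cmod
            \<zeta>) ^ N" using C g(2) by simp
          also have "\<dots> \<le> C' * exp (a * \<bar>Im \<zeta>\<bar>) / (1 + cmod \<zeta>) ^ N"
            by (intro divide_right_mono mult_right_mono) (auto simp: C'_def)
          finally show ?thesis .
        qed (simp add: C'_def)
        then have "cmod (g \<zeta>) / cmod (d I) \<le> C' * exp (a * \<bar>Im \<zeta>\<bar>) / (1 +
            cmod \<zeta>) ^ N / cmod (d I)"
          by (rule divide_right_mono) simp
        then show ?thesis by (simp add: norm_divide mult.commute)
      qed
      then show "\<exists>C. \<forall>\<zeta>. cmod (g \<zeta> / d I) \<le> C * exp (a * \<bar>Im
          \<zeta>\<bar>) / (1 + cmod \<zeta>) ^ N" by blast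
    qed
    have "(\<lambda>\<zeta>. g \<zeta> / d I) holomorphic_on UNIV" using d(1)
        by (intro holomorphic_intros g(1))
    from this decay obtain f :: "nat \<Rightarrow> real \<Rightarrow> complex" where f:
      "\<And>k x. (f k has_vector_derivative f (Suc k) x) (at x)"
      "\<And>k x. \<bar>x\<bar> > a \<Longrightarrow> f k x = 0" "\<And>\<zeta>. fourier (f 0)
          \<zeta> = g \<zeta> / d I"
      by (rule paley_wiener_surjective) (rule that)
    have "d I * \<zeta> ^ ?m * fourier (f 0) \<zeta> = ?T I \<zeta>" if "\<zeta> \<noteq> 0" for \<zeta>
      using that d(1)[of I] g(2)[OF that] by (simp add: f(3))
    with f(1,2) show ?thesis by blast
  qed
  then obtain f :: "nat set \<Rightarrow> nat \<Rightarrow> real \<Rightarrow> complex" where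
    f: "\<And>I k x. (f I k has_vector_derivative f I (Suc k) x) (at x)"
      "\<And>I k x. \<bar>x\<bar> > a \<Longrightarrow> f I k x = 0"
      "\<And>I \<zeta>. \<zeta> \<noteq> 0 \<Longrightarrow> d I * \<zeta> ^ ?m * fourier (f I 0)
          \<zeta> = ?T I \<zeta>" by metis
  \<comment> \<open>Values are extended linearly for each \<open>x\<close> separately. Regularity in
    \<open>x\<close> is recovered afterwards, as every \<open>u\<close> is a finite combination of
    basis elements.\<close>
  have "\<forall>x. \<exists>L. linear L \<and> (\<forall>k I. I \<subseteq> ?N \<longrightarrow> L
      (uhc_z ^ k * monomial b I) = f I k x)"
    by (intro allI linear_on_monomials_exists[OF b])
  then obtain L :: "real \<Rightarrow> 'v uhc \<Rightarrow> complex" where L: "\<And>x. linear (L x)"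
    "\<And>x k I. I \<subseteq> ?N \<Longrightarrow> L x (uhc_z ^ k * monomial b I) = f I k x" by metis
  define F where "F u x = L x u" for u x
  have lin: "linear (\<lambda>u. F u x)" for x using L(1) by (simp add: F_def)
  have mono: "F (uhc_z ^ k * monomial b I) = f I k" if "I \<subseteq> ?N" for k I
    using L(2)[OF that] by (auto simp: F_def)
  have deriv: "(F u has_vector_derivative F (uhc_z * u) x) (at x)" for u x
    using span_monomials[OF b, of u]
  proof (induction rule: span_induct_alt)
    case base
    have "F 0 = (\<lambda>_. 0)" using linear_0[OF lin] by auto
    then show ?case by simp
  next
    case (step c u v)
    then obtain k I where u: "u = uhc_z ^ k * monomial b I" "I \<subseteq> ?N" by auto
    have "F u = f I k" "F (uhc_z * u) = f I (Suc k)"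
      using mono[OF u(2), of k] mono[OF u(2), of "Suc k"] by (simp_all add: u(1) mult.assoc)
    then have "(F u has_vector_derivative F (uhc_z * u) x) (at x)" using f(1) by simp
    then have "((\<lambda>x. c *\<^sub>R F u x + F v x) has_vector_derivative (c *\<^sub>R F (uhc_z
        * u) x + F (uhc_z * v) x)) (at x)"
      using step by (intro has_vector_derivative_add bounded_linear.has_vector_derivative[OF
          bounded_linear_scaleR_right])
    moreover have "F (c *\<^sub>R u + v) = (\<lambda>x. c *\<^sub>R F u x + F v x)"
      by (rule ext) (simp only: linear_add[OF lin] linear_scale[OF lin])
    moreover have "F (uhc_z * (c *\<^sub>R u + v)) x = c *\<^sub>R F (uhc_z * u) x + F (uhc_z * v) x"
      by (simp only: distrib_left mult_scaleR_right linear_add[OF lin] linear_scale[OF lin])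
    ultimately show ?case by (simp only:)
  qed
  have supp: "F u x = 0" if x: "\<bar>x\<bar> > a" for u x
    using span_monomials[OF b, of u]
  proof (induction rule: span_induct_alt)
    case base
    show ?case by (simp only: linear_0[OF lin])
  next
    case (step c u v)
    then have "F u x = 0" using mono f(2)[OF x] by auto
    with step show ?case by (simp only: linear_add[OF lin] linear_scale[OF lin]) simp
  qed
  \<comment> \<open>By \<open>deriv\<close>, the iterated derivatives of \<open>F u\<close> are the
    functions F(z^k u).\<close>
  have "smooth (F u)" for u
    using smooth_from_derivatives[of "\<lambda>k. F (uhc_z ^ k * u)"] deriv by (simp add: mult.assoc)
  moreover have "closure {x. F u x \<noteq> 0} \<subseteq> {-a..a}" for u
  proof (rule closure_minimal)
    show "{x. F u x \<noteq> 0} \<subseteq> {-a..a}"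
    proof
      fix x assume "x \<in> {x. F u x \<noteq> 0}"
      then have "\<not> \<bar>x\<bar> > a" using supp by blast
      then show "x \<in> {-a..a}" by auto
    qed
  qed simp
  ultimately have F: "F \<in> HC_smooth_supported a"
    using lin deriv by (auto simp: HC_smooth_supported_def HC_smooth_def)
  have off_0: "HC_fourier b F \<zeta> = A \<zeta>" if z: "\<zeta> \<noteq> 0" for \<zeta>
  proof (rule H_eq_by_traces[OF b])
    show "- \<zeta> \<noteq> 0" using z by simp
    show "A \<zeta> \<in> H_carrier ?n" using ent by (simp add: H_entire_def)
    show "H_functional ?n (- \<zeta>) (H_mult (- \<zeta>) (HC_fourier b F \<zeta>) (dpi b (-
        \<zeta>) (monomial b I))) = ?T I \<zeta>"
      if I: "I \<subseteq> ?N" for I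
      using d(2)[OF F z I] f(3)[OF z, of I] mono[OF I, of 0] by simp
  qed (rule car)
  have ent': "H_entire ?n (HC_fourier b F)"
    using HC_fourier_in_paley_wiener[OF b F] by (simp add: paley_wiener_def)
  have "HC_fourier b F \<zeta> = A \<zeta>" for \<zeta>
  proof (rule H_entry_eqI)
    fix i assume i: "i \<in> H_index ?n"
    have "(\<lambda>\<zeta>. H_entry (HC_fourier b F \<zeta>) i) = (\<lambda>\<zeta>. H_entry (A
        \<zeta>) i)"
      using ent ent' i off_0
      by (intro continuous_eq_at_0 holomorphic_on_imp_continuous_on) (auto simp: H_entire_iff)
    then show "H_entry (HC_fourier b F \<zeta>) i = H_entry (A \<zeta>) i" by metis
  qed (use ent car in \<open>auto simp: H_entire_def\<close>)
  with F show ?thesis by blast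
qed

theorem theorem3:
  fixes b :: "nat \<Rightarrow> 'v::euclidean_space" and a :: real
  assumes "orthonormal_basis b" and "a > 0"
  shows "bij_betw (HC_fourier b) (HC_smooth_supported a) (paley_wiener b a)"
proof -
  have "HC_fourier b ` HC_smooth_supported a = paley_wiener b a"
    using HC_fourier_in_paley_wiener[OF assms(1)] paley_wiener_imp_HC_fourier[OF assms(1)] by blast
  then show ?thesis using inj_on_HC_fourier[OF assms(1)] by (simp add: bij_betw_def)
qed

end
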